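(* Fix $\lambda>0$ and an integer $d\ge 1$. Let $\alpha>0$ and let every link have capacity $D=D(n)$, where $D(n)\sim \alpha \frac{\ln n}{\ln\ln n}$ as $n\to\infty$. If $\alpha>2/d$, then $\alpha$ is $K$-good for some $K>0$; and if $\alpha\le 2/d$, then $\alpha$ is $K$-bad for each $K>0$. (The notions $K$-good and $K$-bad are defined in the context.)
   Context: Model. Let $V=\{1,\dots,n\}$ ($n\ge 3$) and let $E(K_n)$ be the set of unordered pairs of distinct nodes. For each $\{u,v\}\in E(K_n)$ there are two links $uv$ and $vu$, each of integer capacity $D=D(n)$. Calls arrive in a Poisson process of rate $\lambda\binom n2$; each call is an independent uniformly random element of $E(K_n)$. When a call $\{u,v\}$ arrives, nodes $w_1,\dots,w_d$ are selected independently and uniformly at random, with replacement, from $V\setminus\{u,v\}$. The candidate route via $w$ consists of the two links $uw$ and $vw$. The load of a link is the number of calls in progress using it; a link is saturated if its load equals $D$. A candidate route is available if neither of its two links is saturated. A general dynamic alternative routing (GDAR) algorithm accepts the call onto one of the available candidate routes if there is one (different versions of GDAR correspond to different rules for choosing among available candidate routes, based on the current loads); otherwise the call is lost (fails). FDAR (first-fit) is the version which always uses the first available candidate route in the order $w_1,\dots,w_d$. Call durations are exponential with mean $1$, independent of each other and of the arrivals and choices; when a call ends it frees both its links. For $e=\{u,v\}\in E(K_n)$ and $w\in V\setminus e$, $X_t(e,w)$ is the number of calls between $u$ and $v$ routed via $w$ in progress at time $t$. The load vector $X_t=(X_t(e,w))_{e,w}$ is a continuous-time jump Markov chain with a unique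 stationary distribution $\pi$. The initial state respects the capacities. Stochastic domination: load vectors are ordered coordinatewise, and a distribution $F$ is stochastically dominated by $G$ if there is a coupling $(Z,\tilde Z)$ with $Z\sim F$, $\tilde Z\sim G$ and $Z\le\tilde Z$ with probability 1. Burn-in time: for each $n$, if the distribution of $X_0$ is stochastically dominated by $\pi$ then $t_0=0$; otherwise $t_0=t_0(n)=5\ln n$. Let $K>0$. $\alpha$ is $K$-good if, whatever version of GDAR is used (and whatever the initial distribution), for each $t_1=t_1(n)\ge t_0$ the mean number of calls lost during $[t_1,t_1+n^K]$ is $o(1)$ as $n\to\infty$. $\alpha$ is $K$-bad if, when FDAR is used, for each $t_1=t_1(n)\ge 0$ the mean number of calls lost during $[t_1,t_1+n^K]$ is $n^{\Omega(1)}$ (i.e. at least $n^{c}$ for some constant $c>0$ and all large $n$). *)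

theory Defs
  imports "HOL-Probability.Probability" "HOL-Library.Landau_Symbols"
begin

section \<open>Networks, load vectors and routing rules\<close>

definition nodes :: "nat \<Rightarrow> nat set" where
  "nodes n = {1..n}"

definition edges :: "nat \<Rightarrow> nat set set" where
  "edges n = {e. e \<subseteq> nodes n \<and> card e = 2}"

text \<open>\<open>x e w\<close> is the number of calls in progress between the two ends of \<open>e\<close> that are
  routed via \<open>w\<close>. The order on load vectors is the pointwise order on functions.\<close>

type_synonym load_vector = "nat set \<Rightarrow> nat \<Rightarrow> nat"

text \<open>A call \<open>{u, v}\<close> routed via \<open>w\<close> uses the links \<open>uw\<close> and \<open>vw\<close>. So the directed link
  \<open>uw\<close> carries exactly the calls with one end \<open>u\<close> that are routed via \<open>w\<close>.\<close>

definition link_load :: "nat \<Rightarrow> load_vector \<Rightarrow> nat \<Rightarrow> nat \<Rightarrow> nat" where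
  "link_load n x u w = (\<Sum>v\<in>nodes n - {u, w}. x {u, v} w)"

definition saturated :: "nat \<Rightarrow> nat \<Rightarrow> load_vector \<Rightarrow> nat \<Rightarrow> nat \<Rightarrow> bool" where
  "saturated n D x u w \<longleftrightarrow> link_load n x u w = D"

definition states :: "nat \<Rightarrow> nat \<Rightarrow> load_vector set" where
  "states n D = {x. (\<forall>e w. e \<notin> edges n \<or> w \<notin> nodes n - e \<longrightarrow> x e w = 0) \<and>
     (\<forall>u\<in>nodes n. \<forall>w\<in>nodes n - {u}. link_load n x u w \<le> D)}"

definition available :: "nat \<Rightarrow> nat \<Rightarrow> load_vector \<Rightarrow> nat set \<Rightarrow> nat \<Rightarrow> bool" where
  "available n D x e w \<longleftrightarrow>
     e \<in> edges n \<and> w \<in> nodes n - e \<and> (\<forall>u\<in>e. \<not> saturated n D x u w)"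

text \<open>A rule receives the current load vector, the call, the list of selected nodes and the
  value of an independent uniform random variable, which permits random tie-breaking; a
  deterministic rule ignores the last argument. It returns the node to route via. Its value is
  only relevant when some candidate route is available.\<close>

type_synonym rule = "load_vector \<Rightarrow> nat set \<Rightarrow> nat list \<Rightarrow> real \<Rightarrow> nat"

definition gdar_rule :: "nat \<Rightarrow> nat \<Rightarrow> nat \<Rightarrow> rule \<Rightarrow> bool" where
  "gdar_rule n d D R \<longleftrightarrow>
     (\<forall>x e ws. R x e ws \<in> measurable borel (count_space UNIV)) \<and>
     (\<forall>x\<in>states n D. \<forall>e\<in>edges n. \<forall>ws y.
        length ws = d \<and> set ws \<subseteq> nodes n - e \<and> (\<exists>w\<in>set ws. available n D x e w)
        \<longrightarrow> R x e ws y \<in> set ws \<and> available n D x e (R x e ws y))"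

definition fdar :: "nat \<Rightarrow> nat \<Rightarrow> rule" where
  "fdar n D x e ws y = hd (filter (available n D x e) ws)"

lemma gdar_rule_fdar: "gdar_rule n d D (fdar n D)"
proof -
  have "fdar n D x e ws y \<in> set ws \<and> available n D x e (fdar n D x e ws y)"
    if "\<exists>w\<in>set ws. available n D x e w" for x e ws y
  proof -
    have "filter (available n D x e) ws \<noteq> []"
      using that by (auto simp: filter_empty_conv)
    then have "fdar n D x e ws y \<in> set (filter (available n D x e) ws)"
      unfolding fdar_def by (rule hd_in_set)
    then show ?thesis by simp
  qed
  moreover have "fdar n D x e ws \<in> measurable borel (count_space UNIV)" for x e ws
    unfolding fdar_def [abs_def] by simp
  ultimately show ?thesis by (auto simp: gdar_rule_def)
qed


section \<open>The process\<close>

text \<open>An arrival consists of the time elapsed since the previous arrival, the duration of the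
  call, the uniform variable offered to the rule, the call itself and the selected nodes.

  A sample point consists of the initial load vector, the remaining durations of the calls in
  progress at time 0 (the \<open>k\<close>-th call between the ends of \<open>e\<close> via \<open>w\<close> has index \<open>(e, w, k)\<close>)
  and the sequence of arrivals.\<close>

type_synonym arrival = "real \<times> real \<times> real \<times> nat set \<times> nat list"
type_synonym sample = "load_vector \<times> (nat set \<times> nat \<times> nat \<Rightarrow> real) \<times> (nat \<Rightarrow> arrival)"

definition initial_load :: "sample \<Rightarrow> load_vector" where
  "initial_load \<omega> = fst \<omega>"

definition residual :: "sample \<Rightarrow> nat set \<Rightarrow> nat \<Rightarrow> nat \<Rightarrow> real" where
  "residual \<omega> e w k = fst (snd \<omega>) (e, w, k)"

definition gap :: "sample \<Rightarrow> nat \<Rightarrow> real" where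
  "gap \<omega> i = fst (snd (snd \<omega>) i)"

definition duration :: "sample \<Rightarrow> nat \<Rightarrow> real" where
  "duration \<omega> i = fst (snd (snd (snd \<omega>) i))"

definition tie_break :: "sample \<Rightarrow> nat \<Rightarrow> real" where
  "tie_break \<omega> i = fst (snd (snd (snd (snd \<omega>) i)))"

definition call :: "sample \<Rightarrow> nat \<Rightarrow> nat set" where
  "call \<omega> i = fst (snd (snd (snd (snd (snd \<omega>) i))))"

definition selected :: "sample \<Rightarrow> nat \<Rightarrow> nat list" where
  "selected \<omega> i = snd (snd (snd (snd (snd (snd \<omega>) i))))"

definition arrival_time :: "sample \<Rightarrow> nat \<Rightarrow> real" where
  "arrival_time \<omega> i = (\<Sum>j\<le>i. gap \<omega> j)"

text \<open>The load vector at time \<open>t\<close>, given the routing decisions \<open>\<rho>\<close> for the arriving calls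
  (\<open>\<rho> i = None\<close> if call \<open>i\<close> is not accepted, or has not been considered yet).\<close>

definition load_at :: "nat \<Rightarrow> sample \<Rightarrow> (nat \<Rightarrow> nat option) \<Rightarrow> real \<Rightarrow> load_vector" where
  "load_at n \<omega> \<rho> t e w =
     (if e \<in> edges n \<and> w \<in> nodes n - e
      then card {k. k < initial_load \<omega> e w \<and> t < residual \<omega> e w k}
         + card {i. call \<omega> i = e \<and> \<rho> i = Some w \<and>
                    arrival_time \<omega> i \<le> t \<and> t < arrival_time \<omega> i + duration \<omega> i}
      else 0)"

definition decide :: "nat \<Rightarrow> nat \<Rightarrow> rule \<Rightarrow> load_vector \<Rightarrow> nat set \<Rightarrow> nat list \<Rightarrow> real \<Rightarrow> nat option" where
  "decide n D R x e ws y =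
     (if \<exists>w\<in>set ws. available n D x e w then Some (R x e ws y) else None)"

text \<open>\<open>routes_upto n D R \<omega> i\<close> records the decisions for the calls \<open>j < i\<close>. Call \<open>i\<close> is routed
  according to the loads that these calls and the initial calls produce at its arrival time.\<close>

primrec routes_upto :: "nat \<Rightarrow> nat \<Rightarrow> rule \<Rightarrow> sample \<Rightarrow> nat \<Rightarrow> (nat \<Rightarrow> nat option)" where
  "routes_upto n D R \<omega> 0 = (\<lambda>_. None)"
| "routes_upto n D R \<omega> (Suc i) =
     (routes_upto n D R \<omega> i)
       (i := decide n D R (load_at n \<omega> (routes_upto n D R \<omega> i) (arrival_time \<omega> i))
               (call \<omega> i) (selected \<omega> i) (tie_break \<omega> i))"

definition route :: "nat \<Rightarrow> nat \<Rightarrow> rule \<Rightarrow> sample \<Rightarrow> nat \<Rightarrow> nat option" where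
  "route n D R \<omega> i = routes_upto n D R \<omega> (Suc i) i"

text \<open>The load vector \<open>X\<^sub>t\<close>.\<close>

definition load_process :: "nat \<Rightarrow> nat \<Rightarrow> rule \<Rightarrow> real \<Rightarrow> sample \<Rightarrow> load_vector" where
  "load_process n D R t \<omega> = load_at n \<omega> (route n D R \<omega>) t"

definition lost_calls :: "nat \<Rightarrow> nat \<Rightarrow> rule \<Rightarrow> real \<Rightarrow> real \<Rightarrow> sample \<Rightarrow> nat set" where
  "lost_calls n D R t1 t2 \<omega> =
     {i. t1 \<le> arrival_time \<omega> i \<and> arrival_time \<omega> i \<le> t2 \<and> route n D R \<omega> i = None}"


section \<open>The probability space\<close>

definition exponential_measure :: "real \<Rightarrow> real measure" where
  "exponential_measure l = density lborel (\<lambda>y. ennreal (exponential_density l y))"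

definition call_pmf :: "nat \<Rightarrow> nat \<Rightarrow> (nat set \<times> nat list) pmf" where
  "call_pmf n d = do {
     e \<leftarrow> pmf_of_set (edges n);
     ws \<leftarrow> replicate_pmf d (pmf_of_set (nodes n - e));
     return_pmf (e, ws)
   }"

definition arrival_measure :: "nat \<Rightarrow> real \<Rightarrow> nat \<Rightarrow> arrival measure" where
  "arrival_measure n lam d =
     exponential_measure (lam * real (n choose 2)) \<Otimes>\<^sub>M
     exponential_measure 1 \<Otimes>\<^sub>M
     uniform_measure lborel {0..1} \<Otimes>\<^sub>M
     measure_pmf (call_pmf n d)"

text \<open>The calls arrive in a Poisson process because the gaps are independent exponential
  variables. The remaining durations of the initial calls are exponential with mean 1, since
  the exponential distribution is memoryless. The initial load vector has distribution \<open>\<mu>\<close>.\<close>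

definition sample_measure :: "nat \<Rightarrow> real \<Rightarrow> nat \<Rightarrow> load_vector pmf \<Rightarrow> sample measure" where
  "sample_measure n lam d \<mu> =
     measure_pmf \<mu> \<Otimes>\<^sub>M
     PiM UNIV (\<lambda>_. exponential_measure 1) \<Otimes>\<^sub>M
     PiM UNIV (\<lambda>_. arrival_measure n lam d)"

definition mean_lost ::
  "nat \<Rightarrow> real \<Rightarrow> nat \<Rightarrow> nat \<Rightarrow> rule \<Rightarrow> load_vector pmf \<Rightarrow> real \<Rightarrow> real \<Rightarrow> ennreal" where
  "mean_lost n lam d D R \<mu> t1 t2 =
     (\<integral>\<^sup>+ \<omega>. emeasure (count_space UNIV) (lost_calls n D R t1 t2 \<omega>) \<partial>sample_measure n lam d \<mu>)"

definition stationary :: "nat \<Rightarrow> real \<Rightarrow> nat \<Rightarrow> nat \<Rightarrow> rule \<Rightarrow> load_vector pmf \<Rightarrow> bool" where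
  "stationary n lam d D R \<pi> \<longleftrightarrow>
     set_pmf \<pi> \<subseteq> states n D \<and>
     (\<forall>t\<ge>0. distr (sample_measure n lam d \<pi>) (count_space UNIV) (load_process n D R t)
             = measure_pmf \<pi>)"

text \<open>\<open>rel_pmf (\<le>) \<mu> \<pi>\<close> states that there is a coupling of \<open>\<mu>\<close> and \<open>\<pi>\<close> supported on pairs
  \<open>(x, y)\<close> with \<open>x \<le> y\<close>, i.e. that \<open>\<mu>\<close> is stochastically dominated by \<open>\<pi>\<close>. The
  stationary distribution is unique for \<open>n \<ge> 3\<close>, so the quantifier just names it.\<close>

definition burn_in :: "nat \<Rightarrow> real \<Rightarrow> nat \<Rightarrow> nat \<Rightarrow> rule \<Rightarrow> load_vector pmf \<Rightarrow> real" where
  "burn_in n lam d D R \<mu> =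
     (if \<exists>\<pi>. stationary n lam d D R \<pi> \<and> rel_pmf (\<le>) \<mu> \<pi> then 0 else 5 * ln (real n))"


section \<open>Good and bad capacities\<close>

text \<open>The parameter \<open>\<alpha>\<close> enters through the capacity function \<open>D\<close>. The rule, the initial
  distribution and the time \<open>t1\<close> may all depend on \<open>n\<close>.\<close>

definition K_good :: "real \<Rightarrow> nat \<Rightarrow> (nat \<Rightarrow> nat) \<Rightarrow> real \<Rightarrow> bool" where
  "K_good lam d D K \<longleftrightarrow>
     (\<forall>R \<mu> t1.
        (\<forall>n\<ge>3. gdar_rule n d (D n) (R n) \<and> set_pmf (\<mu> n) \<subseteq> states n (D n) \<and>
                burn_in n lam d (D n) (R n) (\<mu> n) \<le> t1 n)
        \<longrightarrow> (\<lambda>n. mean_lost n lam d (D n) (R n) (\<mu> n) (t1 n) (t1 n + real n powr K))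
              \<longlonglongrightarrow> 0)"

definition K_bad :: "real \<Rightarrow> nat \<Rightarrow> (nat \<Rightarrow> nat) \<Rightarrow> real \<Rightarrow> bool" where
  "K_bad lam d D K \<longleftrightarrow>
     (\<forall>\<mu> t1.
        (\<forall>n\<ge>3. set_pmf (\<mu> n) \<subseteq> states n (D n) \<and> 0 \<le> t1 n)
        \<longrightarrow> (\<exists>c>0. \<forall>\<^sub>F n in sequentially.
              ennreal (real n powr c) \<le>
              mean_lost n lam d (D n) (fdar n (D n)) (\<mu> n) (t1 n) (t1 n + real n powr K)))"

end

theory Submission
  imports Defs "HOL-Real_Asymp.Real_Asymp"
begin

text \<open>
  Good capacities. A call \<open>e\<close> is lost only if each of its selected nodes \<open>w\<close> was also selected by at
  least \<open>D\<close> calls in progress that meet \<open>e\<close>. These numbers do not depend on the routing decisions; they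
  behave as in a system without losses, whose exponential moments are explicit. Markov's inequality
  for \<open>D\<close> to the power of the number of such calls gives a loss probability of \<open>n\<close> to the power
  \<open>- \<alpha> d + o(1)\<close>, up to the case of coinciding selected nodes, which is harmless. After time \<open>5 ln n\<close> the
  initial calls are gone, and letting the time tend to infinity shows that a stationary load has the
  same exponential moments.

  Bad capacities. Let \<open>a k\<close> be the sum of the expectations of \<open>load choose k\<close> over all links and all
  arrivals, where an arrival at time \<open>t\<close> has weight \<open>exp (- \<epsilon> (t - t1))\<close>. By the lack of memory, \<open>k\<close> given
  calls in progress survive until the next arrival with the right probability, and under FDAR a call
  whose first candidate is available increases two loads; this yields
  \<open>(k + 1 + \<epsilon>) a (k + 1) \<ge> lam (a k - 2 ^ (D + 1) a D)\<close>. Iterating up to \<open>k = D\<close>, where \<open>load choose D\<close>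
  indicates saturation, the proportion of saturated links is at least \<open>n\<close> to the power \<open>- \<alpha> - o(1)\<close>.
  Since \<open>q ^ d\<close> is convex in the proportion \<open>q\<close> of unavailable routes, calls are lost at rate at least \<open>n\<close>
  to the power \<open>2 - \<alpha> d - o(1)\<close>.
\<close>


text \<open>The upper bound must hold for every rule, so no routing decision enters it: a lost call
  is majorised pathwise by a product with one factor for each earlier arrival, and the mean of that
  product is computed without the rule. The base of the exponential moment is \<open>D\<close>
  itself. The moment is then \<open>exp\<close> of a multiple of \<open>D\<close>, which is
  \<open>n\<close> to the power \<open>o(1)\<close>, while \<open>D\<close> to the power
  \<open>- D\<close> is \<open>n\<close> to the power \<open>- \<alpha> + o(1)\<close>.

  The lower bound must include \<open>\<alpha> = 2 / d\<close>, where it yields a loss rate of only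
  \<open>n\<close> to the power \<open>- o(1)\<close>; the positive power has to come from the
  length of the interval. Discounting makes the recursion closed: passing to the next arrival
  multiplies by the Laplace transform of the gap, \<open>rate / (rate + k + \<epsilon>)\<close>,
  without boundary terms and without a stationary law. With
  \<open>\<epsilon> = n powr (- K / 2)\<close> the weight lives on a time scale well inside an
  interval of length \<open>n powr K\<close>. The recursion starts at \<open>a 0\<close>, which
  depends neither on the initial distribution nor on \<open>t1\<close>, so the bound is uniform in
  both.\<close>

section \<open>Exponential distributions\<close>

text \<open>\<open>exp (l * c * (1 - exp (- t)))\<close> is the exponential moment of an M/M/\<open>\<infinity>\<close> system at time \<open>t\<close>; conditioning
  on the first arrival leads to this equation.\<close>

lemma renewal_identity:
  fixes l c t :: real
  assumes "0 < l" "0 \<le> c" "0 \<le> t"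
  shows "ennreal (exp (- l * t)) +
    (\<integral>\<^sup>+r. ennreal (l * exp (- l * (t - r)) * ((1 + c * exp (- r)) * exp (l * c * (1 - exp (- r))))) *
       indicator {0..t} r \<partial>lborel) = ennreal (exp (l * c * (1 - exp (- t))))"
proof -
  \<comment> \<open>The integrand is the derivative of \<open>?F\<close>, and
    \<open>?F 0 = exp (- l * t)\<close> cancels the term for no arrival before
    \<open>t\<close>.\<close>
  let ?F = "\<lambda>r. exp (- l * (t - r)) * exp (l * c * (1 - exp (- r)))"
  have "(\<integral>\<^sup>+r. ennreal (l * exp (- l * (t - r)) * ((1 + c * exp (- r)) * exp (l * c * (1 - exp (- r))))) *
       indicator {0..t} r \<partial>lborel) = ennreal (?F t - ?F 0)"
  proof (rule nn_integral_FTC_Icc)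
    show "DERIV ?F x :> l * exp (- l * (t - x)) *
        ((1 + c * exp (- x)) * exp (l * c * (1 - exp (- x))))" for x
      by (auto simp: algebra_simps intro!: derivative_eq_intros)
  qed (use assms in auto)
  moreover have "exp (- l * t) \<le> exp (l * c * (1 - exp (- t)))"
  proof -
    have "0 \<le> l * c * (1 - exp (- t))" "- l * t \<le> 0" using assms by auto
    then show ?thesis by (metis exp_le_cancel_iff order.trans)
  qed
  ultimately show ?thesis
    by (simp flip: ennreal_plus)
qed

lemma prob_space_exponential_measure: "0 < l \<Longrightarrow> prob_space (exponential_measure l)"
  unfolding exponential_measure_def by (rule prob_space_exponential_density)

lemma sets_exponential_measure [simp, measurable_cong]: "sets (exponential_measure l) = sets borel"
  by (simp add: exponential_measure_def)

lemma space_exponential_measure [simp]: "space (exponential_measure l) = UNIV"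
  by (simp add: exponential_measure_def)

lemma nn_integral_exponential_measure:
  assumes "f \<in> borel_measurable borel" "0 < l"
  shows "(\<integral>\<^sup>+g. f g \<partial>exponential_measure l) =
    (\<integral>\<^sup>+g. ennreal (l * exp (- l * g)) * f g * indicator {0..} g \<partial>lborel)"
  unfolding exponential_measure_def using assms
  by (subst nn_integral_density)
    (auto intro!: nn_integral_cong simp: exponential_density_def indicator_def mult.commute)

lemma AE_exponential_measure: "0 < l \<Longrightarrow> AE g in exponential_measure l. 0 < g"
  unfolding exponential_measure_def
  using AE_lborel_singleton [of 0]
  by (subst AE_density) (auto simp: exponential_density_def elim: eventually_mono)

text \<open>After the substitution \<open>r = t - g\<close> the variable is the time left once the
  first arrival has occurred.\<close>

lemma nn_integral_exponential_convolution:
  fixes f :: "real \<Rightarrow> ennreal"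
  assumes [measurable]: "f \<in> borel_measurable borel" and "0 < l"
  shows "(\<integral>\<^sup>+g. f (t - g) \<partial>exponential_measure l) =
    (\<integral>\<^sup>+r. ennreal (l * exp (- l * (t - r))) * f r * indicator {..t} r \<partial>lborel)"
proof -
  have "(\<integral>\<^sup>+g. f (t - g) \<partial>exponential_measure l) =
    (\<integral>\<^sup>+g. ennreal (l * exp (- l * g)) * f (t - g) * indicator {0..} g \<partial>lborel)"
    using assms by (subst nn_integral_exponential_measure) auto
  also have "\<dots> = (\<integral>\<^sup>+r. ennreal (l * exp (- l * (t - r))) * f (t - (t - r)) * indicator {0..} (t - r) \<partial>lborel)"
    by (subst nn_integral_real_affine [where c = "-1" and t = t]) auto
  also have "\<dots> = (\<integral>\<^sup>+r. ennreal (l * exp (- l * (t - r))) * f r * indicator {..t} r \<partial>lborel)"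
    by (intro nn_integral_cong) (auto simp: indicator_def)
  finally show ?thesis .
qed

lemma nn_integral_exponential_exp:
  assumes "0 < l" "0 \<le> a"
  shows "(\<integral>\<^sup>+g. ennreal (exp (- a * g)) \<partial>exponential_measure l) = ennreal (l / (l + a))"
proof -
  have "(\<integral>\<^sup>+g. ennreal (exp (- a * g)) \<partial>exponential_measure l) =
      (\<integral>\<^sup>+g. ennreal (l * exp (- (l + a) * g)) * indicator {0..} g \<partial>lborel)"
    using assms by (subst nn_integral_exponential_measure)
      (auto intro!: nn_integral_cong simp: ennreal_mult'' [symmetric] algebra_simps simp flip: exp_add)
  also have "\<dots> = ennreal (0 - (- (l / (l + a)) * exp (- (l + a) * 0)))"
  proof (rule nn_integral_FTC_atLeast)
    show "((\<lambda>x. - (l / (l + a)) * exp (- (l + a) * x)) has_real_derivative l * exp (- (l + a) * x)) (at x)" for x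
    proof -
      have "((\<lambda>x. - (l / (l + a)) * exp (- (l + a) * x)) has_real_derivative
          - (l / (l + a)) * (exp (- (l + a) * x) * (- (l + a)))) (at x)"
        by (rule derivative_eq_intros refl | simp)+
      moreover have "- (l / k) * (y * (- k)) = l * y" if "k \<noteq> 0" for k y :: real
        using that by simp
      note this [of "l + a" "exp (- (l + a) * x)"]
      ultimately show ?thesis using assms by simp
    qed
    have "0 < l + a" using assms by simp
    then show "((\<lambda>x. - (l / (l + a)) * exp (- (l + a) * x)) \<longlongrightarrow> 0) at_top"
      by real_asymp
  qed (use assms in auto)
  finally show ?thesis by simp
qed

text \<open>Lack of memory: the density at \<open>x + s\<close> is \<open>exp (- s)\<close> times
  the density at \<open>x\<close>. It is an inequality because the values of \<open>f\<close>
  between 0 and \<open>s\<close> are dropped on the left.\<close>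

lemma exponential_measure_shift:
  fixes f :: "real \<Rightarrow> ennreal"
  assumes [measurable]: "f \<in> borel_measurable borel" and "0 \<le> s"
  shows "ennreal (exp (- s)) * (\<integral>\<^sup>+x. f (x + s) \<partial>exponential_measure 1) \<le> (\<integral>\<^sup>+x. f x \<partial>exponential_measure 1)"
proof -
  have "(\<integral>\<^sup>+x. f x \<partial>exponential_measure 1) =
     (\<integral>\<^sup>+x. ennreal (exp (- x)) * f x * indicator {0..} x \<partial>lborel)"
    by (subst nn_integral_exponential_measure) auto
  also have "\<dots> = (\<integral>\<^sup>+x. ennreal (exp (- (s + x))) * f (s + x) * indicator {0..} (s + x) \<partial>lborel)"
    by (subst nn_integral_real_affine [where c = 1 and t = s]) auto
  also have "\<dots> \<ge> (\<integral>\<^sup>+x. ennreal (exp (- s)) * (ennreal (exp (- x)) * f (x + s) * indicator {0..} x) \<partial>lborel)"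
    using assms(2)
    by (intro nn_integral_mono)
      (auto simp: indicator_def exp_add ennreal_mult mult_ac add_ac exp_diff exp_minus field_class.field_divide_inverse)
  also have "(\<integral>\<^sup>+x. ennreal (exp (- s)) * (ennreal (exp (- x)) * f (x + s) * indicator {0..} x) \<partial>lborel) =
     ennreal (exp (- s)) * (\<integral>\<^sup>+x. f (x + s) \<partial>exponential_measure 1)"
    by (subst nn_integral_cmult) (auto simp: nn_integral_exponential_measure)
  finally show ?thesis .
qed

lemma emeasure_exponential_measure_greaterThan:
  assumes "0 \<le> t"
  shows "emeasure (exponential_measure 1) {t<..} \<le> ennreal (exp (- t))"
proof -
  have "emeasure (exponential_measure 1) {t<..} = (\<integral>\<^sup>+x. indicator {t<..} x \<partial>exponential_measure 1)"
    by simp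
  also have "\<dots> = (\<integral>\<^sup>+g. ennreal (1 * exp (- 1 * g)) * indicator {t<..} g * indicator {0..} g \<partial>lborel)"
    by (subst nn_integral_exponential_measure) auto
  also have "\<dots> \<le> (\<integral>\<^sup>+g. ennreal (exp (- g)) * indicator {t..} g \<partial>lborel)"
    by (intro nn_integral_mono) (auto simp: indicator_def)
  also have "\<dots> = ennreal (0 - (- exp (- t)))"
  proof (rule nn_integral_FTC_atLeast)
    show "((\<lambda>x. - exp (- x)) has_real_derivative exp (- x)) (at x)" for x :: real
      by (auto intro!: derivative_eq_intros)
    show "((\<lambda>x::real. - exp (- x)) \<longlongrightarrow> 0) at_top"
      by real_asymp
  qed auto
  finally show ?thesis by simp
qed

text \<open>The step of an induction over arrivals: \<open>f r\<close> bounds what follows a first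
  arrival that leaves time \<open>r\<close>. If \<open>r < 0\<close>, that arrival comes after
  \<open>t\<close>; this case contributes \<open>exp (- l * t)\<close>. The rest adds up by
  \<open>renewal_identity\<close>.\<close>

lemma convolution_indicator_exponential:
  fixes f :: "real \<Rightarrow> ennreal"
  assumes [measurable]: "f \<in> borel_measurable borel" and l: "0 < l" and c: "0 \<le> c"
    and f: "\<And>r. r < 0 \<Longrightarrow> f r \<le> 1"
      "\<And>r. 0 \<le> r \<Longrightarrow> f r \<le> ennreal ((1 + c * exp (- r)) * exp (l * c * (1 - exp (- r))))"
    and t: "0 \<le> t"
  shows "(\<integral>\<^sup>+g. f (t - g) \<partial>exponential_measure l) \<le> ennreal (exp (l * c * (1 - exp (- t))))"
proof -
  have tail: "(\<integral>\<^sup>+r. ennreal (l * exp (- l * (t - r))) * indicator {..0} r \<partial>lborel) = ennreal (exp (- l * t))"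
  proof -
    have "(\<integral>\<^sup>+r. ennreal (l * exp (- l * (t - r))) * indicator {..0} r \<partial>lborel) =
      (\<integral>\<^sup>+x. ennreal (l * exp (- l * (t + x))) * indicator {0..} x \<partial>lborel)"
      by (subst nn_integral_real_affine [where c = "-1" and t = 0])
        (auto intro!: nn_integral_cong simp: indicator_def)
    also have "\<dots> = ennreal (0 - (- exp (- l * (t + 0))))"
    proof (rule nn_integral_FTC_atLeast)
      show "((\<lambda>x. - exp (- l * (t + x))) has_real_derivative l * exp (- l * (t + x))) (at x)" for x
        by (auto intro!: derivative_eq_intros)
      show "((\<lambda>x. - exp (- l * (t + x))) \<longlongrightarrow> 0) at_top"
        using l by real_asymp
    qed (use l in auto)
    finally show ?thesis by simp
  qed
  let ?k = "\<lambda>r. ennreal (l * exp (- l * (t - r)) * ((1 + c * exp (- r)) * exp (l * c * (1 - exp (- r)))))"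
  have "(\<integral>\<^sup>+g. f (t - g) \<partial>exponential_measure l) =
     (\<integral>\<^sup>+r. ennreal (l * exp (- l * (t - r))) * f r * indicator {..t} r \<partial>lborel)"
    by (rule nn_integral_exponential_convolution) (use l in auto)
  also have "\<dots> \<le> (\<integral>\<^sup>+r. ennreal (l * exp (- l * (t - r))) * indicator {..0} r + ?k r * indicator {0..t} r \<partial>lborel)"
  proof (rule nn_integral_mono)
    fix r
    show "ennreal (l * exp (- l * (t - r))) * f r * indicator {..t} r
      \<le> ennreal (l * exp (- l * (t - r))) * indicator {..0} r + ?k r * indicator {0..t} r"
    proof (cases "r < 0")
      case True
      then show ?thesis
        using mult_left_mono [OF f(1) [OF True], of "ennreal (l * exp (- l * (t - r)))"] t
        by (simp add: indicator_def)
    next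
      case False
      then have "ennreal (l * exp (- l * (t - r))) * f r \<le>
         ennreal (l * exp (- l * (t - r))) * ennreal ((1 + c * exp (- r)) * exp (l * c * (1 - exp (- r))))"
        by (intro mult_left_mono f) auto
      also have "\<dots> = ?k r"
        using l c by (simp add: ennreal_mult)
      finally show ?thesis using False
        by (auto simp: indicator_def intro: add_increasing)
    qed
  qed
  also have "\<dots> = ennreal (exp (- l * t)) + (\<integral>\<^sup>+r. ?k r * indicator {0..t} r \<partial>lborel)"
    by (subst nn_integral_add) (simp_all only: tail, measurable)
  also have "\<dots> = ennreal (exp (l * c * (1 - exp (- t))))"
    by (rule renewal_identity [OF l c t])
  finally show ?thesis .
qed


section \<open>Marked Poisson arrivals\<close>

text \<open>The counterpart of \<open>arrival_time\<close> for a bare stream of gaps with arbitrary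
  marks, so that the Poisson estimates can be proved without the network.\<close>

definition atime :: "(nat \<Rightarrow> real \<times> 'm) \<Rightarrow> nat \<Rightarrow> real" where
  "atime s i = (\<Sum>j\<le>i. fst (s j))"

lemma atime_case_nat [simp]:
  "atime (case_nat a s) 0 = fst a"
  "atime (case_nat a s) (Suc i) = fst a + atime s i"
  by (simp_all add: atime_def sum.atMost_Suc_shift del: sum.atMost_Suc)

locale arrival_stream = mark: prob_space N for N :: "'m measure" +
  fixes l :: real
  assumes rate_pos: "0 < l"
begin

abbreviation "A \<equiv> exponential_measure l \<Otimes>\<^sub>M N"
abbreviation "St \<equiv> Pi\<^sub>M (UNIV :: nat set) (\<lambda>_. A)"

sublocale gap: prob_space "exponential_measure l"
  by (rule prob_space_exponential_measure [OF rate_pos])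

sublocale arr: pair_prob_space "exponential_measure l" N ..

sublocale stream: sequence_space A ..

text \<open>The stream consists of one arrival followed by an independent copy of the whole stream.
  The inductions over arrivals in this locale all peel off the first arrival in this way.\<close>

lemma first_arrival:
  assumes [measurable]: "f \<in> borel_measurable St"
  shows "(\<integral>\<^sup>+s. f s \<partial>St) = (\<integral>\<^sup>+g. \<integral>\<^sup>+x. \<integral>\<^sup>+s. f (case_nat (g, x) s) \<partial>St \<partial>N \<partial>exponential_measure l)"
proof -
  have "(\<integral>\<^sup>+s. f s \<partial>St) = (\<integral>\<^sup>+s. f s \<partial>distr (A \<Otimes>\<^sub>M St) St (\<lambda>(a, s). case_nat a s))"
    by (simp only: stream.PiM_iter)
  also have "\<dots> = (\<integral>\<^sup>+z. f (case_nat (fst z) (snd z)) \<partial>(A \<Otimes>\<^sub>M St))"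
    by (subst nn_integral_distr) (auto simp: case_prod_unfold)
  also have "\<dots> = (\<integral>\<^sup>+a. \<integral>\<^sup>+s. f (case_nat a s) \<partial>St \<partial>A)"
    by (subst stream.P.nn_integral_fst [symmetric]) simp_all
  also have "\<dots> = (\<integral>\<^sup>+g. \<integral>\<^sup>+x. \<integral>\<^sup>+s. f (case_nat (g, x) s) \<partial>St \<partial>N \<partial>exponential_measure l)"
    by (subst mark.nn_integral_fst [symmetric]) simp_all
  finally show ?thesis .
qed

lemma measurable_atime [measurable]: "(\<lambda>s. atime s i) \<in> borel_measurable St"
  unfolding atime_def by measurable

text \<open>\<open>h r x\<close> is the factor of a call with mark \<open>x\<close> and age
  \<open>r\<close> at time \<open>t\<close>; a negative age means that it has not arrived yet. For
  Poisson arrivals the mean of the full product is the exponential of \<open>l\<close> times the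
  integrated mean of \<open>h - 1\<close>, which is at most \<open>l * c * (1 - exp (- t))\<close>.
  The bound does not depend on \<open>m\<close>; the induction needs every \<open>t\<close>, since a
  first gap \<open>g\<close> leaves the time \<open>t - g\<close>.\<close>

lemma fixed_time_product_le:
  fixes h :: "real \<Rightarrow> 'm \<Rightarrow> ennreal"
  assumes h_meas [measurable]: "case_prod h \<in> borel_measurable (borel \<Otimes>\<^sub>M N)"
    and h_neg: "\<And>r x. r < 0 \<Longrightarrow> h r x = 1"
    and c: "0 \<le> c"
    and h_mean: "\<And>r. 0 \<le> r \<Longrightarrow> (\<integral>\<^sup>+x. h r x \<partial>N) \<le> ennreal (1 + c * exp (- r))"
  shows "(\<integral>\<^sup>+s. (\<Prod>j<m. h (t - atime s j) (snd (s j))) \<partial>St) \<le>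
    (if t < 0 then 1 else ennreal (exp (l * c * (1 - exp (- t)))))"
proof (induction m arbitrary: t)
  case 0
  show ?case using c rate_pos by (simp add: stream.emeasure_space_1)
next
  case (Suc m)
  define B where "B t = (\<integral>\<^sup>+s. (\<Prod>j<m. h (t - atime s j) (snd (s j))) \<partial>St)" for t
  have IH: "B t \<le> (if t < 0 then 1 else ennreal (exp (l * c * (1 - exp (- t)))))" for t
    unfolding B_def by (rule Suc.IH)
  have [measurable]: "B \<in> borel_measurable borel"
    unfolding B_def by measurable
  define H where "H r = (\<integral>\<^sup>+x. h r x \<partial>N)" for r
  have [measurable]: "H \<in> borel_measurable borel"
    unfolding H_def by measurable
  have H_neg: "H r = 1" if "r < 0" for r
    using that by (simp add: H_def h_neg mark.emeasure_space_1)
  have "(\<integral>\<^sup>+s. (\<Prod>j<Suc m. h (t - atime s j) (snd (s j))) \<partial>St) =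
     (\<integral>\<^sup>+g. \<integral>\<^sup>+x. \<integral>\<^sup>+s. h (t - g) x * (\<Prod>j<m. h (t - g - atime s j) (snd (s j))) \<partial>St \<partial>N \<partial>exponential_measure l)"
    by (subst first_arrival) (simp_all add: prod.lessThan_Suc_shift algebra_simps del: prod.lessThan_Suc)
  also have "\<dots> = (\<integral>\<^sup>+g. H (t - g) * B (t - g) \<partial>exponential_measure l)"
    by (simp add: nn_integral_cmult nn_integral_multc H_def B_def)
  also have "\<dots> \<le> (if t < 0 then 1 else ennreal (exp (l * c * (1 - exp (- t)))))"
  proof (cases "t < 0")
    case True
    have "(\<integral>\<^sup>+g. H (t - g) * B (t - g) \<partial>exponential_measure l) \<le> (\<integral>\<^sup>+g. 1 \<partial>exponential_measure l)"
      using AE_exponential_measure [OF rate_pos]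
    proof (intro nn_integral_mono_AE, eventually_elim)
      case (elim g)
      then show ?case using True IH [of "t - g"] by (simp add: H_neg)
    qed
    then show ?thesis using True by (simp add: gap.emeasure_space_1 [simplified])
  next
    case False
    have "(\<integral>\<^sup>+g. H (t - g) * B (t - g) \<partial>exponential_measure l) \<le> ennreal (exp (l * c * (1 - exp (- t))))"
    proof (rule convolution_indicator_exponential [where f = "\<lambda>r. H r * B r"])
      show "H r * B r \<le> 1" if "r < 0" for r
        using IH [of r] that by (simp add: H_neg)
      show "H r * B r \<le> ennreal ((1 + c * exp (- r)) * exp (l * c * (1 - exp (- r))))" if "0 \<le> r" for r
        using mult_mono [OF h_mean [OF that] IH [of r]] that c by (simp add: H_def ennreal_mult)
    qed (use c False rate_pos in auto)
    then show ?thesis using False by simp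
  qed
  finally show ?case .
qed

text \<open>The same product as seen by the arrivals themselves: relative to an arrival at time
  \<open>t\<close>, the earlier arrivals still form a Poisson process, so the density is
  \<open>l\<close> times the moment at a fixed time. The induction needs every \<open>f\<close>,
  because a first gap \<open>g\<close> turns \<open>f\<close> into its translate by
  \<open>g\<close>.\<close>

lemma arrival_sum_product_le:
  fixes h :: "real \<Rightarrow> 'm \<Rightarrow> ennreal" and f :: "real \<Rightarrow> ennreal"
  assumes h_meas [measurable]: "case_prod h \<in> borel_measurable (borel \<Otimes>\<^sub>M N)"
    and c: "0 \<le> c"
    and h_mean: "\<And>r. 0 \<le> r \<Longrightarrow> (\<integral>\<^sup>+x. h r x \<partial>N) \<le> ennreal (1 + c * exp (- r))"
    and f_meas: "f \<in> borel_measurable borel"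
  shows "(\<Sum>i<m. \<integral>\<^sup>+s. f (atime s i) * (\<Prod>j<i. h (atime s i - atime s j) (snd (s j))) \<partial>St) \<le>
    (\<integral>\<^sup>+t. f t * ennreal (l * exp (l * c * (1 - exp (- t)))) * indicator {0..} t \<partial>lborel)"
  using f_meas
proof (induction m arbitrary: f)
  case 0
  show ?case by simp
next
  case (Suc m)
  note [measurable] = Suc.prems
  let ?E = "exponential_measure l" and ?p = "\<lambda>t. exp (l * c * (1 - exp (- t)))"
  define H where "H r = (\<integral>\<^sup>+x. h r x \<partial>N)" for r
  have [measurable]: "H \<in> borel_measurable borel"
    unfolding H_def by measurable
  have "(\<Sum>i<Suc m. \<integral>\<^sup>+s. f (atime s i) * (\<Prod>j<i. h (atime s i - atime s j) (snd (s j))) \<partial>St) =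
     (\<integral>\<^sup>+s. f (atime s 0) \<partial>St) +
     (\<Sum>i<m. \<integral>\<^sup>+s. f (atime s (Suc i)) * (\<Prod>j<Suc i. h (atime s (Suc i) - atime s j) (snd (s j))) \<partial>St)"
    by (subst sum.lessThan_Suc_shift) simp
  also have "(\<integral>\<^sup>+s. f (atime s 0) \<partial>St) = (\<integral>\<^sup>+g. f g \<partial>?E)"
    by (subst first_arrival) (simp_all add: mark.emeasure_space_1 stream.emeasure_space_1)
  also have "(\<Sum>i<m. \<integral>\<^sup>+s. f (atime s (Suc i)) * (\<Prod>j<Suc i. h (atime s (Suc i) - atime s j) (snd (s j))) \<partial>St) =
     (\<Sum>i<m. \<integral>\<^sup>+g. \<integral>\<^sup>+x. \<integral>\<^sup>+s. f (g + atime s i) * h (atime s i) x *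
        (\<Prod>j<i. h (atime s i - atime s j) (snd (s j))) \<partial>St \<partial>N \<partial>?E)"
    by (intro sum.cong refl, subst first_arrival)
      (simp_all add: prod.lessThan_Suc_shift algebra_simps del: prod.lessThan_Suc)
  also have "\<dots> = (\<integral>\<^sup>+g. \<integral>\<^sup>+x. (\<Sum>i<m. \<integral>\<^sup>+s. f (g + atime s i) * h (atime s i) x *
        (\<Prod>j<i. h (atime s i - atime s j) (snd (s j))) \<partial>St) \<partial>N \<partial>?E)"
    by (simp add: nn_integral_sum)
  also have "\<dots> \<le> (\<integral>\<^sup>+g. \<integral>\<^sup>+x. (\<integral>\<^sup>+t. f (g + t) * h t x * ennreal (l * ?p t) * indicator {0..} t \<partial>lborel) \<partial>N \<partial>?E)"
  proof (rule nn_integral_mono, rule nn_integral_mono)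
    fix g x assume "x \<in> space N"
    then have [measurable]: "(\<lambda>t. h t x) \<in> borel_measurable borel"
      by measurable
    show "(\<Sum>i<m. \<integral>\<^sup>+s. f (g + atime s i) * h (atime s i) x *
        (\<Prod>j<i. h (atime s i - atime s j) (snd (s j))) \<partial>St) \<le>
      (\<integral>\<^sup>+t. f (g + t) * h t x * ennreal (l * ?p t) * indicator {0..} t \<partial>lborel)"
      by (rule Suc.IH) measurable
  qed
  \<comment> \<open>Integrating over the mark of the first arrival first replaces \<open>h\<close>
    by its mean \<open>H\<close>.\<close>
  also have "\<dots> = (\<integral>\<^sup>+g. \<integral>\<^sup>+t. (\<integral>\<^sup>+x. f (g + t) * h t x * ennreal (l * ?p t) * indicator {0..} t \<partial>N) \<partial>lborel \<partial>?E)"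
  proof (rule nn_integral_cong)
    interpret L: pair_sigma_finite N "lborel :: real measure" ..
    show "(\<integral>\<^sup>+x. (\<integral>\<^sup>+t. f (g + t) * h t x * ennreal (l * ?p t) * indicator {0..} t \<partial>lborel) \<partial>N) =
      (\<integral>\<^sup>+t. (\<integral>\<^sup>+x. f (g + t) * h t x * ennreal (l * ?p t) * indicator {0..} t \<partial>N) \<partial>lborel)" for g
      by (rule L.Fubini' [symmetric]) measurable
  qed
  also have "\<dots> = (\<integral>\<^sup>+g. \<integral>\<^sup>+t. f (g + t) * (H t * ennreal (l * ?p t) * indicator {0..} t) \<partial>lborel \<partial>?E)"
    by (intro nn_integral_cong) (simp add: nn_integral_cmult nn_integral_multc H_def mult.assoc)
  \<comment> \<open>Translation by \<open>g\<close> frees \<open>f\<close> from the gap; what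
    remains is a convolution of the kernel with the law of the gap.\<close>
  also have "\<dots> = (\<integral>\<^sup>+g. \<integral>\<^sup>+t. f t * (H (t - g) * ennreal (l * ?p (t - g)) * indicator {0..} (t - g)) \<partial>lborel \<partial>?E)"
  proof (rule nn_integral_cong)
    show "(\<integral>\<^sup>+t. f (g + t) * (H t * ennreal (l * ?p t) * indicator {0..} t) \<partial>lborel) =
       (\<integral>\<^sup>+t. f t * (H (t - g) * ennreal (l * ?p (t - g)) * indicator {0..} (t - g)) \<partial>lborel)" for g
      by (subst nn_integral_real_affine [where c = 1 and t = "- g"]) auto
  qed
  also have "\<dots> = (\<integral>\<^sup>+t. \<integral>\<^sup>+g. f t * (H (t - g) * ennreal (l * ?p (t - g)) * indicator {0..} (t - g)) \<partial>?E \<partial>lborel)"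
  proof -
    interpret L: pair_sigma_finite ?E "lborel :: real measure" ..
    show ?thesis by (rule L.Fubini' [symmetric]) measurable
  qed
  also have "\<dots> = (\<integral>\<^sup>+t. f t * (\<integral>\<^sup>+g. H (t - g) * ennreal (l * ?p (t - g)) * indicator {0..} (t - g) \<partial>?E) \<partial>lborel)"
    by (intro nn_integral_cong nn_integral_cmult) measurable
  also have "(\<integral>\<^sup>+g. f g \<partial>?E) = (\<integral>\<^sup>+t. f t * (ennreal (l * exp (- l * t)) * indicator {0..} t) \<partial>lborel)"
    by (subst nn_integral_exponential_measure) (auto simp: rate_pos mult_ac)
  also have "\<dots> + (\<integral>\<^sup>+t. f t * (\<integral>\<^sup>+g. H (t - g) * ennreal (l * ?p (t - g)) * indicator {0..} (t - g) \<partial>?E) \<partial>lborel)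
     = (\<integral>\<^sup>+t. f t * (ennreal (l * exp (- l * t)) * indicator {0..} t +
         (\<integral>\<^sup>+g. H (t - g) * ennreal (l * ?p (t - g)) * indicator {0..} (t - g) \<partial>?E)) \<partial>lborel)"
    by (subst nn_integral_add [symmetric]) (auto simp: distrib_left)
  \<comment> \<open>Pointwise in \<open>t\<close> this is the renewal equation, multiplied by
    \<open>l\<close>: the first term is the density of the first arrival, the second that of all
    later ones.\<close>
  also have "\<dots> \<le> (\<integral>\<^sup>+t. f t * (ennreal (l * ?p t) * indicator {0..} t) \<partial>lborel)"
  proof (intro nn_integral_mono mult_left_mono)
    fix t :: real
    have conv: "(\<integral>\<^sup>+g. H (t - g) * ennreal (l * ?p (t - g)) * indicator {0..} (t - g) \<partial>?E) =
      (\<integral>\<^sup>+r. ennreal (l * exp (- l * (t - r))) * (H r * ennreal (l * ?p r) * indicator {0..} r) *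
        indicator {..t} r \<partial>lborel)"
      by (rule nn_integral_exponential_convolution [where f = "\<lambda>r. H r * ennreal (l * ?p r) * indicator {0..} r"])
        (use rate_pos in auto)
    show "ennreal (l * exp (- l * t)) * indicator {0..} t +
         (\<integral>\<^sup>+g. H (t - g) * ennreal (l * ?p (t - g)) * indicator {0..} (t - g) \<partial>?E)
       \<le> ennreal (l * ?p t) * indicator {0..} t"
    proof (cases "0 \<le> t")
      case True
      let ?k = "\<lambda>r. ennreal (l * exp (- l * (t - r)) * ((1 + c * exp (- r)) * ?p r)) * indicator {0..t} r"
      have "(\<integral>\<^sup>+g. H (t - g) * ennreal (l * ?p (t - g)) * indicator {0..} (t - g) \<partial>?E) \<le>
        (\<integral>\<^sup>+r. ennreal l * ?k r \<partial>lborel)"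
        unfolding conv
      proof (rule nn_integral_mono)
        fix r :: real
        show "ennreal (l * exp (- l * (t - r))) * (H r * ennreal (l * ?p r) * indicator {0..} r) * indicator {..t} r
           \<le> ennreal l * ?k r"
        proof (cases "0 \<le> r")
          case True
          have "ennreal (l * exp (- l * (t - r))) * (H r * ennreal (l * ?p r)) \<le>
            ennreal (l * exp (- l * (t - r))) * (ennreal (1 + c * exp (- r)) * ennreal (l * ?p r))"
            using h_mean [OF True] by (intro mult_left_mono mult_right_mono) (auto simp: H_def)
          also have "\<dots> = ennreal l * ennreal (l * exp (- l * (t - r)) * ((1 + c * exp (- r)) * ?p r))"
            using rate_pos c by (simp add: ennreal_mult mult_ac)
          finally show ?thesis using True by (auto simp: indicator_def)
        qed (simp add: indicator_def)
      qed
      also have "\<dots> = ennreal l * (\<integral>\<^sup>+r. ?k r \<partial>lborel)"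
        by (rule nn_integral_cmult) measurable
      finally have "ennreal (l * exp (- l * t)) + (\<integral>\<^sup>+g. H (t - g) * ennreal (l * ?p (t - g)) * indicator {0..} (t - g) \<partial>?E)
         \<le> ennreal l * (ennreal (exp (- l * t)) + (\<integral>\<^sup>+r. ?k r \<partial>lborel))"
        using rate_pos by (simp add: distrib_left ennreal_mult add_left_mono)
      also have "\<dots> = ennreal l * ennreal (?p t)"
        by (simp only: renewal_identity [OF rate_pos c True])
      finally show ?thesis using True rate_pos by (simp add: ennreal_mult)
    next
      case False
      then have "(\<integral>\<^sup>+g. H (t - g) * ennreal (l * ?p (t - g)) * indicator {0..} (t - g) \<partial>?E) = (\<integral>\<^sup>+r. 0 \<partial>(lborel :: real measure))"
        unfolding conv by (intro nn_integral_cong) (auto simp: indicator_def)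
      then show ?thesis using False by simp
    qed
  qed simp
  finally show ?case by (simp add: mult.assoc)
qed

lemma nn_integral_atime:
  fixes f :: "real \<Rightarrow> ennreal"
  assumes "f \<in> borel_measurable borel"
  shows "(\<integral>\<^sup>+s. f (atime s i) \<partial>St) = (\<integral>\<^sup>+t. f t * ennreal (erlang_density i l t) \<partial>lborel)"
  using assms
proof (induction i arbitrary: f)
  case 0
  note [measurable] = 0
  have "(\<integral>\<^sup>+s. f (atime s 0) \<partial>St) = (\<integral>\<^sup>+g. f g \<partial>exponential_measure l)"
    by (subst first_arrival) (simp_all add: mark.emeasure_space_1 stream.emeasure_space_1)
  also have "\<dots> = (\<integral>\<^sup>+t. f t * ennreal (erlang_density 0 l t) \<partial>lborel)"
    unfolding exponential_measure_def by (subst nn_integral_density) (auto simp: mult.commute)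
  finally show ?case .
next
  case (Suc i)
  note [measurable] = Suc.prems
  have "(\<integral>\<^sup>+s. f (atime s (Suc i)) \<partial>St) = (\<integral>\<^sup>+g. \<integral>\<^sup>+s. f (g + atime s i) \<partial>St \<partial>exponential_measure l)"
    by (subst first_arrival) (simp_all add: mark.emeasure_space_1)
  also have "\<dots> = (\<integral>\<^sup>+g. \<integral>\<^sup>+t. f (g + t) * ennreal (erlang_density i l t) \<partial>lborel \<partial>exponential_measure l)"
    by (intro nn_integral_cong Suc.IH) measurable
  also have "\<dots> = (\<integral>\<^sup>+g. \<integral>\<^sup>+t. f t * ennreal (erlang_density i l (t - g)) \<partial>lborel \<partial>exponential_measure l)"
  proof (rule nn_integral_cong)
    show "(\<integral>\<^sup>+t. f (g + t) * ennreal (erlang_density i l t) \<partial>lborel) =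
      (\<integral>\<^sup>+t. f t * ennreal (erlang_density i l (t - g)) \<partial>lborel)" for g
      by (subst nn_integral_real_affine [where c = 1 and t = "- g"]) auto
  qed
  also have "\<dots> = (\<integral>\<^sup>+g. (\<integral>\<^sup>+t. f t * ennreal (erlang_density i l (t - g)) * ennreal (erlang_density 0 l g) \<partial>lborel) \<partial>lborel)"
    unfolding exponential_measure_def
    by (subst nn_integral_density) (auto simp: mult.commute simp flip: nn_integral_cmult)
  also have "\<dots> = (\<integral>\<^sup>+t. (\<integral>\<^sup>+g. f t * ennreal (erlang_density i l (t - g)) * ennreal (erlang_density 0 l g) \<partial>lborel) \<partial>lborel)"
    by (rule lborel_pair.Fubini' [symmetric]) measurable
  also have "\<dots> = (\<integral>\<^sup>+t. f t * (\<integral>\<^sup>+g. ennreal (erlang_density i l (t - g)) * ennreal (erlang_density 0 l g) \<partial>lborel) \<partial>lborel)"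
    by (simp add: nn_integral_cmult mult.assoc)
  also have "\<dots> = (\<integral>\<^sup>+t. f t * ennreal (erlang_density (Suc i) l t) \<partial>lborel)"
    using fun_cong [OF convolution_erlang_density [OF rate_pos, of i 0]] by simp
  finally show ?case .
qed

text \<open>The Erlang densities sum to the constant intensity of a Poisson process, by the
  exponential series.\<close>

lemma suminf_erlang_density: "0 \<le> t \<Longrightarrow> (\<Sum>i. ennreal (erlang_density i l t)) = ennreal l"
proof -
  assume t: "0 \<le> t"
  have "(\<lambda>i. (l * t) ^ i /\<^sub>R fact i) sums exp (l * t)"
    by (rule exp_converges)
  then have "(\<lambda>i. l * exp (- l * t) * ((l * t) ^ i /\<^sub>R fact i)) sums (l * exp (- l * t) * exp (l * t))"
    by (rule sums_mult)
  then have "(\<lambda>i. erlang_density i l t) sums l"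
    using t by (simp add: erlang_density_def field_simps exp_minus)
  then show ?thesis
    using rate_pos by (subst suminf_ennreal_eq) auto
qed

text \<open>Campbell's formula for a Poisson process on the positive half-line.\<close>

lemma suminf_nn_integral_atime:
  fixes f :: "real \<Rightarrow> ennreal"
  assumes [measurable]: "f \<in> borel_measurable borel"
  shows "(\<Sum>i. \<integral>\<^sup>+s. f (atime s i) \<partial>St) = ennreal l * (\<integral>\<^sup>+t. f t * indicator {0..} t \<partial>lborel)"
proof -
  have "(\<Sum>i. \<integral>\<^sup>+s. f (atime s i) \<partial>St) = (\<integral>\<^sup>+t. (\<Sum>i. f t * ennreal (erlang_density i l t)) \<partial>lborel)"
    by (subst nn_integral_suminf) (simp_all add: nn_integral_atime)
  also have "\<dots> = (\<integral>\<^sup>+t. ennreal l * (f t * indicator {0..} t) \<partial>lborel)"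
  proof (rule nn_integral_cong)
    show "(\<Sum>i. f t * ennreal (erlang_density i l t)) = ennreal l * (f t * indicator {0..} t)" for t
      by (cases "0 \<le> t") (simp_all add: suminf_erlang_density mult.commute, simp add: erlang_density_def)
  qed
  also have "\<dots> = ennreal l * (\<integral>\<^sup>+t. f t * indicator {0..} t \<partial>lborel)"
    by (rule nn_integral_cmult) measurable
  finally show ?thesis .
qed

end


section \<open>Sample paths\<close>

lemma finite_edges [simp]: "finite (edges n)"
  unfolding edges_def nodes_def by (rule finite_subset [of _ "Pow {1..n}"]) auto

lemma finite_nodes [simp]: "finite (nodes n)"
  by (simp add: nodes_def)

lemma card_nodes [simp]: "card (nodes n) = n"
  by (simp add: nodes_def)

lemma card_edges: "card (edges n) = n choose 2"
  unfolding edges_def using n_subsets [of "nodes n" 2] by simp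

text \<open>The calls that can put load on the link \<open>uw\<close>.\<close>

definition incident :: "nat \<Rightarrow> nat \<Rightarrow> nat \<Rightarrow> nat set set" where
  "incident n u w = {e \<in> edges n. u \<in> e \<and> w \<notin> e}"

text \<open>Every call that can share a link with \<open>e\<close>, via whichever node. The set is
  independent of that node, so one exponential moment serves both links of a route.\<close>

definition meets :: "nat \<Rightarrow> nat set \<Rightarrow> nat set set" where
  "meets n e = {e' \<in> edges n. e' \<inter> e \<noteq> {}}"

lemma finite_incident [simp]: "finite (incident n u w)"
  by (simp add: incident_def)

lemma finite_meets [simp]: "finite (meets n e)"
  by (simp add: meets_def)

lemma edge_eq_pair:
  assumes "e \<in> edges n" "u \<in> e"
  obtains v where "e = {u, v}" "v \<noteq> u" "v \<in> nodes n" "u \<in> nodes n"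
proof -
  obtain a b where "e = {a, b}" "a \<noteq> b"
    using assms by (auto simp: edges_def card_2_iff)
  then show thesis using assms that [of a] that [of b] by (auto simp: edges_def insert_commute)
qed

lemma link_load_eq:
  assumes "u \<in> nodes n" "w \<noteq> u"
  shows "link_load n x u w = (\<Sum>e\<in>incident n u w. x e w)"
proof -
  have "bij_betw (\<lambda>v. {u, v}) (nodes n - {u, w}) (incident n u w)"
  proof (rule bij_betwI')
    show "({u, v} = {u, v'}) = (v = v')" if "v \<in> nodes n - {u, w}" "v' \<in> nodes n - {u, w}" for v v'
      using that by (auto simp: doubleton_eq_iff)
    show "{u, v} \<in> incident n u w" if "v \<in> nodes n - {u, w}" for v
      using that assms by (auto simp: incident_def edges_def card_insert_if)
    show "\<exists>v\<in>nodes n - {u, w}. e = {u, v}" if e: "e \<in> incident n u w" for e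
    proof -
      obtain v where "e = {u, v}" "v \<noteq> u" "v \<in> nodes n"
        using e edge_eq_pair [of e n u] by (auto simp: incident_def)
      then show ?thesis using e by (auto simp: incident_def)
    qed
  qed
  then show ?thesis
    unfolding link_load_def by (subst sum.reindex_bij_betw [symmetric]) auto
qed

lemma load_at_eq:
  assumes "e \<in> edges n" "w \<in> nodes n - e"
  shows "load_at n \<omega> \<rho> t e w =
      card {k. k < initial_load \<omega> e w \<and> t < residual \<omega> e w k}
    + card {i. call \<omega> i = e \<and> \<rho> i = Some w \<and> arrival_time \<omega> i \<le> t \<and> t < arrival_time \<omega> i + duration \<omega> i}"
  using assms by (simp add: load_at_def)

definition initial_calls :: "nat \<Rightarrow> sample \<Rightarrow> real \<Rightarrow> nat \<Rightarrow> nat \<Rightarrow> (nat set \<times> nat) set" where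
  "initial_calls n \<omega> t u w =
     {(e, k). e \<in> incident n u w \<and> k < initial_load \<omega> e w \<and> t < residual \<omega> e w k}"

definition arrived_calls ::
  "nat \<Rightarrow> sample \<Rightarrow> (nat \<Rightarrow> nat option) \<Rightarrow> real \<Rightarrow> nat \<Rightarrow> nat \<Rightarrow> nat set" where
  "arrived_calls n \<omega> \<rho> t u w =
     {i. call \<omega> i \<in> incident n u w \<and> \<rho> i = Some w \<and>
         arrival_time \<omega> i \<le> t \<and> t < arrival_time \<omega> i + duration \<omega> i}"

lemma finite_initial_calls [simp]: "finite (initial_calls n \<omega> t u w)"
proof -
  have "initial_calls n \<omega> t u w \<subseteq> (SIGMA e:incident n u w. {..<initial_load \<omega> e w})"
    by (auto simp: initial_calls_def)
  then show ?thesis by (rule finite_subset) auto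
qed

text \<open>Finitely many decisions are assumed because \<open>card\<close> is 0 on infinite sets,
  which would destroy additivity over the edges.\<close>

lemma link_load_load_at:
  assumes "u \<in> nodes n" "w \<in> nodes n" "w \<noteq> u" "finite {i. \<rho> i \<noteq> None}"
  shows "link_load n (load_at n \<omega> \<rho> t) u w =
    card (initial_calls n \<omega> t u w) + card (arrived_calls n \<omega> \<rho> t u w)"
proof -
  let ?I = "\<lambda>e. {k. k < initial_load \<omega> e w \<and> t < residual \<omega> e w k}"
  let ?J = "\<lambda>e. {i. call \<omega> i = e \<and> \<rho> i = Some w \<and> arrival_time \<omega> i \<le> t \<and> t < arrival_time \<omega> i + duration \<omega> i}"
  have fin: "finite (?J e)" for e
    by (rule finite_subset [OF _ assms(4)]) auto
  have "link_load n (load_at n \<omega> \<rho> t) u w = (\<Sum>e\<in>incident n u w. card (?I e) + card (?J e))"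
    using assms by (subst link_load_eq) (auto simp: load_at_eq incident_def intro!: sum.cong)
  also have "(\<Sum>e\<in>incident n u w. card (?I e) + card (?J e)) =
      card (SIGMA e:incident n u w. ?I e) + card (\<Union>e\<in>incident n u w. ?J e)"
    using fin by (simp add: sum.distrib card_SigmaI) (subst card_UN_disjoint, auto)
  also have "(SIGMA e:incident n u w. ?I e) = initial_calls n \<omega> t u w"
    by (auto simp: initial_calls_def)
  also have "(\<Union>e\<in>incident n u w. ?J e) = arrived_calls n \<omega> \<rho> t u w"
    by (auto simp: arrived_calls_def)
  finally show ?thesis .
qed

lemma routes_upto_eq: "routes_upto n D R \<omega> i j = (if j < i then route n D R \<omega> j else None)"
proof (induction i)
  case (Suc i)
  then show ?case
    by (cases "j = i") (auto simp: route_def)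
qed simp

lemma finite_routes_upto [simp]: "finite {j. routes_upto n D R \<omega> i j \<noteq> None}"
  by (rule finite_subset [of _ "{..<i}"]) (auto simp: routes_upto_eq)

text \<open>The loads found by call \<open>i\<close> on its arrival: only the decisions for earlier
  calls enter, so call \<open>i\<close> itself is not counted.\<close>

definition seen :: "nat \<Rightarrow> nat \<Rightarrow> rule \<Rightarrow> sample \<Rightarrow> nat \<Rightarrow> load_vector" where
  "seen n D R \<omega> i = load_at n \<omega> (routes_upto n D R \<omega> i) (arrival_time \<omega> i)"

lemma route_eq:
  "route n D R \<omega> i = decide n D R (seen n D R \<omega> i) (call \<omega> i) (selected \<omega> i) (tie_break \<omega> i)"
  by (simp add: route_def seen_def)

text \<open>Properties that almost every sample point has; the pathwise arguments are confined to
  such points.\<close>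

definition regular :: "nat \<Rightarrow> nat \<Rightarrow> nat \<Rightarrow> sample \<Rightarrow> bool" where
  "regular n d D \<omega> \<longleftrightarrow> initial_load \<omega> \<in> states n D \<and>
     (\<forall>i. 0 < gap \<omega> i \<and> call \<omega> i \<in> edges n \<and> length (selected \<omega> i) = d \<and> set (selected \<omega> i) \<subseteq> nodes n - call \<omega> i)"

lemma arrival_time_strict_mono:
  assumes "regular n d D \<omega>" "i < j"
  shows "arrival_time \<omega> i < arrival_time \<omega> j"
proof -
  have "strict_mono (arrival_time \<omega>)"
    using assms(1) by (subst strict_mono_Suc_iff) (simp add: arrival_time_def regular_def)
  then show ?thesis using assms(2) by (rule strict_monoD)
qed

lemma arrival_time_mono:
  "regular n d D \<omega> \<Longrightarrow> i \<le> j \<Longrightarrow> arrival_time \<omega> i \<le> arrival_time \<omega> j"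
  using arrival_time_strict_mono [of n d D \<omega> i j] by (cases "i = j") auto

lemma route_Some:
  assumes "gdar_rule n d D R" "regular n d D \<omega>" "seen n D R \<omega> i \<in> states n D" "route n D R \<omega> i = Some w"
  shows "w \<in> set (selected \<omega> i)" "available n D (seen n D R \<omega> i) (call \<omega> i) w"
proof -
  have *: "\<exists>w\<in>set (selected \<omega> i). available n D (seen n D R \<omega> i) (call \<omega> i) w"
    "w = R (seen n D R \<omega> i) (call \<omega> i) (selected \<omega> i) (tie_break \<omega> i)"
    using assms(4) by (auto simp: route_eq decide_def split: if_splits)
  moreover have "call \<omega> i \<in> edges n" "length (selected \<omega> i) = d" "set (selected \<omega> i) \<subseteq> nodes n - call \<omega> i"
    using assms(2) by (auto simp: regular_def)
  ultimately show "w \<in> set (selected \<omega> i)" "available n D (seen n D R \<omega> i) (call \<omega> i) w"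
    using assms(1,3) unfolding gdar_rule_def by blast+
qed

lemma load_at_in_states:
  assumes "\<And>u w. u \<in> nodes n \<Longrightarrow> w \<in> nodes n - {u} \<Longrightarrow> link_load n (load_at n \<omega> \<rho> t) u w \<le> D"
  shows "load_at n \<omega> \<rho> t \<in> states n D"
  using assms unfolding states_def by (auto simp: load_at_def)

text \<open>Between arrivals loads can only decrease, and a call is accepted only onto links that
  are not saturated. The time \<open>t\<close> is arbitrary after the first \<open>i\<close>
  arrivals, so that the induction hypothesis can be used at the next arrival time.\<close>

lemma link_load_routes_upto_le:
  assumes R: "gdar_rule n d D R" and reg: "regular n d D \<omega>"
    and uw: "u \<in> nodes n" "w \<in> nodes n" "w \<noteq> u"
    and t: "\<And>j. j < i \<Longrightarrow> arrival_time \<omega> j \<le> t" 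
  shows "link_load n (load_at n \<omega> (routes_upto n D R \<omega> i) t) u w \<le> D"
  using uw t
proof (induction i arbitrary: t u w)
  case 0
  have "link_load n (load_at n \<omega> (routes_upto n D R \<omega> 0) t) u w \<le> link_load n (initial_load \<omega>) u w"
    unfolding link_load_def
  proof (rule sum_mono)
    fix v
    have "card {k. k < initial_load \<omega> {u, v} w \<and> t < residual \<omega> {u, v} w k} \<le> card {..<initial_load \<omega> {u, v} w}"
      by (rule card_mono) auto
    then show "load_at n \<omega> (routes_upto n D R \<omega> 0) t {u, v} w \<le> initial_load \<omega> {u, v} w"
      by (simp add: load_at_def)
  qed
  also have "\<dots> \<le> D"
    using reg 0 by (auto simp: regular_def states_def)
  finally show ?case .
next
  case (Suc i)
  have seen: "seen n D R \<omega> i \<in> states n D"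
    unfolding seen_def
    by (rule load_at_in_states, rule Suc.IH) (use arrival_time_mono [OF reg] in auto)
  have loads: "link_load n (seen n D R \<omega> i) u w =
      card (initial_calls n \<omega> (arrival_time \<omega> i) u w) +
      card (arrived_calls n \<omega> (routes_upto n D R \<omega> i) (arrival_time \<omega> i) u w)"
    unfolding seen_def by (rule link_load_load_at) (use Suc.prems finite_routes_upto in blast)+
  have le: "link_load n (seen n D R \<omega> i) u w \<le> D"
    using seen Suc.prems by (auto simp: states_def)
  \<comment> \<open>Call \<open>i\<close> adds at most one to the load of \<open>uw\<close>; if it
    does, the availability of its route leaves room for it.\<close>
  define new where "new = (if route n D R \<omega> i = Some w \<and> call \<omega> i \<in> incident n u w then {i} else {})"
  have "link_load n (load_at n \<omega> (routes_upto n D R \<omega> (Suc i)) t) u w =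
      card (initial_calls n \<omega> t u w) + card (arrived_calls n \<omega> (routes_upto n D R \<omega> (Suc i)) t u w)"
    by (rule link_load_load_at) (use Suc.prems finite_routes_upto in blast)+
  also have "\<dots> \<le> card (initial_calls n \<omega> (arrival_time \<omega> i) u w) +
     card (arrived_calls n \<omega> (routes_upto n D R \<omega> i) (arrival_time \<omega> i) u w \<union> new)"
  proof (intro add_mono card_mono)
    have ti: "arrival_time \<omega> i \<le> t" using Suc.prems(4) by simp
    then show "initial_calls n \<omega> t u w \<subseteq> initial_calls n \<omega> (arrival_time \<omega> i) u w"
      by (auto simp: initial_calls_def)
    show "arrived_calls n \<omega> (routes_upto n D R \<omega> (Suc i)) t u w \<subseteq>
        arrived_calls n \<omega> (routes_upto n D R \<omega> i) (arrival_time \<omega> i) u w \<union> new"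
      using ti arrival_time_mono [OF reg]
      by (auto simp: arrived_calls_def routes_upto_eq new_def less_Suc_eq simp del: routes_upto.simps
          split: if_splits) 
    have "arrived_calls n \<omega> (routes_upto n D R \<omega> i) (arrival_time \<omega> i) u w \<subseteq> {..<i}"
      by (auto simp: arrived_calls_def routes_upto_eq split: if_splits)
    then show "finite (arrived_calls n \<omega> (routes_upto n D R \<omega> i) (arrival_time \<omega> i) u w \<union> new)"
      by (auto simp: new_def intro: finite_subset)
  qed simp
  also have "\<dots> \<le> link_load n (seen n D R \<omega> i) u w + card new"
    unfolding loads using card_Un_le [of "arrived_calls n \<omega> (routes_upto n D R \<omega> i) (arrival_time \<omega> i) u w" new]
    by simp
  also have "\<dots> \<le> D"
  proof (cases "new = {}")
    case False
    then have new: "route n D R \<omega> i = Some w" "call \<omega> i \<in> incident n u w" "card new = 1"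
      by (auto simp: new_def split: if_splits)
    then have "\<not> saturated n D (seen n D R \<omega> i) u w"
      using route_Some(2) [OF R reg seen new(1)] by (auto simp: available_def incident_def)
    then show ?thesis using le new by (simp add: saturated_def)
  qed (use le in auto)
  finally show ?case .
qed

lemma seen_in_states:
  assumes "gdar_rule n d D R" "regular n d D \<omega>"
  shows "seen n D R \<omega> i \<in> states n D"
  unfolding seen_def
  by (rule load_at_in_states, rule link_load_routes_upto_le [OF assms])
    (use arrival_time_mono [OF assms(2)] in auto)

lemma route_in_selected:
  assumes "gdar_rule n d D R" "regular n d D \<omega>" "route n D R \<omega> i = Some w"
  shows "w \<in> set (selected \<omega> i)"
  using route_Some(1) [OF assms(1,2) seen_in_states [OF assms(1,2)] assms(3)] .

text \<open>Initial calls are counted by their actual route, since they carry no list of selected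
  nodes.\<close>

definition surviving :: "nat \<Rightarrow> sample \<Rightarrow> real \<Rightarrow> nat set \<Rightarrow> nat \<Rightarrow> nat" where
  "surviving n \<omega> t e w = (\<Sum>e'\<in>meets n e. card {k. k < initial_load \<omega> e' w \<and> t < residual \<omega> e' w k})"

definition in_progress :: "sample \<Rightarrow> real \<Rightarrow> nat \<Rightarrow> bool" where
  "in_progress \<omega> t j \<longleftrightarrow> arrival_time \<omega> j \<le> t \<and> t < arrival_time \<omega> j + duration \<omega> j"

text \<open>All selected nodes in \<open>W\<close> are counted, although the call uses at most one
  of them: this bounds its contribution to the loads via \<open>W\<close> whatever the rule
  decides.\<close>

definition hits :: "nat set \<Rightarrow> nat set \<Rightarrow> nat set \<times> nat list \<Rightarrow> nat" where
  "hits e W c = (if fst c \<inter> e \<noteq> {} then card (W \<inter> set (snd c)) else 0)"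

lemma incident_subset_meets: "u \<in> e \<Longrightarrow> incident n u w \<subseteq> meets n e"
  by (auto simp: incident_def meets_def)

text \<open>Double counting: by nodes on the left, by calls on the right.\<close>

lemma sum_card_hits:
  assumes "finite W" "finite J"
  shows "(\<Sum>w\<in>W. card {j\<in>J. P j \<and> fst (c j) \<inter> e \<noteq> {} \<and> w \<in> set (snd (c j))}) =
    (\<Sum>j\<in>J. if P j then hits e W (c j) else 0)"
proof -
  have "(\<Sum>w\<in>W. card {j\<in>J. P j \<and> fst (c j) \<inter> e \<noteq> {} \<and> w \<in> set (snd (c j))}) =
     (\<Sum>w\<in>W. \<Sum>j\<in>J. if P j \<and> fst (c j) \<inter> e \<noteq> {} \<and> w \<in> set (snd (c j)) then 1 else 0)"
    using assms by (simp add: sum.If_cases Int_def)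
  also have "\<dots> = (\<Sum>j\<in>J. \<Sum>w\<in>W. if P j \<and> fst (c j) \<inter> e \<noteq> {} \<and> w \<in> set (snd (c j)) then 1 else 0)"
    by (rule sum.swap)
  also have "\<dots> = (\<Sum>j\<in>J. if P j then hits e W (c j) else 0)"
    using assms by (intro sum.cong) (auto simp: hits_def sum.If_cases Int_def)
  finally show ?thesis .
qed

lemma lost_call_bound:
  assumes R: "gdar_rule n d D R" and reg: "regular n d D \<omega>" and lost: "route n D R \<omega> i = None"
    and w: "w \<in> set (selected \<omega> i)"
  shows "D \<le> surviving n \<omega> (arrival_time \<omega> i) (call \<omega> i) w +
    card {j\<in>{..<i}. in_progress \<omega> (arrival_time \<omega> i) j \<and> call \<omega> j \<inter> call \<omega> i \<noteq> {} \<and> w \<in> set (selected \<omega> j)}"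
proof -
  let ?t = "arrival_time \<omega> i"
  have e: "call \<omega> i \<in> edges n" and wn: "w \<in> nodes n" "w \<notin> call \<omega> i"
    using reg w by (auto simp: regular_def)
  have "\<not> available n D (seen n D R \<omega> i) (call \<omega> i) w"
    using lost w by (auto simp: route_eq decide_def split: if_splits)
  then obtain u where u: "u \<in> call \<omega> i" "link_load n (seen n D R \<omega> i) u w = D"
    using e wn by (auto simp: available_def saturated_def)
  have un: "u \<in> nodes n" "w \<noteq> u"
    using u(1) e wn by (auto simp: edges_def)
  have "D = link_load n (seen n D R \<omega> i) u w"
    by (rule u(2) [symmetric])
  also have "\<dots> = card (initial_calls n \<omega> ?t u w) + card (arrived_calls n \<omega> (routes_upto n D R \<omega> i) ?t u w)"
    unfolding seen_def by (rule link_load_load_at) (use un wn finite_routes_upto in blast)+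
  also have "initial_calls n \<omega> ?t u w = (SIGMA e':incident n u w. {k. k < initial_load \<omega> e' w \<and> ?t < residual \<omega> e' w k})"
    by (auto simp: initial_calls_def)
  also have "card \<dots> \<le> surviving n \<omega> ?t (call \<omega> i) w"
    unfolding surviving_def using incident_subset_meets [OF u(1)]
    by (subst card_SigmaI) (auto intro!: sum_mono2)
  also have "card (arrived_calls n \<omega> (routes_upto n D R \<omega> i) ?t u w) \<le>
    card {j\<in>{..<i}. in_progress \<omega> (arrival_time \<omega> i) j \<and> call \<omega> j \<inter> call \<omega> i \<noteq> {} \<and> w \<in> set (selected \<omega> j)}"
    by (rule card_mono)
      (use route_in_selected [OF R reg] u(1) in
        \<open>auto simp: arrived_calls_def in_progress_def incident_def routes_upto_eq split: if_splits\<close>)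
  finally show ?thesis by simp
qed

definition total_load :: "nat \<Rightarrow> load_vector \<Rightarrow> nat set \<Rightarrow> nat set \<Rightarrow> nat" where
  "total_load n x e W = (\<Sum>w\<in>W. \<Sum>e'\<in>meets n e. x e' w)"

text \<open>The process at time \<open>t\<close> refers to the whole sequence of arrivals, without a
  last index. Some finite \<open>m\<close> suffices, because the left side is a finite sum of finite
  cardinalities; it depends on the sample point, so later the supremum over \<open>m\<close> is
  taken.\<close>

lemma total_load_process_le:
  assumes R: "gdar_rule n d D R" and reg: "regular n d D \<omega>" and W: "finite W"
  shows "\<exists>m. total_load n (load_process n D R t \<omega>) e W \<le> (\<Sum>w\<in>W. surviving n \<omega> t e w) +
    (\<Sum>j<m. if in_progress \<omega> t j then hits e W (call \<omega> j, selected \<omega> j) else 0)"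
proof -
  \<comment> \<open>\<open>J e' w\<close> may be infinite; its cardinality is then \<open>0\<close>.\<close>
  define J where "J e' w = {i. call \<omega> i = e' \<and> route n D R \<omega> i = Some w \<and> in_progress \<omega> t i}" for e' w
  define F where "F = (\<Union>w\<in>W. \<Union>e'\<in>meets n e. if finite (J e' w) then J e' w else {})"
  have "finite F" using W by (auto simp: F_def)
  then obtain m where m: "F \<subseteq> {..<m}"
    by (auto simp: finite_nat_set_iff_bounded)
  have "(\<Sum>e'\<in>meets n e. load_process n D R t \<omega> e' w) \<le> surviving n \<omega> t e w +
     card {j\<in>{..<m}. in_progress \<omega> t j \<and> fst (call \<omega> j, selected \<omega> j) \<inter> e \<noteq> {} \<and> w \<in> set (snd (call \<omega> j, selected \<omega> j))}" (is "_ \<le> _ + card ?T")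
    if "w \<in> W" for w
  proof -
    have "(\<Sum>e'\<in>meets n e. load_process n D R t \<omega> e' w) \<le>
       (\<Sum>e'\<in>meets n e. card {k. k < initial_load \<omega> e' w \<and> t < residual \<omega> e' w k} + card (J e' w))"
      unfolding load_process_def by (intro sum_mono) (auto simp: load_at_def J_def in_progress_def)
    also have "\<dots> = surviving n \<omega> t e w + (\<Sum>e'\<in>meets n e. card (J e' w))"
      by (simp add: surviving_def sum.distrib)
    also have "(\<Sum>e'\<in>meets n e. card (J e' w)) = (\<Sum>e'\<in>meets n e. card (if finite (J e' w) then J e' w else {}))"
      by (intro sum.cong) auto
    also have "\<dots> = card (\<Union>e'\<in>meets n e. if finite (J e' w) then J e' w else {})"
      by (subst card_UN_disjoint) (auto simp: J_def)
    also have "\<dots> \<le> card ?T"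
    proof (rule card_mono)
      have "(\<Union>e'\<in>meets n e. if finite (J e' w) then J e' w else {}) \<subseteq> F"
        using that by (auto simp: F_def)
      then show "(\<Union>e'\<in>meets n e. if finite (J e' w) then J e' w else {}) \<subseteq> ?T"
        using m route_in_selected [OF R reg] by (auto simp: J_def meets_def split: if_splits)
    qed auto
    finally show ?thesis by simp
  qed
  then have "total_load n (load_process n D R t \<omega>) e W \<le> (\<Sum>w\<in>W. surviving n \<omega> t e w) +
     (\<Sum>w\<in>W. card {j\<in>{..<m}. in_progress \<omega> t j \<and> fst (call \<omega> j, selected \<omega> j) \<inter> e \<noteq> {} \<and> w \<in> set (snd (call \<omega> j, selected \<omega> j))})"
    unfolding total_load_def by (subst sum.distrib [symmetric]) (rule sum_mono)
  also have "(\<Sum>w\<in>W. card {j\<in>{..<m}. in_progress \<omega> t j \<and> fst (call \<omega> j, selected \<omega> j) \<inter> e \<noteq> {} \<and> w \<in> set (snd (call \<omega> j, selected \<omega> j))})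
     = (\<Sum>j<m. if in_progress \<omega> t j then hits e W (call \<omega> j, selected \<omega> j) else 0)"
    by (rule sum_card_hits) (use W in auto)
  finally show ?thesis by blast
qed


section \<open>The sample measure\<close>

text \<open>Works through a null set that covers the exceptional points, so \<open>P\<close> itself
  may fail to be measurable.\<close>

lemma AE_pair_fst:
  assumes "prob_space N" "AE x in M. P x"
  shows "AE z in M \<Otimes>\<^sub>M N. P (fst z)"
proof -
  interpret N: prob_space N by fact
  obtain Z where Z: "Z \<in> null_sets M" "{x \<in> space M. \<not> P x} \<subseteq> Z"
    using assms(2) unfolding eventually_ae_filter by auto
  show ?thesis
  proof (rule AE_I')
    show "Z \<times> space N \<in> null_sets (M \<Otimes>\<^sub>M N)"
      using Z(1) by (auto simp: null_sets_def N.emeasure_pair_measure_Times)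
    show "{z \<in> space (M \<Otimes>\<^sub>M N). \<not> P (fst z)} \<subseteq> Z \<times> space N"
      using Z(2) by (auto simp: space_pair_measure)
  qed
qed

lemma AE_pair_snd:
  assumes "sigma_finite_measure N" "AE x in N. P x"
  shows "AE z in M \<Otimes>\<^sub>M N. P (snd z)"
proof -
  interpret N: sigma_finite_measure N by fact
  obtain Z where Z: "Z \<in> null_sets N" "{x \<in> space N. \<not> P x} \<subseteq> Z"
    using assms(2) unfolding eventually_ae_filter by auto
  show ?thesis
  proof (rule AE_I')
    show "space M \<times> Z \<in> null_sets (M \<Otimes>\<^sub>M N)"
      using Z(1) by (auto simp: null_sets_def N.emeasure_pair_measure_Times)
    show "{z \<in> space (M \<Otimes>\<^sub>M N). \<not> P (snd z)} \<subseteq> space M \<times> Z"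
      using Z(2) by (auto simp: space_pair_measure)
  qed
qed

definition mark_measure :: "nat \<Rightarrow> nat \<Rightarrow> (real \<times> real \<times> nat set \<times> nat list) measure" where
  "mark_measure n d = exponential_measure 1 \<Otimes>\<^sub>M uniform_measure lborel {0..1} \<Otimes>\<^sub>M measure_pmf (call_pmf n d)"

abbreviation residual_measure :: "(nat set \<times> nat \<times> nat \<Rightarrow> real) measure" where
  "residual_measure \<equiv> Pi\<^sub>M UNIV (\<lambda>_. exponential_measure 1)"

lemma prob_space_uniform_unit: "prob_space (uniform_measure lborel {0..1::real})"
  by (rule prob_space_uniform_measure) auto

lemma prob_space_mark_measure: "prob_space (mark_measure n d)"
  unfolding mark_measure_def
  by (intro prob_space_pair prob_space_exponential_measure prob_space_uniform_unit prob_space_measure_pmf) auto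

locale network =
  fixes n d :: nat and lam :: real
  assumes n: "3 \<le> n" and lam: "0 < lam"
begin

definition rate :: real where "rate = lam * real (n choose 2)"

lemma choose_pos: "0 < n choose 2"
  using n by (simp add: zero_less_binomial)

sublocale arrival_stream "mark_measure n d" rate
  unfolding arrival_stream_def arrival_stream_axioms_def rate_def
  using choose_pos lam prob_space_mark_measure by simp

sublocale res: product_prob_space "\<lambda>_::nat set \<times> nat \<times> nat. exponential_measure 1" UNIV
  unfolding product_prob_space_def product_prob_space_axioms_def product_sigma_finite_def
  using prob_space_exponential_measure [of 1] by (simp add: prob_space_imp_sigma_finite)

lemma arrival_measure_eq: "arrival_measure n lam d = A"
  by (simp add: arrival_measure_def mark_measure_def rate_def)

lemma sample_measure_eq:
  "sample_measure n lam d \<mu> = measure_pmf \<mu> \<Otimes>\<^sub>M residual_measure \<Otimes>\<^sub>M St"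
  by (simp add: sample_measure_def arrival_measure_eq)

sublocale tail: pair_prob_space residual_measure St ..

lemma nn_integral_sample:
  assumes "F \<in> borel_measurable (sample_measure n lam d \<mu>)"
  shows "(\<integral>\<^sup>+\<omega>. F \<omega> \<partial>sample_measure n lam d \<mu>) =
    (\<integral>\<^sup>+x. \<integral>\<^sup>+r. \<integral>\<^sup>+s. F (x, r, s) \<partial>St \<partial>residual_measure \<partial>measure_pmf \<mu>)"
proof -
  have [measurable]: "F \<in> borel_measurable (measure_pmf \<mu> \<Otimes>\<^sub>M residual_measure \<Otimes>\<^sub>M St)"
    using assms by (simp add: sample_measure_eq)
  have "(\<integral>\<^sup>+\<omega>. F \<omega> \<partial>sample_measure n lam d \<mu>) =
      (\<integral>\<^sup>+x. \<integral>\<^sup>+z. F (x, z) \<partial>(residual_measure \<Otimes>\<^sub>M St) \<partial>measure_pmf \<mu>)"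
    unfolding sample_measure_eq by (rule tail.nn_integral_fst [symmetric]) measurable
  also have "\<dots> = (\<integral>\<^sup>+x. \<integral>\<^sup>+r. \<integral>\<^sup>+s. F (x, r, s) \<partial>St \<partial>residual_measure \<partial>measure_pmf \<mu>)"
  proof (rule nn_integral_cong)
    fix x
    have "(\<lambda>z. F (x, z)) \<in> borel_measurable (residual_measure \<Otimes>\<^sub>M St)"
      by measurable
    then show "(\<integral>\<^sup>+z. F (x, z) \<partial>(residual_measure \<Otimes>\<^sub>M St)) = (\<integral>\<^sup>+r. \<integral>\<^sup>+s. F (x, r, s) \<partial>St \<partial>residual_measure)"
      by (rule stream.nn_integral_fst [symmetric])
  qed
  finally show ?thesis .
qed

lemma measurable_coordinates [measurable]:
  "initial_load \<in> sample_measure n lam d \<mu> \<rightarrow>\<^sub>M count_space UNIV"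
  "(\<lambda>\<omega>. residual \<omega> e w k) \<in> borel_measurable (sample_measure n lam d \<mu>)"
  "(\<lambda>\<omega>. gap \<omega> i) \<in> borel_measurable (sample_measure n lam d \<mu>)"
  "(\<lambda>\<omega>. duration \<omega> i) \<in> borel_measurable (sample_measure n lam d \<mu>)"
  "(\<lambda>\<omega>. call \<omega> i) \<in> sample_measure n lam d \<mu> \<rightarrow>\<^sub>M count_space UNIV"
  "(\<lambda>\<omega>. selected \<omega> i) \<in> sample_measure n lam d \<mu> \<rightarrow>\<^sub>M count_space UNIV"
  "(\<lambda>\<omega>. (call \<omega> i, selected \<omega> i)) \<in> sample_measure n lam d \<mu> \<rightarrow>\<^sub>M count_space UNIV"
proof -
  show "initial_load \<in> sample_measure n lam d \<mu> \<rightarrow>\<^sub>M count_space UNIV"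
    unfolding initial_load_def [abs_def] sample_measure_eq by measurable
  show "(\<lambda>\<omega>. residual \<omega> e w k) \<in> borel_measurable (sample_measure n lam d \<mu>)"
    unfolding residual_def sample_measure_eq by measurable
  show "(\<lambda>\<omega>. gap \<omega> i) \<in> borel_measurable (sample_measure n lam d \<mu>)"
    unfolding gap_def sample_measure_eq by measurable
  show "(\<lambda>\<omega>. duration \<omega> i) \<in> borel_measurable (sample_measure n lam d \<mu>)"
    unfolding duration_def sample_measure_eq mark_measure_def by measurable
  have *: "(\<lambda>\<omega>. snd (snd (snd (snd (snd \<omega>) i)))) \<in> sample_measure n lam d \<mu> \<rightarrow>\<^sub>M count_space UNIV"
    unfolding sample_measure_eq mark_measure_def by measurable
  show "(\<lambda>\<omega>. call \<omega> i) \<in> sample_measure n lam d \<mu> \<rightarrow>\<^sub>M count_space UNIV"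
    unfolding call_def by (rule measurable_compose [OF *]) simp
  show "(\<lambda>\<omega>. selected \<omega> i) \<in> sample_measure n lam d \<mu> \<rightarrow>\<^sub>M count_space UNIV"
    unfolding selected_def by (rule measurable_compose [OF *]) simp
  show "(\<lambda>\<omega>. (call \<omega> i, selected \<omega> i)) \<in> sample_measure n lam d \<mu> \<rightarrow>\<^sub>M count_space UNIV"
    unfolding call_def selected_def by (rule measurable_compose [OF *]) simp
qed

lemma measurable_arrival_time [measurable]:
  "(\<lambda>\<omega>. arrival_time \<omega> i) \<in> borel_measurable (sample_measure n lam d \<mu>)"
  unfolding arrival_time_def by measurable

lemma arrival_time_eq: "arrival_time (x, r, s) i = atime s i"
  by (simp add: arrival_time_def atime_def gap_def)

lemma edges_ne: "edges n \<noteq> {}"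
  using choose_pos card_edges [of n] by (metis card.empty less_not_refl)

lemma card_nodes_minus: "e \<in> edges n \<Longrightarrow> card (nodes n - e) = n - 2"
  by (subst card_Diff_subset) (auto simp: edges_def intro: finite_subset)

lemma nodes_minus_ne: "e \<in> edges n \<Longrightarrow> nodes n - e \<noteq> {}"
  using card_nodes_minus [of e] n by (metis card.empty diff_is_0_eq numeral_le_iff not_less_eq_eq numeral_2_eq_2 numeral_3_eq_3 order_refl)

lemma set_call_pmf:
  assumes "c \<in> set_pmf (call_pmf n d)"
  shows "fst c \<in> edges n" "length (snd c) = d" "set (snd c) \<subseteq> nodes n - fst c"
  using assms edges_ne nodes_minus_ne
  by (auto simp: call_pmf_def set_replicate_pmf set_pmf_of_set)

lemma AE_stream:
  "AE \<omega> in sample_measure n lam d \<mu>. \<forall>i. 0 < fst (snd (snd \<omega>) i) \<and> snd (snd (snd (snd (snd \<omega>) i))) \<in> set_pmf (call_pmf n d)"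
proof -
  have "AE z in A. 0 < fst z"
    by (rule AE_pair_fst [OF prob_space_mark_measure AE_exponential_measure [OF rate_pos]])
  moreover have "AE z in A. snd (snd (snd z)) \<in> set_pmf (call_pmf n d)"
  proof -
    have "AE z in measure_pmf (call_pmf n d). z \<in> set_pmf (call_pmf n d)"
      by (rule AE_measure_pmf)
    note AE_pair_snd [OF measure_pmf.sigma_finite_measure_axioms this, of "uniform_measure lborel {0..1}"]
    note AE_pair_snd [OF prob_space_imp_sigma_finite [OF prob_space_pair
      [OF prob_space_uniform_unit prob_space_measure_pmf]] this, of "exponential_measure 1"]
    note AE_pair_snd [OF prob_space_imp_sigma_finite [OF prob_space_mark_measure, unfolded mark_measure_def] this,
      of "exponential_measure rate"]
    then show ?thesis unfolding mark_measure_def .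
  qed
  ultimately have "AE z in A. 0 < fst z \<and> snd (snd (snd z)) \<in> set_pmf (call_pmf n d)"
    by eventually_elim auto
  then have "AE s in St. 0 < fst (s i) \<and> snd (snd (snd (s i))) \<in> set_pmf (call_pmf n d)" for i
    by (intro AE_PiM_component) (simp_all add: arr.prob_space_axioms)
  then have "AE s in St. \<forall>i. 0 < fst (s i) \<and> snd (snd (snd (s i))) \<in> set_pmf (call_pmf n d)"
    by (simp add: AE_all_countable)
  then show "AE \<omega> in sample_measure n lam d \<mu>. \<forall>i. 0 < fst (snd (snd \<omega>) i) \<and> snd (snd (snd (snd (snd \<omega>) i))) \<in> set_pmf (call_pmf n d)"
    unfolding sample_measure_eq
    by (rule AE_pair_snd [OF prob_space_imp_sigma_finite [OF tail.prob_space_axioms]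
      AE_pair_snd [OF prob_space_imp_sigma_finite [OF stream.P.prob_space_axioms]]])
qed

lemma AE_regular:
  assumes "set_pmf \<mu> \<subseteq> states n D"
  shows "AE \<omega> in sample_measure n lam d \<mu>. regular n d D \<omega>"
proof -
  have 2: "AE \<omega> in sample_measure n lam d \<mu>. fst \<omega> \<in> set_pmf \<mu>"
    unfolding sample_measure_eq
    by (rule AE_pair_fst [OF tail.prob_space_axioms AE_measure_pmf])
  show ?thesis
    using AE_stream [of \<mu>] 2
  proof eventually_elim
    case (elim \<omega>)
    then show ?case
      using assms set_call_pmf [of "snd (snd (snd (snd (snd \<omega>) i)))" for i]
      by (auto simp: regular_def initial_load_def gap_def call_def selected_def)
  qed
qed

end

section \<open>Generating functions of the list of selected nodes\<close>

lemma nn_integral_pmf_swap: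
  "(\<integral>\<^sup>+x. \<integral>\<^sup>+y. f x y \<partial>measure_pmf q \<partial>measure_pmf p) = (\<integral>\<^sup>+y. \<integral>\<^sup>+x. f x y \<partial>measure_pmf p \<partial>measure_pmf q)"
proof -
  have "(\<integral>\<^sup>+z. f (fst z) (snd z) \<partial>bind_pmf p (\<lambda>x. bind_pmf q (\<lambda>y. return_pmf (x, y)))) =
     (\<integral>\<^sup>+z. f (fst z) (snd z) \<partial>bind_pmf q (\<lambda>y. bind_pmf p (\<lambda>x. return_pmf (x, y))))"
    by (subst bind_commute_pmf) rule
  then show ?thesis by simp
qed

text \<open>Each selection falls into \<open>W\<close> with probability at most
  \<open>m / card S\<close>, and the selections are independent.\<close>

lemma nn_integral_replicate_hits:
  fixes z :: real
  assumes "finite S" "S \<noteq> {}" "1 \<le> z" "finite W" "card W \<le> m"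
  shows "(\<integral>\<^sup>+ws. ennreal (z ^ card (W \<inter> set ws)) \<partial>replicate_pmf k (pmf_of_set S)) \<le>
    ennreal ((1 + (z - 1) * real m / real (card S)) ^ k)"
proof (induction k)
  case (Suc k)
  have S: "0 < card S" using assms by (simp add: card_gt_0_iff)
  \<comment> \<open>Only distinct nodes count in \<open>W \<inter> set ws\<close>; counting repeated
    hits with multiplicity gives the product bound.\<close>
  have step: "ennreal (z ^ card (W \<inter> set (x # ws))) \<le> ennreal (if x \<in> W then z else 1) * ennreal (z ^ card (W \<inter> set ws))" for x ws
  proof (cases "x \<in> W")
    case True
    then have "card (W \<inter> set (x # ws)) \<le> Suc (card (W \<inter> set ws))"
      by (simp add: card_insert_if)
    then have "z ^ card (W \<inter> set (x # ws)) \<le> z ^ Suc (card (W \<inter> set ws))"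
      using assms by (intro power_increasing) auto
    then show ?thesis using True assms by (simp flip: ennreal_mult)
  qed simp
  have "(\<integral>\<^sup>+ws. ennreal (z ^ card (W \<inter> set ws)) \<partial>replicate_pmf (Suc k) (pmf_of_set S)) \<le>
     (\<integral>\<^sup>+x. ennreal (if x \<in> W then z else 1) *
       (\<integral>\<^sup>+ws. ennreal (z ^ card (W \<inter> set ws)) \<partial>replicate_pmf k (pmf_of_set S)) \<partial>pmf_of_set S)"
    by (simp flip: nn_integral_cmult) (intro nn_integral_mono, use step in simp)
  also have "\<dots> \<le> (\<integral>\<^sup>+x. ennreal (if x \<in> W then z else 1) * ennreal ((1 + (z - 1) * real m / real (card S)) ^ k) \<partial>pmf_of_set S)"
    by (intro nn_integral_mono mult_left_mono Suc.IH) simp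
  also have "\<dots> = (\<integral>\<^sup>+x. ennreal (if x \<in> W then z else 1) \<partial>pmf_of_set S) * ennreal ((1 + (z - 1) * real m / real (card S)) ^ k)"
    by (rule nn_integral_multc) simp
  also have "(\<integral>\<^sup>+x. ennreal (if x \<in> W then z else 1) \<partial>pmf_of_set S) = ennreal ((\<Sum>x\<in>S. if x \<in> W then z else 1) / card S)"
    using assms S by (subst nn_integral_pmf_of_set) (simp_all add: divide_ennreal ennreal_of_nat_eq_real_of_nat sum_nonneg)
  also have "(\<Sum>x\<in>S. if x \<in> W then z else 1) = card S + (z - 1) * card (S \<inter> W)"
  proof -
    have "(\<Sum>x\<in>S. if x \<in> W then z else 1) = (\<Sum>x\<in>S. 1 + (z - 1) * (if x \<in> W then 1 else 0))"
      by (rule sum.cong) auto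
    also have "\<dots> = card S + (z - 1) * card (S \<inter> W)"
      using assms by (simp add: sum.distrib sum.If_cases Int_def flip: sum_distrib_left)
    finally show ?thesis .
  qed
  also have "ennreal ((card S + (z - 1) * card (S \<inter> W)) / card S) * ennreal ((1 + (z - 1) * real m / real (card S)) ^ k) \<le>
      ennreal (1 + (z - 1) * real m / real (card S)) * ennreal ((1 + (z - 1) * real m / real (card S)) ^ k)"
  proof (rule mult_right_mono [OF ennreal_leI])
    have "card (S \<inter> W) \<le> card W" using assms by (intro card_mono) auto
    then have "(z - 1) * card (S \<inter> W) \<le> (z - 1) * m"
      using assms by (intro mult_left_mono) auto
    then show "(card S + (z - 1) * card (S \<inter> W)) / card S \<le> 1 + (z - 1) * real m / real (card S)"
      using S by (simp add: add_divide_distrib divide_right_mono)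
  qed simp
  finally show ?case
    using assms S by (simp del: ennreal_plus flip: ennreal_mult)
qed simp

text \<open>Given \<open>j\<close> earlier selections, the next one either repeats one of at most
  \<open>j\<close> nodes, with probability at most \<open>j / card S\<close> and no gain, or it is
  new and contributes the factor \<open>y\<close>. This is the price of selecting with
  replacement.\<close>

lemma nn_integral_replicate_card_set:
  fixes y :: real
  assumes "finite S" "S \<noteq> {}" "0 \<le> y" "y \<le> 1"
  shows "(\<integral>\<^sup>+ws. ennreal (y ^ card (set ws)) \<partial>replicate_pmf k (pmf_of_set S)) \<le>
    ennreal (\<Prod>j<k. y + real j / real (card S))"
proof (induction k)
  case (Suc k)
  have S: "0 < card S" using assms by (simp add: card_gt_0_iff)
  have "(\<integral>\<^sup>+ws. ennreal (y ^ card (set ws)) \<partial>replicate_pmf (Suc k) (pmf_of_set S)) =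
     (\<integral>\<^sup>+x. \<integral>\<^sup>+ws. ennreal (y ^ card (insert x (set ws))) \<partial>replicate_pmf k (pmf_of_set S) \<partial>pmf_of_set S)"
    by simp
  \<comment> \<open>The new selection \<open>x\<close> is averaged with the others held
    fixed.\<close>
  also have "\<dots> = (\<integral>\<^sup>+ws. \<integral>\<^sup>+x. ennreal (y ^ card (insert x (set ws))) \<partial>pmf_of_set S \<partial>replicate_pmf k (pmf_of_set S))"
    by (rule nn_integral_pmf_swap)
  also have "\<dots> \<le> (\<integral>\<^sup>+ws. ennreal (y ^ card (set ws)) * ennreal (y + real k / real (card S)) \<partial>replicate_pmf k (pmf_of_set S))"
  proof (rule nn_integral_mono_AE, rule AE_pmfI)
    fix ws assume "ws \<in> set_pmf (replicate_pmf k (pmf_of_set S))"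
    then have ws: "length ws = k" by (simp add: set_replicate_pmf)
    have "(\<Sum>x\<in>S. y ^ card (insert x (set ws))) \<le> (\<Sum>x\<in>S. y ^ card (set ws) * (y + (if x \<in> set ws then 1 else 0)))"
      using assms by (intro sum_mono) (auto simp: insert_absorb card_insert_if algebra_simps)
    also have "\<dots> = y ^ card (set ws) * (y * card S + card (S \<inter> set ws))"
      using assms by (simp add: sum.distrib sum.If_cases Int_def flip: sum_distrib_left)
    also have "\<dots> \<le> y ^ card (set ws) * (y * card S + k)"
    proof -
      have "card (S \<inter> set ws) \<le> card (set ws)" by (intro card_mono) auto
      also have "\<dots> \<le> k" using ws card_length by metis
      finally show ?thesis using assms by (intro mult_left_mono add_mono) auto
    qed
    finally have "(\<Sum>x\<in>S. y ^ card (insert x (set ws))) / card S \<le> y ^ card (set ws) * (y + real k / real (card S))"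
      using S by (simp add: field_simps)
    then show "(\<integral>\<^sup>+x. ennreal (y ^ card (insert x (set ws))) \<partial>pmf_of_set S) \<le> ennreal (y ^ card (set ws)) * ennreal (y + real k / real (card S))"
      using assms S
      by (subst nn_integral_pmf_of_set)
        (simp_all add: divide_ennreal ennreal_of_nat_eq_real_of_nat sum_nonneg ennreal_leI del: ennreal_plus flip: ennreal_mult)
  qed
  also have "\<dots> = (\<integral>\<^sup>+ws. ennreal (y ^ card (set ws)) \<partial>replicate_pmf k (pmf_of_set S)) * ennreal (y + real k / real (card S))"
    by (rule nn_integral_multc) simp
  also have "\<dots> \<le> ennreal (\<Prod>j<k. y + real j / real (card S)) * ennreal (y + real k / real (card S))"
    by (intro mult_right_mono Suc.IH) simp
  finally show ?case
    using assms by (simp add: prod_nonneg del: ennreal_plus flip: ennreal_mult)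
qed simp


section \<open>Exponential moments of the number of calls in progress\<close>

text \<open>A convex function lies below its chord, here over the unit interval.\<close>

lemma power_Suc_minus_one_le:
  fixes x :: real
  assumes "0 \<le> x" "x \<le> 1"
  shows "(1 + x) ^ k - 1 \<le> (2 ^ k - 1) * x"
proof (induction k)
  case (Suc k)
  have "(1 + x) ^ Suc k - 1 = (1 + x) * ((1 + x) ^ k - 1) + x"
    by (simp add: algebra_simps)
  also have "\<dots> \<le> (1 + x) * ((2 ^ k - 1) * x) + x"
    using Suc assms by (intro add_right_mono mult_left_mono) auto
  also have "\<dots> \<le> 2 * ((2 ^ k - 1) * x) + x"
    using assms by (intro add_right_mono mult_right_mono) auto
  also have "\<dots> = (2 ^ Suc k - 1) * x"
    by (simp add: algebra_simps)
  finally show ?case .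
qed simp

lemma card_incident_edges_le:
  assumes "u \<in> nodes n"
  shows "card {e \<in> edges n. u \<in> e} \<le> n - 1"
proof -
  have "{e \<in> edges n. u \<in> e} \<subseteq> (\<lambda>v. {u, v}) ` (nodes n - {u})"
    by (auto elim: edge_eq_pair)
  then have "card {e \<in> edges n. u \<in> e} \<le> card ((\<lambda>v. {u, v}) ` (nodes n - {u}))"
    by (intro card_mono) auto
  also have "\<dots> \<le> card (nodes n - {u})"
    by (rule card_image_le) simp
  also have "\<dots> = n - 1"
    using assms by simp
  finally show ?thesis .
qed

lemma card_meets_le:
  assumes "e \<in> edges n"
  shows "card (meets n e) \<le> 2 * (n - 1)"
proof -
  have e: "finite e" "card e = 2" "e \<subseteq> nodes n"
    using assms by (auto simp: edges_def intro: finite_subset)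
  have "meets n e = (\<Union>u\<in>e. {e' \<in> edges n. u \<in> e'})"
    by (auto simp: meets_def)
  then have "card (meets n e) \<le> (\<Sum>u\<in>e. card {e' \<in> edges n. u \<in> e'})"
    using e by (simp add: card_UN_le)
  also have "\<dots> \<le> (\<Sum>u\<in>e. n - 1)"
    using e by (intro sum_mono card_incident_edges_le) auto
  finally show ?thesis using e by simp
qed

lemma finite_set_call_pmf_lists: "finite {c. fst c \<in> edges n \<and> length (snd c) = d \<and> set (snd c) \<subseteq> nodes n - fst c}"
  by (rule finite_subset [of _ "edges n \<times> {ws. set ws \<subseteq> nodes n \<and> length ws = d}"])
    (auto intro!: finite_cartesian_product finite_lists_length_eq)

text \<open>The factor by which a call of age \<open>t\<close> enters \<open>z\<close> to the power
  of the total number of hits: 1 if it has not arrived yet or has already ended.\<close>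

definition boost :: "real \<Rightarrow> nat set \<Rightarrow> nat set \<Rightarrow> real \<Rightarrow> real \<times> real \<times> nat set \<times> nat list \<Rightarrow> ennreal" where
  "boost z e W t m = (if 0 \<le> t \<and> t < fst m then ennreal (z ^ hits e W (snd (snd m))) else 1)"

context network
begin

lemma finite_set_call_pmf: "finite (set_pmf (call_pmf n d))"
  by (rule finite_subset [OF _ finite_set_call_pmf_lists [of n d]]) (use set_call_pmf in blast)

text \<open>Bounds the mean of \<open>z ^ hits - 1\<close> for a random call: the first factor
  bounds the probability of meeting a given \<open>e\<close>, the second the mean given this. For
  fixed \<open>z\<close> it is of order \<open>1 / n ^ 2\<close>, so that
  \<open>rate * kappa z\<close> stays bounded in \<open>n\<close>.\<close>

definition kappa :: "real \<Rightarrow> real" where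
  "kappa z = 2 * real (n - 1) / real (n choose 2) * ((1 + (z - 1) * d / real (n - 2)) ^ d - 1)"

lemma kappa_nonneg: "1 \<le> z \<Longrightarrow> 0 \<le> kappa z"
  unfolding kappa_def by (intro mult_nonneg_nonneg) auto

lemma nn_integral_replicate_minus_one:
  assumes "e' \<in> edges n" "finite W" "card W \<le> d" "1 \<le> z"
  shows "(\<integral>\<^sup>+ws. ennreal (z ^ card (W \<inter> set ws) - 1) \<partial>replicate_pmf d (pmf_of_set (nodes n - e'))) \<le>
    ennreal ((1 + (z - 1) * d / real (n - 2)) ^ d - 1)"
proof -
  let ?p = "replicate_pmf d (pmf_of_set (nodes n - e'))" and ?b = "(1 + (z - 1) * d / real (n - 2)) ^ d"
  have b: "1 \<le> ?b" using assms by (intro one_le_power) auto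
  \<comment> \<open>Subtraction in \<open>ennreal\<close> is truncated, so 1 is added on both sides
    and cancelled at the end.\<close>
  have "1 + (\<integral>\<^sup>+ws. ennreal (z ^ card (W \<inter> set ws) - 1) \<partial>?p) =
      (\<integral>\<^sup>+ws. 1 + ennreal (z ^ card (W \<inter> set ws) - 1) \<partial>?p)"
    by (subst nn_integral_add) auto
  also have "\<dots> = (\<integral>\<^sup>+ws. ennreal (z ^ card (W \<inter> set ws)) \<partial>?p)"
  proof (intro nn_integral_cong)
    fix ws
    have "1 \<le> z ^ card (W \<inter> set ws)" using assms by (intro one_le_power)
    then show "1 + ennreal (z ^ card (W \<inter> set ws) - 1) = ennreal (z ^ card (W \<inter> set ws))"
      by (simp flip: ennreal_1 ennreal_plus)
  qed
  also have "\<dots> \<le> ennreal ?b"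
    using nn_integral_replicate_hits [OF _ nodes_minus_ne [OF assms(1)] assms(4,2,3), of d] card_nodes_minus [OF assms(1)]
    by simp
  also have "\<dots> = 1 + ennreal (?b - 1)"
    using b by (simp flip: ennreal_1 ennreal_plus)
  finally show ?thesis by (simp add: ennreal_add_left_cancel_le)
qed

lemma nn_integral_call_pmf_hits:
  assumes e: "e \<in> edges n" and W: "finite W" "card W \<le> d" and z: "1 \<le> z"
  shows "(\<integral>\<^sup>+c. ennreal (z ^ hits e W c - 1) \<partial>call_pmf n d) \<le> ennreal (kappa z)"
proof -
  let ?b = "(1 + (z - 1) * d / real (n - 2)) ^ d - 1"
  have b: "0 \<le> ?b" using z by simp
  have "(\<integral>\<^sup>+c. ennreal (z ^ hits e W c - 1) \<partial>call_pmf n d) =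
    (\<integral>\<^sup>+e'. \<integral>\<^sup>+ws. ennreal (z ^ hits e W (e', ws) - 1) \<partial>replicate_pmf d (pmf_of_set (nodes n - e')) \<partial>pmf_of_set (edges n))"
    by (simp add: call_pmf_def)
  also have "\<dots> \<le> (\<integral>\<^sup>+e'. ennreal (if e' \<in> meets n e then ?b else 0) \<partial>pmf_of_set (edges n))"
  proof (rule nn_integral_mono_AE, rule AE_pmfI)
    fix e' assume "e' \<in> set_pmf (pmf_of_set (edges n))"
    then have e': "e' \<in> edges n" using edges_ne by simp
    show "(\<integral>\<^sup>+ws. ennreal (z ^ hits e W (e', ws) - 1) \<partial>replicate_pmf d (pmf_of_set (nodes n - e'))) \<le>
        ennreal (if e' \<in> meets n e then ?b else 0)"
      using nn_integral_replicate_minus_one [OF e' W z] e' by (auto simp: hits_def meets_def)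
  qed
  also have "\<dots> = ennreal ((\<Sum>e'\<in>edges n. if e' \<in> meets n e then ?b else 0) / real (n choose 2))"
    using edges_ne b choose_pos
    by (subst nn_integral_pmf_of_set)
      (simp_all add: divide_ennreal ennreal_of_nat_eq_real_of_nat sum_nonneg card_edges)
  also have "(\<Sum>e'\<in>edges n. if e' \<in> meets n e then ?b else 0) = card (meets n e) * ?b"
    by (subst sum.inter_filter [symmetric]) (auto simp: meets_def)
  also have "ennreal (card (meets n e) * ?b / real (n choose 2)) \<le> ennreal (kappa z)"
  proof (rule ennreal_leI)
    have "real (card (meets n e)) \<le> 2 * real (n - 1)"
      using card_meets_le [OF e] by (simp flip: of_nat_mult)
    then have "card (meets n e) * ?b / real (n choose 2) \<le> 2 * real (n - 1) * ?b / real (n choose 2)"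
      using b by (intro divide_right_mono mult_right_mono) auto
    then show "card (meets n e) * ?b / real (n choose 2) \<le> kappa z"
      by (simp add: kappa_def)
  qed
  finally show ?thesis .
qed

lemma nn_integral_mark:
  assumes H: "H \<in> borel_measurable (mark_measure n d)"
  shows "(\<integral>\<^sup>+m. H m \<partial>mark_measure n d) = (\<integral>\<^sup>+x. \<integral>\<^sup>+y. \<integral>\<^sup>+c. H (x, y, c) \<partial>call_pmf n d
    \<partial>uniform_measure lborel {0..1::real} \<partial>exponential_measure 1)"
proof -
  interpret UP: pair_prob_space "uniform_measure lborel {0..1::real}" "measure_pmf (call_pmf n d)"
    unfolding pair_prob_space_def pair_sigma_finite_def
    using prob_space_uniform_unit by (simp add: prob_space_imp_sigma_finite prob_space_measure_pmf)
  have [measurable]: "H \<in> borel_measurable (exponential_measure 1 \<Otimes>\<^sub>M uniform_measure lborel {0..1} \<Otimes>\<^sub>M measure_pmf (call_pmf n d))"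
    using H by (simp add: mark_measure_def)
  have "(\<integral>\<^sup>+m. H m \<partial>mark_measure n d) = (\<integral>\<^sup>+x. \<integral>\<^sup>+m. H (x, m) \<partial>(uniform_measure lborel {0..1::real} \<Otimes>\<^sub>M measure_pmf (call_pmf n d)) \<partial>exponential_measure 1)"
    unfolding mark_measure_def by (rule UP.nn_integral_fst [symmetric, where f = H]) measurable
  also have "\<dots> = (\<integral>\<^sup>+x. \<integral>\<^sup>+y. \<integral>\<^sup>+c. H (x, y, c) \<partial>call_pmf n d
    \<partial>uniform_measure lborel {0..1::real} \<partial>exponential_measure 1)"
    by (intro nn_integral_cong measure_pmf.nn_integral_fst [symmetric, where f = "\<lambda>m. H (x, m)" for x]) measurable
  finally show ?thesis .
qed

lemma measurable_mark_coordinates [measurable]: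
  "fst \<in> borel_measurable (mark_measure n d)"
  "(\<lambda>m. snd (snd m)) \<in> mark_measure n d \<rightarrow>\<^sub>M count_space UNIV"
  unfolding mark_measure_def by measurable

lemma measurable_arrival_update [measurable (raw)]:
  "f \<in> N \<rightarrow>\<^sub>M St \<Longrightarrow> h \<in> N \<rightarrow>\<^sub>M A \<Longrightarrow> (\<lambda>x. (f x)(i := h x)) \<in> N \<rightarrow>\<^sub>M St"
  by (rule measurable_fun_upd [where J = UNIV]) auto

lemma measurable_boost [measurable]:
  "case_prod (boost z e W) \<in> borel_measurable (borel \<Otimes>\<^sub>M mark_measure n d)"
proof -
  have [measurable]: "(\<lambda>x. hits e W (snd (snd (snd x)))) \<in> borel \<Otimes>\<^sub>M mark_measure n d \<rightarrow>\<^sub>M count_space UNIV"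
    by (rule measurable_compose [where N = "count_space UNIV" and g = "hits e W"]) measurable
  have [measurable]: "(\<lambda>x. fst (snd x)) \<in> borel \<Otimes>\<^sub>M mark_measure n d \<rightarrow>\<^sub>M borel"
    unfolding mark_measure_def by measurable
  show ?thesis
    unfolding boost_def [abs_def] case_prod_unfold by measurable
qed

text \<open>The duration is independent of the selections and exceeds the age \<open>t\<close> with
  probability \<open>exp (- t)\<close>. This gives the decay in the age that the product estimates
  require.\<close>

lemma nn_integral_boost:
  assumes e: "e \<in> edges n" and W: "finite W" "card W \<le> d" and z: "1 \<le> z" and t: "0 \<le> t"
  shows "(\<integral>\<^sup>+m. boost z e W t m \<partial>mark_measure n d) \<le> ennreal (1 + kappa z * exp (- t))"
proof -
  have E1: "emeasure (exponential_measure 1) UNIV = 1"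
    using prob_space.emeasure_space_1 [OF prob_space_exponential_measure [of 1]] by simp
  interpret U: prob_space "uniform_measure lborel {0..1::real}" by (rule prob_space_uniform_unit)
  let ?g = "\<lambda>c. ennreal (z ^ hits e W c - 1)"
  have [measurable]: "(\<lambda>m. ?g (snd (snd m))) \<in> borel_measurable (mark_measure n d)"
    by (rule measurable_compose [where N = "count_space UNIV" and g = ?g]) measurable
  have "(\<integral>\<^sup>+m. boost z e W t m \<partial>mark_measure n d) =
      (\<integral>\<^sup>+m. 1 + indicator {t<..} (fst m) * ?g (snd (snd m)) \<partial>mark_measure n d)"
  proof (intro nn_integral_cong)
    fix m :: "real \<times> real \<times> nat set \<times> nat list"
    have "1 \<le> z ^ hits e W (snd (snd m))" using z by (intro one_le_power)
    then have "1 + ?g (snd (snd m)) = ennreal (z ^ hits e W (snd (snd m)))"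
      by (simp flip: ennreal_1 ennreal_plus)
    then show "boost z e W t m = 1 + indicator {t<..} (fst m) * ?g (snd (snd m))"
      using t by (simp add: boost_def indicator_def)
  qed
  also have "\<dots> = (\<integral>\<^sup>+x. \<integral>\<^sup>+y. \<integral>\<^sup>+c. 1 + indicator {t<..} x * ?g c \<partial>call_pmf n d \<partial>uniform_measure lborel {0..1::real} \<partial>exponential_measure 1)"
    by (subst nn_integral_mark) simp_all
  also have "\<dots> = (\<integral>\<^sup>+x. 1 + indicator {t<..} x * (\<integral>\<^sup>+c. ?g c \<partial>call_pmf n d) \<partial>exponential_measure 1)"
    by (simp add: nn_integral_add nn_integral_cmult U.emeasure_space_1 [simplified])
  also have "\<dots> = 1 + emeasure (exponential_measure 1) {t<..} * (\<integral>\<^sup>+c. ?g c \<partial>call_pmf n d)"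
    by (simp add: nn_integral_add nn_integral_multc E1)
  also have "\<dots> \<le> 1 + ennreal (exp (- t)) * ennreal (kappa z)"
    by (intro add_left_mono mult_mono emeasure_exponential_measure_greaterThan t nn_integral_call_pmf_hits e W z) auto
  also have "\<dots> = ennreal (1 + kappa z * exp (- t))"
    using kappa_nonneg [OF z] by (simp add: mult.commute flip: ennreal_mult)
  finally show ?thesis .
qed

lemma arrival_sum_boost_le:
  assumes e: "e \<in> edges n" and W: "finite W" "card W \<le> d" and z: "1 \<le> z" and t: "t1 \<le> t2"
  shows "(\<Sum>i<m. \<integral>\<^sup>+s. indicator {t1..t2} (atime s i) * (\<Prod>j<i. boost z e W (atime s i - atime s j) (snd (s j))) \<partial>St)
    \<le> ennreal (rate * (t2 - t1)) * ennreal (exp (rate * kappa z))"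
proof -
  note k = kappa_nonneg [OF z]
  have "(\<Sum>i<m. \<integral>\<^sup>+s. indicator {t1..t2} (atime s i) * (\<Prod>j<i. boost z e W (atime s i - atime s j) (snd (s j))) \<partial>St)
    \<le> (\<integral>\<^sup>+t. indicator {t1..t2} t * ennreal (rate * exp (rate * kappa z * (1 - exp (- t)))) * indicator {0..} t \<partial>lborel)"
    by (rule arrival_sum_product_le [OF measurable_boost k nn_integral_boost [OF e W z]]) auto
  also have "\<dots> \<le> (\<integral>\<^sup>+t. ennreal (rate * exp (rate * kappa z)) * indicator {t1..t2} t \<partial>lborel)"
  proof (rule nn_integral_mono)
    fix t :: real
    have "rate * kappa z * (1 - exp (- t)) \<le> rate * kappa z * 1"
      using k rate_pos by (intro mult_left_mono) auto
    then have "ennreal (rate * exp (rate * kappa z * (1 - exp (- t)))) \<le> ennreal (rate * exp (rate * kappa z))"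
      using rate_pos by (intro ennreal_leI mult_left_mono) auto
    then show "indicator {t1..t2} t * ennreal (rate * exp (rate * kappa z * (1 - exp (- t)))) * indicator {0..} t
       \<le> ennreal (rate * exp (rate * kappa z)) * indicator {t1..t2} t"
      by (simp add: indicator_def)
  qed
  also have "\<dots> = ennreal (rate * exp (rate * kappa z)) * ennreal (t2 - t1)"
    using t by (simp add: nn_integral_cmult_indicator)
  also have "\<dots> = ennreal (rate * (t2 - t1)) * ennreal (exp (rate * kappa z))"
    using rate_pos t by (simp add: mult_ac flip: ennreal_mult)
  finally show ?thesis .
qed

text \<open>Exchanging one coordinate of an independent sequence for a fresh copy preserves the law.
  It isolates the randomness of a single arrival.\<close>

lemma nn_integral_resample_arrival:
  assumes [measurable]: "H \<in> borel_measurable St"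
  shows "(\<integral>\<^sup>+s. H s \<partial>St) = (\<integral>\<^sup>+s. \<integral>\<^sup>+a. H (s(i := a)) \<partial>A \<partial>St)"
proof -
  interpret AS: pair_prob_space A St ..
  have ps: "prob_space A" by (rule arr.prob_space_axioms)
  have "(\<integral>\<^sup>+s. H s \<partial>St) = (\<integral>\<^sup>+s. H s \<partial>distr (A \<Otimes>\<^sub>M St) St (\<lambda>(a, s). s(i := a)))"
    using distr_pair_PiM_eq_PiM [of UNIV "\<lambda>_. A" i] ps by simp
  also have "\<dots> = (\<integral>\<^sup>+z. H ((snd z)(i := fst z)) \<partial>(A \<Otimes>\<^sub>M St))"
    by (subst nn_integral_distr) (auto simp: case_prod_unfold)
  also have "\<dots> = (\<integral>\<^sup>+s. \<integral>\<^sup>+a. H (s(i := a)) \<partial>A \<partial>St)"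
    by (subst AS.nn_integral_snd [symmetric]) auto
  finally show ?thesis .
qed

lemma nn_integral_arrival:
  assumes [measurable]: "H \<in> borel_measurable A"
  shows "(\<integral>\<^sup>+a. H a \<partial>A) = (\<integral>\<^sup>+g. \<integral>\<^sup>+x. \<integral>\<^sup>+y. \<integral>\<^sup>+c. H (g, x, y, c) \<partial>call_pmf n d
    \<partial>uniform_measure lborel {0..1::real} \<partial>exponential_measure 1 \<partial>exponential_measure rate)"
  by (subst mark.nn_integral_fst [symmetric]) (auto intro!: nn_integral_cong nn_integral_mark [where H = "\<lambda>m. H (g, m)" for g])

text \<open>\<open>F\<close> may involve the gap, the duration and the tie-breaking variable of
  arrival \<open>i\<close>, but neither its call nor its selected nodes; averaging over a fresh
  arrival \<open>i\<close> then factorises.\<close>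

lemma stream_call_independent:
  assumes F [measurable]: "F \<in> borel_measurable St"
    and indep: "\<And>s g x y c c'. F (s(i := (g, x, y, c))) = F (s(i := (g, x, y, c')))"
  shows "(\<integral>\<^sup>+s. F s * G (snd (snd (snd (s i)))) \<partial>St) = (\<integral>\<^sup>+s. F s \<partial>St) * (\<integral>\<^sup>+c. G c \<partial>call_pmf n d)"
proof -
  interpret U: prob_space "uniform_measure lborel {0..1::real}" by (rule prob_space_uniform_unit)
  interpret E: prob_space "exponential_measure 1" by (rule prob_space_exponential_measure) simp
  let ?K = "\<integral>\<^sup>+c. G c \<partial>call_pmf n d"
  have Gm [measurable]: "(\<lambda>a. G (snd (snd (snd a)))) \<in> borel_measurable A"
    by (rule measurable_compose [where N = "count_space UNIV" and g = G]) measurable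
  have pt: "(\<integral>\<^sup>+a. F (s(i := a)) * G (snd (snd (snd a))) \<partial>A) = (\<integral>\<^sup>+a. F (s(i := a)) \<partial>A) * ?K"
    if "s \<in> space St" for s
  proof -
    have fA [measurable]: "(\<lambda>a. F (s(i := a))) \<in> borel_measurable A"
      using that by measurable
    define f where "f g x y = F (s(i := (g, x, y, undefined)))" for g x y
    have f: "F (s(i := (g, x, y, c))) = f g x y" for g x y c
      unfolding f_def by (rule indep)
    have [measurable]: "(\<lambda>a. F (s(i := a))) \<in> borel_measurable (borel \<Otimes>\<^sub>M borel \<Otimes>\<^sub>M borel \<Otimes>\<^sub>M count_space UNIV)"
      using fA by (simp add: mark_measure_def cong: measurable_cong_sets sets_pair_measure_cong)
    have m1: "f g x \<in> borel_measurable (uniform_measure lborel {0..1::real})" for g x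
      unfolding f_def [abs_def] by measurable
    have m2: "(\<lambda>x. \<integral>\<^sup>+y. f g x y \<partial>uniform_measure lborel {0..1::real}) \<in> borel_measurable (exponential_measure 1)" for g
      unfolding f_def by measurable
    have m3: "(\<lambda>g. \<integral>\<^sup>+x. \<integral>\<^sup>+y. f g x y
      \<partial>uniform_measure lborel {0..1::real} \<partial>exponential_measure 1) \<in> borel_measurable (exponential_measure rate)"
      unfolding f_def by measurable
    have "(\<integral>\<^sup>+a. F (s(i := a)) * G (snd (snd (snd a))) \<partial>A) = (\<integral>\<^sup>+g. \<integral>\<^sup>+x. \<integral>\<^sup>+y. \<integral>\<^sup>+c. f g x y * G c \<partial>call_pmf n d
      \<partial>uniform_measure lborel {0..1::real} \<partial>exponential_measure 1 \<partial>exponential_measure rate)"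
      by (subst nn_integral_arrival) (simp_all add: f)
    also have "\<dots> = (\<integral>\<^sup>+g. \<integral>\<^sup>+x. \<integral>\<^sup>+y. f g x y
      \<partial>uniform_measure lborel {0..1::real} \<partial>exponential_measure 1 \<partial>exponential_measure rate) * ?K"
      by (simp add: nn_integral_cmult nn_integral_multc m1 m2 m3)
    also have "(\<integral>\<^sup>+g. \<integral>\<^sup>+x. \<integral>\<^sup>+y. f g x y
      \<partial>uniform_measure lborel {0..1::real} \<partial>exponential_measure 1 \<partial>exponential_measure rate) = (\<integral>\<^sup>+a. F (s(i := a)) \<partial>A)"
      by (subst nn_integral_arrival) (simp_all add: f)
    finally show ?thesis .
  qed
  have "(\<integral>\<^sup>+s. F s * G (snd (snd (snd (s i)))) \<partial>St) = (\<integral>\<^sup>+s. \<integral>\<^sup>+a. F (s(i := a)) * G (snd (snd (snd a))) \<partial>A \<partial>St)"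
    by (subst nn_integral_resample_arrival [where i = i]) simp_all
  also have "\<dots> = (\<integral>\<^sup>+s. (\<integral>\<^sup>+a. F (s(i := a)) \<partial>A) * ?K \<partial>St)"
    by (intro nn_integral_cong pt)
  also have "\<dots> = (\<integral>\<^sup>+s. (\<integral>\<^sup>+a. F (s(i := a)) \<partial>A) \<partial>St) * ?K"
    by (rule nn_integral_multc) measurable
  also have "(\<integral>\<^sup>+s. (\<integral>\<^sup>+a. F (s(i := a)) \<partial>A) \<partial>St) = (\<integral>\<^sup>+s. F s \<partial>St)"
    by (rule nn_integral_resample_arrival [symmetric]) simp
  finally show ?thesis .
qed

end


section \<open>Upper bounds for the mean number of lost calls\<close>

context network
begin

lemma measurable_stream_call [measurable]:
  "(\<lambda>s. snd (snd (snd (s i)))) \<in> St \<rightarrow>\<^sub>M count_space UNIV"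
proof -
  have [measurable]: "(\<lambda>a. snd (snd (snd a))) \<in> A \<rightarrow>\<^sub>M count_space UNIV"
    by measurable
  show ?thesis by measurable
qed

lemma nn_integral_sample_split:
  assumes "f \<in> borel_measurable (measure_pmf \<mu> \<Otimes>\<^sub>M residual_measure)" "g \<in> borel_measurable St"
  shows "(\<integral>\<^sup>+\<omega>. f (fst \<omega>, fst (snd \<omega>)) * g (snd (snd \<omega>)) \<partial>sample_measure n lam d \<mu>) =
    (\<integral>\<^sup>+z. f z \<partial>(measure_pmf \<mu> \<Otimes>\<^sub>M residual_measure)) * (\<integral>\<^sup>+s. g s \<partial>St)"
proof -
  note [measurable] = assms
  have "(\<integral>\<^sup>+\<omega>. f (fst \<omega>, fst (snd \<omega>)) * g (snd (snd \<omega>)) \<partial>sample_measure n lam d \<mu>) =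
     (\<integral>\<^sup>+x. \<integral>\<^sup>+r. f (x, r) * (\<integral>\<^sup>+s. g s \<partial>St) \<partial>residual_measure \<partial>measure_pmf \<mu>)"
    by (subst nn_integral_sample) (simp_all add: nn_integral_cmult sample_measure_eq)
  also have "\<dots> = (\<integral>\<^sup>+x. \<integral>\<^sup>+r. f (x, r) \<partial>residual_measure \<partial>measure_pmf \<mu>) * (\<integral>\<^sup>+s. g s \<partial>St)"
    by (simp add: nn_integral_multc)
  also have "(\<integral>\<^sup>+x. \<integral>\<^sup>+r. f (x, r) \<partial>residual_measure \<partial>measure_pmf \<mu>) = (\<integral>\<^sup>+z. f z \<partial>(measure_pmf \<mu> \<Otimes>\<^sub>M residual_measure))"
    by (rule res.nn_integral_fst) measurable
  finally show ?thesis .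
qed

lemma nn_integral_initial:
  "(\<integral>\<^sup>+z. f (fst z) \<partial>(measure_pmf \<mu> \<Otimes>\<^sub>M residual_measure)) = (\<integral>\<^sup>+x. f x \<partial>measure_pmf \<mu>)"
proof -
  have [measurable]: "(\<lambda>z. f (fst z)) \<in> borel_measurable (measure_pmf \<mu> \<Otimes>\<^sub>M residual_measure)"
    by (rule measurable_compose [OF measurable_fst]) simp
  show ?thesis
    by (subst res.nn_integral_fst [symmetric]) (simp_all add: res.P.emeasure_space_1)
qed

lemma AE_call_pmf:
  "AE \<omega> in sample_measure n lam d \<mu>. \<forall>i. (call \<omega> i, selected \<omega> i) \<in> set_pmf (call_pmf n d)"
  using AE_stream [of \<mu>] by eventually_elim (simp add: call_def selected_def)

lemma arrivals_in_interval_le: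
  "t1 \<le> t2 \<Longrightarrow> (\<Sum>i. \<integral>\<^sup>+s. indicator {t1..t2} (atime s i) \<partial>St) \<le> ennreal (rate * (t2 - t1))"
proof -
  assume t: "t1 \<le> t2"
  have "(\<Sum>i. \<integral>\<^sup>+s. indicator {t1..t2} (atime s i) \<partial>St) = ennreal rate * (\<integral>\<^sup>+t. indicator {t1..t2} t * indicator {0..} t \<partial>lborel)"
    by (rule suminf_nn_integral_atime) simp
  also have "\<dots> \<le> ennreal rate * (\<integral>\<^sup>+t. indicator {t1..t2} t \<partial>lborel)"
    by (intro mult_left_mono nn_integral_mono) (auto simp: indicator_def)
  also have "\<dots> = ennreal (rate * (t2 - t1))"
    using t rate_pos by (simp add: ennreal_mult)
  finally show ?thesis .
qed

text \<open>Markov's inequality in pointwise form: a loss forces at least \<open>D\<close> hits for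
  each distinct selected node, hence \<open>D * card W\<close> in total. Coinciding selections
  impose no further constraint, so the exponent contains \<open>card W\<close> and not
  \<open>d\<close>.\<close>

lemma lost_call_markov:
  assumes R: "gdar_rule n d D R" and reg: "regular n d D \<omega>" and lost: "route n D R \<omega> i = None"
    and z: "1 \<le> z"
    and surv: "\<And>w. surviving n \<omega> (arrival_time \<omega> i) (call \<omega> i) w \<le> q w"
  defines "W \<equiv> set (selected \<omega> i)"
  shows "1 \<le> ennreal ((1 / z) ^ (D * card W) * z ^ (\<Sum>w\<in>W. q w)) *
    (\<Prod>j<i. boost z (call \<omega> i) W (arrival_time \<omega> i - arrival_time \<omega> j) (snd (snd (snd \<omega>) j)))"
proof -
  let ?t = "arrival_time \<omega> i" and ?e = "call \<omega> i"
  let ?N = "\<lambda>j. if in_progress \<omega> ?t j then hits ?e W (call \<omega> j, selected \<omega> j) else 0"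
  have "D * card W = (\<Sum>w\<in>W. D)" by simp
  also have "\<dots> \<le> (\<Sum>w\<in>W. q w + card {j\<in>{..<i}. in_progress \<omega> ?t j \<and> call \<omega> j \<inter> ?e \<noteq> {} \<and> w \<in> set (selected \<omega> j)})"
    using lost_call_bound [OF R reg lost] surv unfolding W_def by (intro sum_mono) (meson add_mono order.refl order.trans)
  also have "\<dots> = (\<Sum>w\<in>W. q w) + (\<Sum>j<i. ?N j)"
    using sum_card_hits [of W "{..<i}" "in_progress \<omega> ?t" "\<lambda>j. (call \<omega> j, selected \<omega> j)" ?e]
    by (simp add: sum.distrib W_def)
  finally have "z ^ (D * card W) \<le> z ^ ((\<Sum>w\<in>W. q w) + (\<Sum>j<i. ?N j))"
    using z by (intro power_increasing) auto
  then have "1 \<le> (1 / z) ^ (D * card W) * (z ^ (\<Sum>w\<in>W. q w) * (\<Prod>j<i. z ^ ?N j))"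
    using z by (simp add: power_one_over field_simps power_add power_sum)
  then have "ennreal 1 \<le> ennreal ((1 / z) ^ (D * card W) * z ^ (\<Sum>w\<in>W. q w)) * ennreal (\<Prod>j<i. z ^ ?N j)"
    using z by (subst ennreal_mult [symmetric]) (auto simp: prod_nonneg mult.assoc intro!: ennreal_leI)
  also have "ennreal (\<Prod>j<i. z ^ ?N j) = (\<Prod>j<i. ennreal (z ^ ?N j))"
    using z by (simp add: prod_ennreal)
  also have "\<dots> = (\<Prod>j<i. boost z ?e W (?t - arrival_time \<omega> j) (snd (snd (snd \<omega>) j)))"
    by (intro prod.cong) (auto simp: boost_def in_progress_def duration_def call_def selected_def)
  finally show ?thesis by simp
qed

text \<open>The initial calls enter through \<open>q\<close> outside the exceptional event \<open>G\<close>. After the burn-in time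
  \<open>q\<close> is \<open>0\<close> and \<open>G\<close> says that some initial call survives; for an initial distribution that is dominated
  by a stationary one, \<open>q\<close> is the initial load and \<open>G\<close> is empty.\<close>

lemma mean_lost_le:
  assumes R: "gdar_rule n d D R" and \<mu>: "set_pmf \<mu> \<subseteq> states n D" and z: "1 \<le> z" and t: "t1 \<le> t2"
    and G: "G \<in> sets (measure_pmf \<mu> \<Otimes>\<^sub>M residual_measure)"
    and surv: "\<And>x r s t e w. x \<in> states n D \<Longrightarrow> t1 \<le> t \<Longrightarrow> (x, r) \<notin> G \<Longrightarrow> surviving n (x, r, s) t e w \<le> q x e w"
    and Q: "\<And>e W. e \<in> edges n \<Longrightarrow> finite W \<Longrightarrow> card W \<le> d \<Longrightarrow> (\<integral>\<^sup>+x. ennreal (z ^ (\<Sum>w\<in>W. q x e w)) \<partial>measure_pmf \<mu>) \<le> Q"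
  shows "mean_lost n lam d D R \<mu> t1 t2 \<le> ennreal (rate * (t2 - t1)) *
    (emeasure (measure_pmf \<mu> \<Otimes>\<^sub>M residual_measure) G +
     Q * ennreal (exp (rate * kappa z)) * (\<integral>\<^sup>+c. ennreal ((1 / z) ^ (D * card (set (snd c)))) \<partial>call_pmf n d))"
proof -
  let ?C = "set_pmf (call_pmf n d)" and ?L = "ennreal (rate * (t2 - t1))"
  let ?M = "sample_measure n lam d \<mu>"
  define y where "y c = ennreal ((1 / z) ^ (D * card (set (snd c))))" for c :: "nat set \<times> nat list"
  define u where "u c x = ennreal (z ^ (\<Sum>w\<in>set (snd c). q x (fst c) w))" for c :: "nat set \<times> nat list" and x
  define \<Phi> where "\<Phi> c i s = indicator {t1..t2} (atime s i) *
    (\<Prod>j<i. boost z (fst c) (set (snd c)) (atime s i - atime s j) (snd (s j)))" for c i s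
  have [measurable]: "\<Phi> c i \<in> borel_measurable St" for c i
    unfolding \<Phi>_def [abs_def] by measurable
  define P :: "nat \<Rightarrow> sample \<Rightarrow> ennreal" where "P i \<omega> = indicator G (fst \<omega>, fst (snd \<omega>)) * indicator {t1..t2} (atime (snd (snd \<omega>)) i)" for i \<omega>
  \<comment> \<open>Losses are sorted by the type \<open>c\<close> of the call, consisting of its
    ends and its selected nodes: \<open>boost\<close> depends on both, and only for a fixed
    \<open>c\<close> is the product over earlier arrivals independent of the event that arrival
    \<open>i\<close> has type \<open>c\<close>.\<close>
  define V where "V c i \<omega> = y c * u c (fst \<omega>) * (\<Phi> c i (snd (snd \<omega>)) * indicator {c} (snd (snd (snd (snd (snd \<omega>) i)))))"
    for c i and \<omega> :: sample
  note [measurable] = G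
  have Pm [measurable]: "P i \<in> borel_measurable ?M" for i
    unfolding P_def [abs_def] sample_measure_eq by measurable
  have [measurable]: "(\<lambda>\<omega>. u c (fst \<omega>)) \<in> borel_measurable ?M" for c
    unfolding sample_measure_eq by (rule measurable_compose [OF measurable_fst]) simp
  have Im: "(\<lambda>s. \<Phi> c i s * indicator {c} (snd (snd (snd (s i))))) \<in> borel_measurable St" for c i
    by (intro borel_measurable_times_ennreal measurable_compose [OF measurable_stream_call, where g = "indicator {c}"]) measurable
  have um: "(\<lambda>z. y c * u c (fst z)) \<in> borel_measurable (measure_pmf \<mu> \<Otimes>\<^sub>M residual_measure)" for c
    by (rule measurable_compose [OF measurable_fst]) simp
  have Vm [measurable]: "V c i \<in> borel_measurable ?M" for c i
  proof -
    have st: "(\<lambda>\<omega>. snd (snd \<omega>)) \<in> ?M \<rightarrow>\<^sub>M St" unfolding sample_measure_eq by measurable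
    from measurable_compose [OF st Im]
    have [measurable]: "(\<lambda>\<omega>. \<Phi> c i (snd (snd \<omega>)) * indicator {c} (snd (snd (snd (snd (snd \<omega>) i))))) \<in> borel_measurable ?M" .
    show ?thesis unfolding V_def [abs_def] by measurable
  qed
  have "mean_lost n lam d D R \<mu> t1 t2 \<le> (\<integral>\<^sup>+\<omega>. (\<Sum>i. P i \<omega> + (\<Sum>c\<in>?C. V c i \<omega>)) \<partial>?M)"
    unfolding mean_lost_def
  \<comment> \<open>The comparison is pointwise almost everywhere, so measurability enters only
    through the majorant.\<close>
  proof (rule nn_integral_mono_AE)
    show "AE \<omega> in ?M. emeasure (count_space UNIV) (lost_calls n D R t1 t2 \<omega>) \<le> (\<Sum>i. P i \<omega> + (\<Sum>c\<in>?C. V c i \<omega>))"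
      using AE_regular [OF \<mu>] AE_call_pmf [of \<mu>]
    proof eventually_elim
      case (elim \<omega>)
      obtain x r s where \<omega>: "\<omega> = (x, r, s)" by (cases \<omega>)
      have "emeasure (count_space UNIV) (lost_calls n D R t1 t2 \<omega>) = (\<Sum>i. indicator (lost_calls n D R t1 t2 \<omega>) i)"
        by (simp add: nn_integral_count_space_nat flip: nn_integral_indicator)
      also have "\<dots> \<le> (\<Sum>i. P i \<omega> + (\<Sum>c\<in>?C. V c i \<omega>))"
      proof (rule suminf_le)
        fix i
        show "indicator (lost_calls n D R t1 t2 \<omega>) i \<le> P i \<omega> + (\<Sum>c\<in>?C. V c i \<omega>)"
        proof (cases "i \<in> lost_calls n D R t1 t2 \<omega>")
          case True
          then have lost: "route n D R \<omega> i = None" and ti: "t1 \<le> arrival_time \<omega> i" "arrival_time \<omega> i \<le> t2"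
            by (auto simp: lost_calls_def)
          show ?thesis
          proof (cases "(x, r) \<in> G")
            case True
            then have "P i \<omega> = 1" using ti by (simp add: P_def \<omega> arrival_time_eq)
            then show ?thesis by (simp add: indicator_def)
          next
            case False
            let ?c = "(call \<omega> i, selected \<omega> i)"
            have c: "?c \<in> ?C" using elim(2) by simp
            have sv: "surviving n \<omega> (arrival_time \<omega> i) (call \<omega> i) w \<le> q x (call \<omega> i) w" for w
              unfolding \<omega> using elim(1) False ti(1) by (intro surv) (auto simp: \<omega> regular_def initial_load_def)
            have "1 \<le> V ?c i \<omega>"
              using lost_call_markov [OF R elim(1) lost z sv] ti z
              by (simp add: V_def y_def u_def \<Phi>_def \<omega> arrival_time_eq call_def selected_def ennreal_mult mult_ac)
            also have "\<dots> \<le> (\<Sum>c\<in>?C. V c i \<omega>)"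
              by (rule member_le_sum [OF c]) (auto simp: finite_set_call_pmf)
            finally show ?thesis by (simp add: indicator_def add_increasing)
          qed
        qed simp
      qed auto
      finally show ?case .
    qed
  qed
  also have "\<dots> = (\<Sum>i. (\<integral>\<^sup>+\<omega>. P i \<omega> \<partial>?M) + (\<Sum>c\<in>?C. \<integral>\<^sup>+\<omega>. V c i \<omega> \<partial>?M))"
    by (simp add: nn_integral_suminf nn_integral_add nn_integral_sum)
  also have "\<dots> = (\<Sum>i. \<integral>\<^sup>+\<omega>. P i \<omega> \<partial>?M) + (\<Sum>c\<in>?C. \<Sum>i. \<integral>\<^sup>+\<omega>. V c i \<omega> \<partial>?M)"
    by (simp add: suminf_add [symmetric] suminf_sum)
  also have "(\<Sum>i. \<integral>\<^sup>+\<omega>. P i \<omega> \<partial>?M) = emeasure (measure_pmf \<mu> \<Otimes>\<^sub>M residual_measure) G * (\<Sum>i. \<integral>\<^sup>+s. indicator {t1..t2} (atime s i) \<partial>St)"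
    unfolding P_def by (subst nn_integral_sample_split) (simp_all add: ennreal_suminf_cmult)
  also have "\<dots> \<le> emeasure (measure_pmf \<mu> \<Otimes>\<^sub>M residual_measure) G * ?L"
    by (intro mult_left_mono arrivals_in_interval_le t) simp
  also have "(\<Sum>c\<in>?C. \<Sum>i. \<integral>\<^sup>+\<omega>. V c i \<omega> \<partial>?M) \<le>
     (\<Sum>c\<in>?C. ennreal (pmf (call_pmf n d) c) * y c * (Q * (?L * ennreal (exp (rate * kappa z)))))"
  proof (rule sum_mono)
    fix c assume c: "c \<in> ?C"
    then have e: "fst c \<in> edges n" "length (snd c) = d" using set_call_pmf by auto
    have W: "finite (set (snd c))" "card (set (snd c)) \<le> d" using e card_length [of "snd c"] by auto
    have V: "(\<integral>\<^sup>+\<omega>. V c i \<omega> \<partial>?M) = (y c * (\<integral>\<^sup>+x. u c x \<partial>measure_pmf \<mu>) * ennreal (pmf (call_pmf n d) c)) * (\<integral>\<^sup>+s. \<Phi> c i s \<partial>St)" for i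
    proof -
      have "(\<integral>\<^sup>+\<omega>. V c i \<omega> \<partial>?M) = (\<integral>\<^sup>+z. y c * u c (fst z) \<partial>(measure_pmf \<mu> \<Otimes>\<^sub>M residual_measure)) *
         (\<integral>\<^sup>+s. \<Phi> c i s * indicator {c} (snd (snd (snd (s i)))) \<partial>St)"
        unfolding V_def
        by (subst nn_integral_sample_split [OF um Im, symmetric]) simp
      also have "(\<integral>\<^sup>+z. y c * u c (fst z) \<partial>(measure_pmf \<mu> \<Otimes>\<^sub>M residual_measure)) = y c * (\<integral>\<^sup>+x. u c x \<partial>measure_pmf \<mu>)"
        by (subst nn_integral_initial) (simp add: nn_integral_cmult)
      also have "(\<integral>\<^sup>+s. \<Phi> c i s * indicator {c} (snd (snd (snd (s i)))) \<partial>St) = (\<integral>\<^sup>+s. \<Phi> c i s \<partial>St) * (\<integral>\<^sup>+c'. indicator {c} c' \<partial>call_pmf n d)"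
      proof (rule stream_call_independent)
        have at: "atime (s(i := (g, a))) j = atime (s(i := (g, a'))) j" for s :: "nat \<Rightarrow> arrival" and g a a' j
          unfolding atime_def by (intro sum.cong) auto
        show "\<Phi> c i (s(i := (g, x', y', c1))) = \<Phi> c i (s(i := (g, x', y', c2)))" for s g x' y' c1 c2
          unfolding \<Phi>_def at [of s g "(x', y', c1)" _ "(x', y', c2)"]
          by (intro arg_cong2 [where f = "(*)"] prod.cong) auto
      qed measurable
      finally show ?thesis by (simp add: emeasure_pmf_single mult_ac)
    qed
    have "(\<Sum>i. \<integral>\<^sup>+\<omega>. V c i \<omega> \<partial>?M) = (y c * (\<integral>\<^sup>+x. u c x \<partial>measure_pmf \<mu>) * ennreal (pmf (call_pmf n d) c)) * (\<Sum>i. \<integral>\<^sup>+s. \<Phi> c i s \<partial>St)"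
      unfolding V by (rule ennreal_suminf_cmult)
    also have "\<dots> \<le> (y c * (\<integral>\<^sup>+x. u c x \<partial>measure_pmf \<mu>) * ennreal (pmf (call_pmf n d) c)) * (?L * ennreal (exp (rate * kappa z)))"
      unfolding suminf_eq_SUP \<Phi>_def
      by (intro mult_left_mono SUP_least arrival_sum_boost_le [OF e(1) W z t]) simp
    also have "y c * (\<integral>\<^sup>+x. u c x \<partial>measure_pmf \<mu>) * ennreal (pmf (call_pmf n d) c) * (?L * ennreal (exp (rate * kappa z)))
       \<le> y c * Q * ennreal (pmf (call_pmf n d) c) * (?L * ennreal (exp (rate * kappa z)))"
      using Q [OF e(1) W] unfolding u_def by (intro mult_right_mono mult_left_mono) auto
    finally show "(\<Sum>i. \<integral>\<^sup>+\<omega>. V c i \<omega> \<partial>?M) \<le> ennreal (pmf (call_pmf n d) c) * y c * (Q * (?L * ennreal (exp (rate * kappa z))))"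
      by (simp add: mult_ac mult_left_mono)
  qed
  also have "(\<Sum>c\<in>?C. ennreal (pmf (call_pmf n d) c) * y c * (Q * (?L * ennreal (exp (rate * kappa z))))) =
     (\<integral>\<^sup>+c. y c \<partial>call_pmf n d) * (Q * (?L * ennreal (exp (rate * kappa z))))"
  proof -
    have "(\<integral>\<^sup>+c. y c \<partial>call_pmf n d) = (\<Sum>c\<in>?C. ennreal (pmf (call_pmf n d) c) * y c)"
      by (subst nn_integral_measure_pmf_finite [OF finite_set_call_pmf]) (simp_all add: mult.commute)
    then show ?thesis by (simp only: sum_distrib_right)
  qed
  finally show ?thesis
    by (simp add: y_def distrib_left mult_ac add_mono)
qed

end

section \<open>Finiteness of the state space, initial calls, and stationary loads\<close>

lemma states_le:
  assumes x: "x \<in> states n D"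
  shows "x e w \<le> D"
proof (cases "e \<in> edges n \<and> w \<in> nodes n - e")
  case True
  then obtain u where u: "u \<in> e" by (auto simp: edges_def card_2_iff)
  then have un: "u \<in> nodes n" "w \<noteq> u" using True by (auto simp: edges_def)
  have "x e w \<le> (\<Sum>e\<in>incident n u w. x e w)"
    using True u by (intro member_le_sum) (auto simp: incident_def)
  also have "\<dots> = link_load n x u w"
    using un by (simp add: link_load_eq)
  also have "\<dots> \<le> D"
    using x True un by (auto simp: states_def)
  finally show ?thesis .
next
  case False
  then have "x e w = 0" using x by (auto simp: states_def)
  then show ?thesis by simp
qed

lemma finite_states: "finite (states n D)"
proof -
  have "finite {f. \<forall>p. (p \<in> edges n \<times> nodes n \<longrightarrow> f p \<in> {..D}) \<and> (p \<notin> edges n \<times> nodes n \<longrightarrow> f p = 0)}" (is "finite ?F")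
    by (rule finite_set_of_finite_funs) auto
  moreover have "states n D \<subseteq> (\<lambda>f e w. f (e, w)) ` ?F"
  proof
    fix x assume x: "x \<in> states n D"
    then have "(\<lambda>(e, w). x e w) \<in> ?F"
      using states_le [OF x] by (auto simp: states_def)
    then show "x \<in> (\<lambda>f e w. f (e, w)) ` ?F"
      by (intro image_eqI [of _ _ "\<lambda>(e, w). x e w"]) auto
  qed
  ultimately show ?thesis by (rule finite_surj)
qed

text \<open>A call via \<open>w\<close> uses a link \<open>uw\<close>, so the calls via
  \<open>w\<close> number at most the total load of the fewer than \<open>n\<close> links of this
  form.\<close>

lemma sum_states_le:
  assumes x: "x \<in> states n D"
  shows "(\<Sum>w\<in>nodes n. \<Sum>e\<in>edges n. x e w) \<le> n ^ 2 * D"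
proof -
  have "(\<Sum>e\<in>edges n. x e w) \<le> n * D" if w: "w \<in> nodes n" for w
  proof -
    have "(\<Sum>e\<in>edges n. x e w) \<le> (\<Sum>e\<in>edges n. \<Sum>u\<in>nodes n - {w}. if e \<in> incident n u w then x e w else 0)"
    proof (rule sum_mono)
      fix e assume e: "e \<in> edges n"
      show "x e w \<le> (\<Sum>u\<in>nodes n - {w}. if e \<in> incident n u w then x e w else 0)"
      proof (cases "w \<in> e")
        case True
        then have "x e w = 0" using x by (auto simp: states_def)
        then show ?thesis by simp
      next
        case False
        obtain u where u: "u \<in> e" "u \<in> nodes n" using e by (auto simp: edges_def card_2_iff)
        then have "(if e \<in> incident n u w then x e w else 0) \<le> (\<Sum>u\<in>nodes n - {w}. if e \<in> incident n u w then x e w else 0)"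
          using False by (intro member_le_sum) auto
        then show ?thesis using u e False by (simp add: incident_def)
      qed
    qed
    also have "\<dots> = (\<Sum>u\<in>nodes n - {w}. \<Sum>e\<in>edges n. if e \<in> incident n u w then x e w else 0)"
      by (rule sum.swap)
    also have "\<dots> = (\<Sum>u\<in>nodes n - {w}. link_load n x u w)"
    proof (rule sum.cong)
      fix u assume "u \<in> nodes n - {w}"
      then show "(\<Sum>e\<in>edges n. if e \<in> incident n u w then x e w else 0) = link_load n x u w"
        by (subst link_load_eq, force, force, subst sum.inter_filter [symmetric])
          (auto simp: incident_def intro!: sum.cong)
    qed simp
    also have "\<dots> \<le> (\<Sum>u\<in>nodes n - {w}. D)"
      using x w by (intro sum_mono) (auto simp: states_def)
    also have "\<dots> \<le> n * D"
      using w by simp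
    finally show ?thesis .
  qed
  then have "(\<Sum>w\<in>nodes n. \<Sum>e\<in>edges n. x e w) \<le> (\<Sum>w\<in>nodes n. n * D)"
    by (rule sum_mono)
  then show ?thesis by (simp add: power2_eq_square)
qed

text \<open>No measurability of \<open>f\<close> is assumed, so that the lemma applies to the load process of an arbitrary
  rule.\<close>

lemma emeasure_distr_le:
  assumes "A \<in> sets N"
  shows "emeasure (distr M N f) A \<le> (if f -` A \<inter> space M \<in> sets M then emeasure M (f -` A \<inter> space M) else 0)"
proof -
  have "emeasure (distr M N f) A \<le> emeasure M (f -` A \<inter> space M)"
    using assms by (auto simp: distr_def emeasure_measure_of_conv)
  then show ?thesis
    by (cases "f -` A \<inter> space M \<in> sets M") (simp_all add: emeasure_notin_sets)
qed

lemma nn_integral_rel_pmf_mono: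
  assumes "rel_pmf (\<le>) p q" "\<And>x y. x \<le> y \<Longrightarrow> f x \<le> f y"
  shows "(\<integral>\<^sup>+x. f x \<partial>measure_pmf p) \<le> (\<integral>\<^sup>+x. f x \<partial>measure_pmf q)"
  using assms(1)
proof cases
  case (1 pq)
  have "(\<integral>\<^sup>+x. f x \<partial>measure_pmf p) = (\<integral>\<^sup>+z. f (fst z) \<partial>measure_pmf pq)"
    using 1 by (simp flip: nn_integral_map_pmf)
  also have "\<dots> \<le> (\<integral>\<^sup>+z. f (snd z) \<partial>measure_pmf pq)"
    using 1 assms(2) by (intro nn_integral_mono_AE) (auto simp: AE_measure_pmf_iff)
  also have "\<dots> = (\<integral>\<^sup>+x. f x \<partial>measure_pmf q)"
    using 1 by (simp flip: nn_integral_map_pmf)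
  finally show ?thesis .
qed

text \<open>An event of the initial part of the sample alone, and therefore independent of the
  arrivals.\<close>

definition survivors :: "nat \<Rightarrow> real \<Rightarrow> (load_vector \<times> (nat set \<times> nat \<times> nat \<Rightarrow> real)) set" where
  "survivors n t = {(x, r). \<exists>w\<in>nodes n. \<exists>e\<in>edges n. \<exists>k<x e w. t < r (e, w, k)}"

context network
begin

lemma survivors_sets [measurable]: "survivors n t \<in> sets (measure_pmf \<mu> \<Otimes>\<^sub>M residual_measure)"
proof -
  have "survivors n t = {z \<in> space (measure_pmf \<mu> \<Otimes>\<^sub>M residual_measure).
      \<exists>w\<in>nodes n. \<exists>e\<in>edges n. \<exists>k. k < fst z e w \<and> t < snd z (e, w, k)}"
    by (auto simp: survivors_def space_pair_measure space_PiM) blast+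
  also have "\<dots> \<in> sets (measure_pmf \<mu> \<Otimes>\<^sub>M residual_measure)"
  proof -
    have [measurable]: "Measurable.pred (measure_pmf \<mu> \<Otimes>\<^sub>M residual_measure) (\<lambda>z. k < fst z e w)" for e w k
      by (rule measurable_compose [OF measurable_fst, where g = "\<lambda>x. k < x e w"]) simp
    show ?thesis by measurable
  qed
  finally show ?thesis .
qed

text \<open>Union bound over at most \<open>n ^ 2 * D\<close> initial calls. At
  \<open>t = 5 ln n\<close> it is \<open>D / n ^ 3\<close>, which beats the \<open>n ^ 2\<close>
  arrivals per unit of time.\<close>

lemma emeasure_survivors_le:
  assumes \<mu>: "set_pmf \<mu> \<subseteq> states n D" and t: "0 \<le> t"
  shows "emeasure (measure_pmf \<mu> \<Otimes>\<^sub>M residual_measure) (survivors n t) \<le> ennreal (real (n ^ 2 * D) * exp (- t))"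
proof -
  have "emeasure (measure_pmf \<mu> \<Otimes>\<^sub>M residual_measure) (survivors n t) =
     (\<integral>\<^sup>+x. \<integral>\<^sup>+r. indicator (survivors n t) (x, r) \<partial>residual_measure \<partial>measure_pmf \<mu>)"
    by (subst res.nn_integral_fst) simp_all
  also have "\<dots> \<le> (\<integral>\<^sup>+x. ennreal (real (n ^ 2 * D) * exp (- t)) \<partial>measure_pmf \<mu>)"
  proof (rule nn_integral_mono_AE, rule AE_pmfI)
    fix x assume "x \<in> set_pmf \<mu>"
    then have x: "x \<in> states n D" using \<mu> by auto
    have "(\<integral>\<^sup>+r. indicator (survivors n t) (x, r) \<partial>residual_measure) \<le>
       (\<integral>\<^sup>+r. (\<Sum>w\<in>nodes n. \<Sum>e\<in>edges n. \<Sum>k<x e w. indicator {t<..} (r (e, w, k))) \<partial>residual_measure)"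
    proof (rule nn_integral_mono)
      fix r :: "nat set \<times> nat \<times> nat \<Rightarrow> real"
      show "indicator (survivors n t) (x, r) \<le> (\<Sum>w\<in>nodes n. \<Sum>e\<in>edges n. \<Sum>k<x e w. indicator {t<..} (r (e, w, k)) :: ennreal)"
      proof (cases "(x, r) \<in> survivors n t")
        case True
        then obtain w e k where wek: "w \<in> nodes n" "e \<in> edges n" "k < x e w" "t < r (e, w, k)"
          by (auto simp: survivors_def)
        have "(1 :: ennreal) = indicator {t<..} (r (e, w, k))" using wek by simp
        also have "\<dots> \<le> (\<Sum>k<x e w. indicator {t<..} (r (e, w, k)))"
          using wek by (intro member_le_sum) auto
        also have "\<dots> \<le> (\<Sum>e\<in>edges n. \<Sum>k<x e w. indicator {t<..} (r (e, w, k)))"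
          using wek by (intro member_le_sum [of e _ "\<lambda>e. \<Sum>k<x e w. indicator {t<..} (r (e, w, k))"]) auto
        also have "\<dots> \<le> (\<Sum>w\<in>nodes n. \<Sum>e\<in>edges n. \<Sum>k<x e w. indicator {t<..} (r (e, w, k)))"
          using wek by (intro member_le_sum [of w _ "\<lambda>w. \<Sum>e\<in>edges n. \<Sum>k<x e w. indicator {t<..} (r (e, w, k))"]) auto
        finally show ?thesis using True by simp
      qed simp
    qed
    also have "\<dots> = (\<Sum>w\<in>nodes n. \<Sum>e\<in>edges n. \<Sum>k<x e w. \<integral>\<^sup>+r. indicator {t<..} (r (e, w, k)) \<partial>residual_measure)"
      by (simp add: nn_integral_sum)
    also have "\<dots> \<le> (\<Sum>w\<in>nodes n. \<Sum>e\<in>edges n. \<Sum>k<x e w. ennreal (exp (- t)))"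
    proof (intro sum_mono)
      fix w e k
      have "(\<integral>\<^sup>+r. indicator {t<..} (r (e, w, k)) \<partial>residual_measure) =
         (\<integral>\<^sup>+v. indicator {t<..} v \<partial>distr residual_measure (exponential_measure 1) (\<lambda>r. r (e, w, k)))"
        by (subst nn_integral_distr) auto
      also have "\<dots> = emeasure (exponential_measure 1) {t<..}"
        by (subst res.PiM_component) auto
      also have "\<dots> \<le> ennreal (exp (- t))"
        by (rule emeasure_exponential_measure_greaterThan [OF t])
      finally show "(\<integral>\<^sup>+r. indicator {t<..} (r (e, w, k)) \<partial>residual_measure) \<le> ennreal (exp (- t))" .
    qed
    also have "\<dots> = ennreal (\<Sum>w\<in>nodes n. \<Sum>e\<in>edges n. \<Sum>k<x e w. exp (- t))"
      by (simp only: sum_ennreal sum_nonneg exp_ge_zero)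
    also have "\<dots> = ennreal (real (\<Sum>w\<in>nodes n. \<Sum>e\<in>edges n. x e w) * exp (- t))"
      by (simp add: sum_distrib_right)
    also have "\<dots> \<le> ennreal (real (n ^ 2 * D) * exp (- t))"
      using sum_states_le [OF x] by (intro ennreal_leI mult_right_mono) (simp_all only: of_nat_le_iff exp_ge_zero)
    finally show "(\<integral>\<^sup>+r. indicator (survivors n t) (x, r) \<partial>residual_measure) \<le> ennreal (real (n ^ 2 * D) * exp (- t))" .
  qed
  also have "\<dots> = ennreal (real (n ^ 2 * D) * exp (- t))"
    by (simp add: measure_pmf.emeasure_space_1)
  finally show ?thesis .
qed

lemma surviving_eq_0:
  assumes "x \<in> states n D" "t1 \<le> t" "(x, r) \<notin> survivors n t1"
  shows "surviving n (x, r, s) t e w = 0"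
proof -
  have "{k. k < x e' w \<and> t < r (e', w, k)} = {}" if e': "e' \<in> meets n e" for e'
  proof (cases "w \<in> nodes n")
    case True
    then show ?thesis using assms e' by (fastforce simp: survivors_def meets_def)
  next
    case False
    then have "x e' w = 0" using assms(1) by (auto simp: states_def)
    then show ?thesis by simp
  qed
  then show ?thesis
    by (simp add: surviving_def initial_load_def residual_def)
qed

lemma surviving_le: "surviving n (x, r, s) t e w \<le> (\<Sum>e'\<in>meets n e. x e' w)"
  unfolding surviving_def initial_load_def fst_conv
proof (rule sum_mono)
  fix e'
  have "card {k. k < x e' w \<and> t < residual (x, r, s) e' w k} \<le> card {..<x e' w}"
    by (intro card_mono) auto
  then show "card {k. k < x e' w \<and> t < residual (x, r, s) e' w k} \<le> x e' w" by simp
qed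

text \<open>If some initial call survives, the initial contribution is bounded by its largest
  conceivable value. The constant is huge, but it is multiplied by a probability that vanishes as
  \<open>t\<close> grows.\<close>

lemma load_process_total_le:
  assumes R: "gdar_rule n d D R" and reg: "regular n d D \<omega>" and z: "1 \<le> z" and W: "finite W"
    and \<omega>: "\<omega> = (x, r, s)"
  shows "ennreal (z ^ total_load n (load_process n D R t \<omega>) e W) \<le>
    (1 + ennreal (z ^ (card W * (card (meets n e) * D))) * indicator (survivors n t) (x, r)) *
      (SUP m. \<Prod>j<m. boost z e W (t - atime s j) (snd (s j)))"
proof -
  obtain m where m: "total_load n (load_process n D R t \<omega>) e W \<le> (\<Sum>w\<in>W. surviving n \<omega> t e w) +
    (\<Sum>j<m. if in_progress \<omega> t j then hits e W (call \<omega> j, selected \<omega> j) else 0)" (is "_ \<le> ?S + ?J")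
    using total_load_process_le [OF R reg W] by blast
  have x: "x \<in> states n D" using reg by (simp add: regular_def \<omega> initial_load_def)
  have "z ^ total_load n (load_process n D R t \<omega>) e W \<le> z ^ ?S * z ^ ?J"
    using power_increasing [OF m z] by (simp add: power_add)
  then have "ennreal (z ^ total_load n (load_process n D R t \<omega>) e W) \<le> ennreal (z ^ ?S) * ennreal (z ^ ?J)"
    using z by (subst ennreal_mult [symmetric]) (auto intro!: ennreal_leI)
  also have "ennreal (z ^ ?J) = (\<Prod>j<m. boost z e W (t - atime s j) (snd (s j)))"
  proof -
    have "ennreal (z ^ ?J) = (\<Prod>j<m. ennreal (z ^ (if in_progress \<omega> t j then hits e W (call \<omega> j, selected \<omega> j) else 0)))"
      using z by (simp add: power_sum prod_ennreal)
    also have "\<dots> = (\<Prod>j<m. boost z e W (t - atime s j) (snd (s j)))"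
      by (intro prod.cong) (auto simp: boost_def in_progress_def duration_def call_def selected_def \<omega> arrival_time_eq)
    finally show ?thesis .
  qed
  also have "ennreal (z ^ ?S) * (\<Prod>j<m. boost z e W (t - atime s j) (snd (s j))) \<le>
     (1 + ennreal (z ^ (card W * (card (meets n e) * D))) * indicator (survivors n t) (x, r)) *
      (SUP m. \<Prod>j<m. boost z e W (t - atime s j) (snd (s j)))"
  proof (rule mult_mono)
    show "ennreal (z ^ ?S) \<le> 1 + ennreal (z ^ (card W * (card (meets n e) * D))) * indicator (survivors n t) (x, r)"
    proof (cases "(x, r) \<in> survivors n t")
      case True
      have "?S \<le> (\<Sum>w\<in>W. card (meets n e) * D)"
      proof (rule sum_mono)
        fix w
        have "surviving n \<omega> t e w \<le> (\<Sum>e'\<in>meets n e. x e' w)"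
          unfolding \<omega> by (rule surviving_le)
        also have "\<dots> \<le> (\<Sum>e'\<in>meets n e. D)"
          by (intro sum_mono states_le [OF x])
        finally show "surviving n \<omega> t e w \<le> card (meets n e) * D" by simp
      qed
      then have "z ^ ?S \<le> z ^ (card W * (card (meets n e) * D))"
        using z by (intro power_increasing) auto
      then have "ennreal (z ^ ?S) \<le> ennreal (z ^ (card W * (card (meets n e) * D)))"
        by (rule ennreal_leI)
      then show ?thesis using True by (simp add: add_increasing)
    next
      case False
      then have "?S = 0" using surviving_eq_0 [OF x order.refl False] by (simp add: \<omega>)
      then show ?thesis using False by simp
    qed
  qed (auto intro: SUP_upper)
  finally show ?thesis .
qed

text \<open>The left side is independent of time, so the bound at time \<open>t\<close> may be taken
  to its limit, in which the initial calls no longer contribute.\<close>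

lemma stationary_total_load_le:
  assumes R: "gdar_rule n d D R" and st: "stationary n lam d D R p" and z: "1 \<le> z"
    and e: "e \<in> edges n" and W: "finite W" "card W \<le> d"
  shows "(\<integral>\<^sup>+x. ennreal (z ^ total_load n x e W) \<partial>measure_pmf p) \<le> ennreal (exp (rate * kappa z))"
proof -
  let ?M = "sample_measure n lam d p"
  let ?B = "\<lambda>t m s. \<Prod>j<m. boost z e W (t - atime s j) (snd (s j))"
  let ?E = "ennreal (exp (rate * kappa z))"
  define b where "b = z ^ (card W * (card (meets n e) * D))"
  have b: "0 \<le> b" using z by (simp add: b_def)
  have p: "set_pmf p \<subseteq> states n D" using st by (simp add: stationary_def)
  have bound: "(\<integral>\<^sup>+x. ennreal (z ^ total_load n x e W) \<partial>measure_pmf p) \<le> ennreal (1 + b * (real (n ^ 2 * D) * exp (- t))) * ?E"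
    if t: "0 \<le> t" for t
  proof -
    let ?X = "load_process n D R t"
    let ?V = "\<lambda>x. ?X -` {x} \<inter> space ?M"
    \<comment> \<open>The states whose preimage is measurable. By \<open>emeasure_distr_le\<close>
      the other states carry no mass of \<open>p\<close>.\<close>
    let ?T = "{x \<in> states n D. ?V x \<in> sets ?M}"
    have law: "distr ?M (count_space UNIV) ?X = measure_pmf p"
      using st t by (simp add: stationary_def)
    have finp: "finite (set_pmf p)" using p finite_states finite_subset by blast
    have "(\<integral>\<^sup>+x. ennreal (z ^ total_load n x e W) \<partial>measure_pmf p) =
       (\<Sum>x\<in>set_pmf p. ennreal (z ^ total_load n x e W) * emeasure (measure_pmf p) {x})"
      using finp z by (subst nn_integral_measure_pmf_finite) (simp_all add: emeasure_pmf_single)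
    also have "\<dots> \<le> (\<Sum>x\<in>states n D. ennreal (z ^ total_load n x e W) * emeasure (measure_pmf p) {x})"
      using p by (intro sum_mono2 finite_states) auto
    also have "\<dots> \<le> (\<Sum>x\<in>states n D. if ?V x \<in> sets ?M then ennreal (z ^ total_load n x e W) * emeasure ?M (?V x) else 0)"
    proof (rule sum_mono)
      fix x
      have "emeasure (measure_pmf p) {x} \<le> (if ?V x \<in> sets ?M then emeasure ?M (?V x) else 0)"
        unfolding law [symmetric] by (rule emeasure_distr_le) simp
      then show "ennreal (z ^ total_load n x e W) * emeasure (measure_pmf p) {x} \<le>
         (if ?V x \<in> sets ?M then ennreal (z ^ total_load n x e W) * emeasure ?M (?V x) else 0)"
        by (auto intro: mult_left_mono split: if_splits)
    qed
    also have "\<dots> = (\<Sum>x\<in>?T. ennreal (z ^ total_load n x e W) * emeasure ?M (?V x))"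
      by (simp add: sum.inter_filter finite_states)
    also have "\<dots> = (\<integral>\<^sup>+\<omega>. (\<Sum>x\<in>?T. ennreal (z ^ total_load n x e W) * indicator (?V x) \<omega>) \<partial>?M)"
      by (subst nn_integral_sum) (auto simp: nn_integral_cmult_indicator)
    also have "\<dots> \<le> (\<integral>\<^sup>+\<omega>. (1 + ennreal b * indicator (survivors n t) (fst \<omega>, fst (snd \<omega>))) * (SUP m. ?B t m (snd (snd \<omega>))) \<partial>?M)"
    proof (rule nn_integral_mono_AE)
      show "AE \<omega> in ?M. (\<Sum>x\<in>?T. ennreal (z ^ total_load n x e W) * indicator (?V x) \<omega>) \<le>
        (1 + ennreal b * indicator (survivors n t) (fst \<omega>, fst (snd \<omega>))) * (SUP m. ?B t m (snd (snd \<omega>)))"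
        using AE_regular [OF p]
      proof eventually_elim
        case (elim \<omega>)
        have "(\<Sum>x\<in>?T. ennreal (z ^ total_load n x e W) * indicator (?V x) \<omega>) \<le>
           (\<Sum>x\<in>?T. if x = ?X \<omega> then ennreal (z ^ total_load n (?X \<omega>) e W) else 0)"
          by (intro sum_mono) (auto simp: indicator_def)
        also have "\<dots> \<le> ennreal (z ^ total_load n (?X \<omega>) e W)"
          using finite_states [of n D] by (simp add: sum.delta)
        also have "\<dots> \<le> (1 + ennreal b * indicator (survivors n t) (fst \<omega>, fst (snd \<omega>))) * (SUP m. ?B t m (snd (snd \<omega>)))"
          unfolding b_def by (rule load_process_total_le [OF R elim z W(1)]) simp
        finally show ?case .
      qed
    qed
    also have "\<dots> = (\<integral>\<^sup>+v. 1 + ennreal b * indicator (survivors n t) v \<partial>(measure_pmf p \<Otimes>\<^sub>M residual_measure)) *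
        (\<integral>\<^sup>+s. (SUP m. ?B t m s) \<partial>St)"
      by (rule nn_integral_sample_split [where f = "\<lambda>v. 1 + ennreal b * indicator (survivors n t) v" and g = "\<lambda>s. SUP m. ?B t m s"]) measurable
    also have "\<dots> \<le> ennreal (1 + b * (real (n ^ 2 * D) * exp (- t))) * ?E"
    proof (rule mult_mono)
      have pp: "emeasure (measure_pmf p \<Otimes>\<^sub>M residual_measure) (space (measure_pmf p \<Otimes>\<^sub>M residual_measure)) = 1"
        by (intro prob_space.emeasure_space_1 prob_space_pair prob_space_measure_pmf res.P.prob_space_axioms)
      have "(\<integral>\<^sup>+v. 1 + ennreal b * indicator (survivors n t) v \<partial>(measure_pmf p \<Otimes>\<^sub>M residual_measure)) =
         1 + ennreal b * emeasure (measure_pmf p \<Otimes>\<^sub>M residual_measure) (survivors n t)"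
        by (subst nn_integral_add) (simp_all add: nn_integral_cmult_indicator pp)
      also have "\<dots> \<le> 1 + ennreal b * ennreal (real (n ^ 2 * D) * exp (- t))"
        by (intro add_left_mono mult_left_mono emeasure_survivors_le p t) simp
      also have "\<dots> = ennreal (1 + b * (real (n ^ 2 * D) * exp (- t)))"
        using b by (simp flip: ennreal_mult ennreal_1 ennreal_plus)
      finally show "(\<integral>\<^sup>+v. 1 + ennreal b * indicator (survivors n t) v \<partial>(measure_pmf p \<Otimes>\<^sub>M residual_measure)) \<le>
        ennreal (1 + b * (real (n ^ 2 * D) * exp (- t)))" .
      have "(\<integral>\<^sup>+s. (SUP m. ?B t m s) \<partial>St) = (SUP m. \<integral>\<^sup>+s. ?B t m s \<partial>St)"
      \<comment> \<open>Every factor is at least 1, so the products increase with \<open>m\<close>,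
        and the bound for fixed \<open>m\<close> passes to the supremum.\<close>
      proof (rule nn_integral_monotone_convergence_SUP)
        have "1 \<le> boost z e W a m" for a m
          using z by (auto simp: boost_def intro!: one_le_power simp flip: ennreal_1)
        then have "?B t m s * 1 \<le> ?B t m s * boost z e W (t - atime s m) (snd (s m))" for m s
          by (intro mult_left_mono) auto
        then show "incseq (\<lambda>m s. ?B t m s)"
          by (intro incseq_SucI le_funI) simp
      qed measurable
      also have "\<dots> \<le> ?E"
      proof (rule SUP_least)
        fix m
        have "(\<integral>\<^sup>+s. ?B t m s \<partial>St) \<le> (if t < 0 then 1 else ennreal (exp (rate * kappa z * (1 - exp (- t)))))"
          by (rule fixed_time_product_le [OF measurable_boost _ kappa_nonneg [OF z] nn_integral_boost [OF e W z]])
            (auto simp: boost_def)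
        also have "\<dots> \<le> ?E"
        proof -
          have "rate * kappa z * (1 - exp (- t)) \<le> rate * kappa z * 1"
            using kappa_nonneg [OF z] rate_pos by (intro mult_left_mono) auto
          then show ?thesis using t by (simp add: ennreal_leI)
        qed
        finally show "(\<integral>\<^sup>+s. ?B t m s \<partial>St) \<le> ?E" .
      qed
      finally show "(\<integral>\<^sup>+s. (SUP m. ?B t m s) \<partial>St) \<le> ?E" .
    qed simp_all
    finally show ?thesis .
  qed
  \<comment> \<open>\<open>n\<close>, \<open>D\<close>, \<open>z\<close> and \<open>b\<close> are
    fixed here; only \<open>t\<close> tends to infinity.\<close>
  have "((\<lambda>t. 1 + b * (real (n ^ 2 * D) * exp (- t))) \<longlongrightarrow> 1) at_top"
    by real_asymp
  then have "((\<lambda>t. ennreal ((1 + b * (real (n ^ 2 * D) * exp (- t))) * exp (rate * kappa z))) \<longlongrightarrow> ennreal (1 * exp (rate * kappa z))) at_top"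
    by (intro tendsto_ennrealI tendsto_mult tendsto_const)
  moreover have "eventually (\<lambda>t. (\<integral>\<^sup>+x. ennreal (z ^ total_load n x e W) \<partial>measure_pmf p) \<le>
     ennreal ((1 + b * (real (n ^ 2 * D) * exp (- t))) * exp (rate * kappa z))) at_top"
    using eventually_ge_at_top [of 0]
  proof eventually_elim
    case (elim t)
    then show ?case using bound [of t] b by (simp add: ennreal_mult del: ennreal_plus)
  qed
  ultimately have "(\<integral>\<^sup>+x. ennreal (z ^ total_load n x e W) \<partial>measure_pmf p) \<le> ennreal (1 * exp (rate * kappa z))"
    by (rule tendsto_lowerbound) simp
  then show ?thesis by simp
qed

text \<open>One bound for both cases of the burn-in time. Under domination the initial load and the
  later arrivals contribute the same exponential moment, hence the 2 in the exponent; otherwise the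
  initial calls contribute the additive term.\<close>

lemma mean_lost_upper_bound:
  assumes R: "gdar_rule n d D R" and \<mu>: "set_pmf \<mu> \<subseteq> states n D" and z: "1 \<le> z" and t: "t1 \<le> t2"
    and burn: "burn_in n lam d D R \<mu> \<le> t1"
  shows "mean_lost n lam d D R \<mu> t1 t2 \<le> ennreal (rate * (t2 - t1)) *
    (ennreal (real (n ^ 2 * D) * exp (- (5 * ln (real n)))) +
     ennreal (exp (2 * (rate * kappa z))) * (\<integral>\<^sup>+c. ennreal ((1 / z) ^ (D * card (set (snd c)))) \<partial>call_pmf n d))"
    (is "_ \<le> ?L * (?S + ?E2 * ?Y)")
proof -
  let ?E = "ennreal (exp (rate * kappa z))"
  have k: "0 \<le> rate * kappa z" using kappa_nonneg [OF z] rate_pos by simp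
  have E2: "?E2 = ?E * ?E" by (simp add: exp_double power2_eq_square ennreal_mult)
  have E: "1 \<le> ?E" using k by simp
  show ?thesis
  proof (cases "\<exists>p. stationary n lam d D R p \<and> rel_pmf (\<le>) \<mu> p")
    case True
    then obtain p where p: "stationary n lam d D R p" "rel_pmf (\<le>) \<mu> p" by blast
    have "mean_lost n lam d D R \<mu> t1 t2 \<le> ?L * (emeasure (measure_pmf \<mu> \<Otimes>\<^sub>M residual_measure) {} + ?E * ?E * ?Y)"
    proof (rule mean_lost_le [OF R \<mu> z t, where q = "\<lambda>x e w. \<Sum>e'\<in>meets n e. x e' w"])
      fix e W :: "nat set" assume e: "e \<in> edges n" and W: "finite W" "card W \<le> d"
      have "(\<integral>\<^sup>+x. ennreal (z ^ total_load n x e W) \<partial>measure_pmf \<mu>) \<le> (\<integral>\<^sup>+x. ennreal (z ^ total_load n x e W) \<partial>measure_pmf p)"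
      proof (rule nn_integral_rel_pmf_mono [OF p(2)])
        fix x y :: load_vector assume "x \<le> y"
        then have "total_load n x e W \<le> total_load n y e W"
          unfolding total_load_def by (intro sum_mono) (simp add: le_fun_def)
        then show "ennreal (z ^ total_load n x e W) \<le> ennreal (z ^ total_load n y e W)"
          using z by (intro ennreal_leI power_increasing) auto
      qed
      also have "\<dots> \<le> ?E"
        by (rule stationary_total_load_le [OF R p(1) z e W])
      finally show "(\<integral>\<^sup>+x. ennreal (z ^ (\<Sum>w\<in>W. \<Sum>e'\<in>meets n e. x e' w)) \<partial>measure_pmf \<mu>) \<le> ?E"
        by (simp add: total_load_def)
    qed (auto intro: surviving_le)
    also have "\<dots> \<le> ?L * (?S + ?E2 * ?Y)"
      unfolding E2 by (intro mult_left_mono add_mono) auto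
    finally show ?thesis .
  next
    case False
    then have t1: "5 * ln (real n) \<le> t1" using burn unfolding burn_in_def by (simp only: if_False)
    have n1: "0 \<le> 5 * ln (real n)" using n by simp
    have "mean_lost n lam d D R \<mu> t1 t2 \<le> ?L * (emeasure (measure_pmf \<mu> \<Otimes>\<^sub>M residual_measure) (survivors n t1) + 1 * ?E * ?Y)"
    proof (rule mean_lost_le [OF R \<mu> z t, where q = "\<lambda>x e w. 0"])
      show "surviving n (x, r, s) t e w \<le> 0" if "x \<in> states n D" "t1 \<le> t" "(x, r) \<notin> survivors n t1" for x r s t e w
        using surviving_eq_0 [OF that] by simp
    qed (auto simp: measure_pmf.emeasure_space_1)
    also have "\<dots> \<le> ?L * (?S + ?E2 * ?Y)"
    proof (intro mult_left_mono add_mono mult_right_mono)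
      have "emeasure (measure_pmf \<mu> \<Otimes>\<^sub>M residual_measure) (survivors n t1) \<le> ennreal (real (n ^ 2 * D) * exp (- t1))"
        by (rule emeasure_survivors_le [OF \<mu>]) (use t1 n1 in auto)
      also have "\<dots> \<le> ?S"
        using t1 by (intro ennreal_leI mult_left_mono) auto
      finally show "emeasure (measure_pmf \<mu> \<Otimes>\<^sub>M residual_measure) (survivors n t1) \<le> ?S" .
      show "1 * ?E \<le> ?E2" unfolding E2 by (intro mult_right_mono E) simp
    qed simp_all
    finally show ?thesis .
  qed
qed

end


section \<open>Capacities above the threshold\<close>

text \<open>All that is used of the growth of \<open>D\<close>: by the first limit factors
  exponential in \<open>D\<close> are \<open>n\<close> to the power \<open>o(1)\<close>, by the
  second \<open>D\<close> to the power \<open>D\<close> is \<open>n\<close> to the power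
  \<open>\<alpha> + o(1)\<close>.\<close>

lemma capacity_asymptotics:
  fixes D :: "nat \<Rightarrow> nat" and \<alpha> :: real
  assumes \<alpha>: "0 < \<alpha>" and D: "(\<lambda>n. real (D n)) \<sim>[at_top] (\<lambda>n. \<alpha> * (ln (real n) / ln (ln (real n))))"
  shows "(\<lambda>n. real (D n) / ln (real n)) \<longlonglongrightarrow> 0"
    and "(\<lambda>n. real (D n) * ln (real (D n)) / ln (real n)) \<longlonglongrightarrow> \<alpha>"
    and "filterlim (\<lambda>n. real (D n)) at_top sequentially"
proof -
  let ?g = "\<lambda>n::nat. \<alpha> * (ln (real n) / ln (ln (real n)))"
  \<comment> \<open>The ratio tends to 1, so each limit splits into a limit of \<open>q\<close> and
    an elementary one.\<close>
  define q where "q n = real (D n) / ?g n" for n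
  have gpos: "eventually (\<lambda>n. 0 < ?g n) sequentially"
    using \<alpha> by real_asymp
  then have "eventually (\<lambda>n. real (D n) \<noteq> 0 \<or> ?g n \<noteq> 0) sequentially"
    by (rule eventually_mono) (metis less_irrefl)
  then have q: "q \<longlonglongrightarrow> 1"
    unfolding q_def by (rule asymp_equivD_strong [OF D])
  have Dq: "eventually (\<lambda>n. real (D n) = q n * ?g n) sequentially"
    using gpos by (rule eventually_mono) (metis q_def less_irrefl nonzero_eq_divide_eq)
  have "(\<lambda>n. q n * (?g n / ln (real n))) \<longlonglongrightarrow> 1 * 0"
    by (intro tendsto_mult q) real_asymp
  moreover have "eventually (\<lambda>n. q n * (?g n / ln (real n)) = real (D n) / ln (real n)) sequentially"
    using Dq by eventually_elim (simp only: times_divide_eq_right)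
  ultimately have "(\<lambda>n. real (D n) / ln (real n)) \<longlonglongrightarrow> 1 * 0"
    by (rule Lim_transform_eventually)
  then show "(\<lambda>n. real (D n) / ln (real n)) \<longlonglongrightarrow> 0" by simp
  have "filterlim (\<lambda>n. q n * ?g n) at_top sequentially"
    by (rule filterlim_tendsto_pos_mult_at_top [OF q]) (use \<alpha> in \<open>simp, real_asymp\<close>)
  then show Dinf: "filterlim (\<lambda>n. real (D n)) at_top sequentially"
    by (rule filterlim_mono_eventually [OF _ order.refl order.refl]) (use Dq in \<open>auto elim: eventually_mono\<close>)
  have qpos: "eventually (\<lambda>n. 0 < q n) sequentially"
    using order_tendstoD(1) [OF q, of 0] by simp
  \<comment> \<open>The numerator is the logarithm of \<open>D\<close>, which is thus asymptotic to
    \<open>ln (ln n)\<close>; multiplied by \<open>D\<close> it cancels the denominator of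
    \<open>?g\<close>.\<close>
  have "(\<lambda>n. (ln (q n) + ln (?g n)) / ln (ln (real n))) \<longlonglongrightarrow> 1"
  proof -
    have "(\<lambda>n. ln (q n)) \<longlonglongrightarrow> ln 1" by (intro tendsto_ln q) simp
    then have "(\<lambda>n. ln (q n) * (1 / ln (ln (real n))) + ln (?g n) / ln (ln (real n))) \<longlonglongrightarrow> ln 1 * 0 + 1"
    proof (intro tendsto_add tendsto_mult)
      show "(\<lambda>n. 1 / ln (ln (real n))) \<longlonglongrightarrow> 0" by real_asymp
      show "(\<lambda>n. ln (?g n) / ln (ln (real n))) \<longlonglongrightarrow> 1" using \<alpha> by real_asymp
    qed
    then show ?thesis by (simp add: add_divide_distrib)
  qed
  moreover have "(\<lambda>n. q n * (?g n * (ln (ln (real n)) / ln (real n)))) \<longlonglongrightarrow> 1 * \<alpha>"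
    by (intro tendsto_mult q) (use \<alpha> in real_asymp)
  ultimately have lim: "(\<lambda>n. (q n * (?g n * (ln (ln (real n)) / ln (real n)))) *
     ((ln (q n) + ln (?g n)) / ln (ln (real n)))) \<longlonglongrightarrow> (1 * \<alpha>) * 1"
    by (rule tendsto_mult [rotated])
  have "eventually (\<lambda>n. (q n * (?g n * (ln (ln (real n)) / ln (real n)))) *
     ((ln (q n) + ln (?g n)) / ln (ln (real n))) = real (D n) * ln (real (D n)) / ln (real n)) sequentially"
  proof -
    have "eventually (\<lambda>n::nat. 0 < ln (ln (real n))) sequentially" by real_asymp
    then show ?thesis
      using Dq qpos gpos
    proof eventually_elim
      case (elim n)
      have ln: "ln (real (D n)) = ln (q n) + ln (?g n)"
        by (subst elim(2)) (rule ln_mult_pos [OF elim(3,4)])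
      have "x * (y * (b / a)) * (s / b) = x * y * s / a" if "0 < b" for x y a b s :: real
        using that by simp
      from this [OF elim(1), of "q n" "?g n" "ln (real n)" "ln (q n) + ln (?g n)"]
      show ?case unfolding ln by (subst elim(2))
    qed
  qed
  from Lim_transform_eventually [OF lim this]
  show "(\<lambda>n. real (D n) * ln (real (D n)) / ln (real n)) \<longlonglongrightarrow> \<alpha>" by simp
qed

context network
begin

lemma nn_integral_card_selected:
  fixes z :: real
  assumes "1 \<le> z"
  shows "(\<integral>\<^sup>+c. ennreal ((1 / z) ^ (D * card (set (snd c)))) \<partial>call_pmf n d) \<le>
    ennreal (\<Prod>j<d. (1 / z) ^ D + real j / real (n - 2))"
proof -
  have y: "0 \<le> (1 / z) ^ D" "(1 / z) ^ D \<le> 1"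
    using assms by (auto intro!: power_le_one)
  have "(\<integral>\<^sup>+c. ennreal ((1 / z) ^ (D * card (set (snd c)))) \<partial>call_pmf n d) =
     (\<integral>\<^sup>+e. \<integral>\<^sup>+ws. ennreal (((1 / z) ^ D) ^ card (set ws)) \<partial>replicate_pmf d (pmf_of_set (nodes n - e)) \<partial>pmf_of_set (edges n))"
    by (simp add: call_pmf_def power_mult)
  also have "\<dots> \<le> (\<integral>\<^sup>+e. ennreal (\<Prod>j<d. (1 / z) ^ D + real j / real (n - 2)) \<partial>pmf_of_set (edges n))"
  proof (rule nn_integral_mono_AE, rule AE_pmfI)
    fix e assume "e \<in> set_pmf (pmf_of_set (edges n))"
    then have e: "e \<in> edges n" using edges_ne by simp
    show "(\<integral>\<^sup>+ws. ennreal (((1 / z) ^ D) ^ card (set ws)) \<partial>replicate_pmf d (pmf_of_set (nodes n - e))) \<le>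
      ennreal (\<Prod>j<d. (1 / z) ^ D + real j / real (n - 2))"
      using nn_integral_replicate_card_set [OF _ nodes_minus_ne [OF e] y] card_nodes_minus [OF e] by simp
  qed
  also have "\<dots> = ennreal (\<Prod>j<d. (1 / z) ^ D + real j / real (n - 2))"
    by (simp add: measure_pmf.emeasure_space_1)
  finally show ?thesis .
qed

text \<open>The chord bound makes the second factor of \<open>kappa\<close> linear in
  \<open>(z - 1) / (n - 2)\<close>, and the powers of \<open>n\<close> cancel against
  \<open>rate\<close>.\<close>

lemma rate_kappa_le:
  fixes z :: real
  assumes z: "1 \<le> z" and small: "(z - 1) * d \<le> real (n - 2)"
  shows "rate * kappa z \<le> 4 * lam * 2 ^ d * d * z"
proof -
  let ?x = "(z - 1) * d / real (n - 2)"
  \<comment> \<open>\<open>n - 1 \<le> 2 * (n - 2)\<close> holds from \<open>n = 3\<close>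
    on.\<close>
  have n2: "0 < real (n - 2)" "real (n - 1) \<le> 2 * real (n - 2)" using n by auto
  have x: "0 \<le> ?x" "?x \<le> 1" using z small n2 by auto
  have "rate * kappa z = lam * (2 * real (n - 1)) * ((1 + ?x) ^ d - 1)"
    using choose_pos by (simp add: rate_def kappa_def)
  also have "\<dots> \<le> lam * (2 * real (n - 1)) * ((2 ^ d - 1) * ?x)"
    using lam by (intro mult_left_mono power_Suc_minus_one_le x) auto
  also have "\<dots> \<le> lam * (2 * (2 * real (n - 2))) * (2 ^ d * ?x)"
    using lam n2(2) x(1) by (intro mult_mono mult_right_mono mult_nonneg_nonneg) auto
  also have "\<dots> = 4 * lam * 2 ^ d * d * (z - 1)"
  proof -
    have "lam * (2 * (2 * m)) * (2 ^ d * ((z - 1) * d / m)) = 4 * lam * 2 ^ d * d * (z - 1)" if "0 < m" for m :: real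
      using that by (simp add: field_simps)
    then show ?thesis using n2(1) by blast
  qed
  also have "\<dots> \<le> 4 * lam * 2 ^ d * d * z"
    using lam by (intro mult_left_mono) auto
  finally show ?thesis .
qed

lemma rate_le: "rate \<le> lam * real n ^ 2"
proof -
  have "n choose 2 \<le> n ^ 2" by (rule binomial_le_pow) (use n in simp)
  then show ?thesis using lam unfolding rate_def by (simp flip: of_nat_power)
qed

text \<open>The choice \<open>z = D\<close> has the order of the minimiser of
  \<open>exp (C * z) / z ^ D\<close>.\<close>

lemma mean_lost_explicit_bound:
  assumes R: "gdar_rule n d D R" and \<mu>: "set_pmf \<mu> \<subseteq> states n D" and D: "1 \<le> D" and l: "0 \<le> l"
    and burn: "burn_in n lam d D R \<mu> \<le> t1" and small: "real D * d \<le> real (n - 2)"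
  shows "mean_lost n lam d D R \<mu> t1 (t1 + l) \<le> ennreal (lam * real n ^ 2 * l *
    (real n ^ 2 * D * exp (- (5 * ln (real n))) +
     exp (8 * lam * 2 ^ d * d * D) * (\<Prod>j<d. exp (- (D * ln D)) + real j / real (n - 2))))"
proof -
  have z: "1 \<le> real D" using D by simp
  let ?P = "\<Prod>j<d. exp (- (D * ln D)) + real j / real (n - 2)"
  have y: "(1 / real D) ^ D = exp (- (D * ln D))"
    using D by (simp add: exp_minus exp_of_nat_mult power_one_over inverse_eq_divide)
  have P: "0 \<le> ?P" by (intro prod_nonneg) auto
  have "(real D - 1) * d \<le> real (n - 2)"
    using small by (simp add: algebra_simps)
  from rate_kappa_le [OF z this]
  have k: "2 * (rate * kappa D) \<le> 8 * lam * 2 ^ d * d * D" by linarith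
  have "mean_lost n lam d D R \<mu> t1 (t1 + l) \<le> ennreal (rate * (t1 + l - t1)) *
    (ennreal (real (n ^ 2 * D) * exp (- (5 * ln (real n)))) +
     ennreal (exp (2 * (rate * kappa D))) * (\<integral>\<^sup>+c. ennreal ((1 / real D) ^ (D * card (set (snd c)))) \<partial>call_pmf n d))"
    by (rule mean_lost_upper_bound [OF R \<mu> z _ burn]) (use l in simp)
  also have "\<dots> \<le> ennreal (lam * real n ^ 2 * l) *
    (ennreal (real (n ^ 2 * D) * exp (- (5 * ln (real n)))) + ennreal (exp (8 * lam * 2 ^ d * d * D)) * ennreal ?P)"
    using nn_integral_card_selected [OF z, of D] k rate_le l lam unfolding y
    by (intro mult_mono add_mono order.refl ennreal_leI) (auto intro: mult_right_mono)
  also have "\<dots> = ennreal (lam * real n ^ 2 * l *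
    (real n ^ 2 * D * exp (- (5 * ln (real n))) + exp (8 * lam * 2 ^ d * d * D) * ?P))"
    using P lam l by (simp flip: ennreal_mult ennreal_plus)
  finally show ?thesis .
qed

end

text \<open>The first candidate is blocked at cost \<beta>. A further candidate costs \<beta> if it
  is blocked separately and 1 if it repeats an earlier one. For \<beta> at most 1 the total is
  \<open>\<beta> * d\<close>; for \<beta> above 1 and \<open>d\<close> at least 2 it exceeds
  \<open>1 + (d - 1)\<close>. So exponents above 2 suffice even with repetitions.\<close>

lemma lost_rate_exponent:
  fixes \<beta> :: real
  assumes "1 \<le> d" "2 / real d < \<beta>"
  shows "2 < \<beta> + min \<beta> 1 * (real d - 1)"
proof (cases "\<beta> \<le> 1")
  case True
  then show ?thesis using assms by (simp add: field_simps)
next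
  case False
  show ?thesis
  proof (cases "d = 1")
    case True
    then show ?thesis using assms by simp
  next
    case d: False
    then have "2 \<le> real d" using assms by simp
    then show ?thesis using False by simp
  qed
qed

text \<open>The factor for \<open>j = 0\<close> has no repetition term and keeps the full exponent
  \<beta>; each of the others is at most a constant times \<open>n\<close> to the power
  \<open>- min \<beta> 1\<close>.\<close>

lemma prod_selection_bound:
  fixes y \<beta> :: real
  assumes d: "1 \<le> d" and n: "3 \<le> n" and y: "0 \<le> y" "y \<le> real n powr - \<beta>"
  shows "(\<Prod>j<d. y + real j / real (n - 2)) \<le>
    (1 + 3 * real d) ^ (d - 1) * real n powr (- (\<beta> + min \<beta> 1 * (real d - 1)))"
proof -
  let ?g = "min \<beta> 1"
  obtain d' where d': "d = Suc d'" using d by (cases d) auto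
  have "y + real (Suc j) / real (n - 2) \<le> (1 + 3 * real d) * real n powr - ?g" if j: "j < d'" for j
  proof -
    \<comment> \<open>\<open>n - 2 \<ge> n / 3\<close> holds from \<open>n = 3\<close> on.\<close>
    have "real (Suc j) / real (n - 2) \<le> real d / (real n / 3)"
      using j n d' by (intro frac_le) auto
    also have "\<dots> = 3 * real d * real n powr - 1"
      using n by (simp add: powr_minus_divide)
    also have "\<dots> \<le> 3 * real d * real n powr - ?g"
      using n by (intro mult_left_mono powr_mono) auto
    finally have "real (Suc j) / real (n - 2) \<le> 3 * real d * real n powr - ?g" .
    moreover have "y \<le> real n powr - ?g"
      using y(2) n by (rule_tac order.trans) (auto intro: powr_mono)
    ultimately show ?thesis by (simp add: distrib_right)
  qed
  then have "(\<Prod>j<d'. y + real (Suc j) / real (n - 2)) \<le> (\<Prod>j<d'. (1 + 3 * real d) * real n powr - ?g)"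
    using y(1) by (intro prod_mono) auto
  then have "(\<Prod>j<d. y + real j / real (n - 2)) \<le> real n powr - \<beta> * ((1 + 3 * real d) * real n powr - ?g) ^ d'"
    unfolding d' prod.lessThan_Suc_shift using y by (intro mult_mono) (auto intro: prod_nonneg)
  also have "(real n powr - ?g) ^ d' = real n powr (- (?g * real d'))"
    using n by (simp add: powr_powr flip: powr_realpow)
  then have "real n powr - \<beta> * ((1 + 3 * real d) * real n powr - ?g) ^ d' =
     (1 + 3 * real d) ^ d' * (real n powr - \<beta> * real n powr (- (?g * real d')))"
    by (simp add: power_mult_distrib)
  also have "real n powr - \<beta> * real n powr (- (?g * real d')) = real n powr (- (\<beta> + ?g * (real d - 1)))"
    by (simp add: d' flip: powr_add)
  finally show ?thesis by (simp add: d')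
qed

theorem K_good_above_threshold:
  fixes lam \<alpha> :: real and d :: nat and D :: "nat \<Rightarrow> nat"
  assumes lam: "lam > 0" and d: "d \<ge> 1" and \<alpha>: "\<alpha> > 2 / real d"
    and D: "(\<lambda>n. real (D n)) \<sim>[at_top] (\<lambda>n. \<alpha> * (ln (real n) / ln (ln (real n))))"
  shows "\<exists>K>0. K_good lam d D K"
proof -
  have "0 < 2 / real d" using d by simp
  then have \<alpha>0: "0 < \<alpha>" using \<alpha> by linarith
  \<comment> \<open>Below \<alpha>, to absorb the \<open>o(1)\<close> in the exponent of
    \<open>D\<close> to the power \<open>- D\<close>; above \<open>2 / d\<close>, to keep the total
    exponent above 2.\<close>
  define \<beta> where "\<beta> = (\<alpha> + 2 / real d) / 2"
  have \<beta>: "2 / real d < \<beta>" "\<beta> < \<alpha>" using \<alpha> by (auto simp: \<beta>_def)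
  define \<eta> where "\<eta> = \<beta> + min \<beta> 1 * (real d - 1) - 2"
  have \<eta>: "0 < \<eta>" using lost_rate_exponent [OF d \<beta>(1)] by (simp add: \<eta>_def)
  \<comment> \<open>The losses have the exponent \<open>2 + K + \<eta> / 4 - (\<eta> + 2)\<close>,
    where \<open>\<eta> / 4\<close> pays for the factor exponential in \<open>D\<close>; this is at
    most \<open>- \<eta> / 2\<close>. The surviving initial calls give \<open>2 + K - 3\<close>,
    which is at most \<open>- 1 / 2\<close>.\<close>
  define K where "K = min (\<eta> / 4) (1 / 2)"
  have K: "0 < K" "K \<le> \<eta> / 4" "K \<le> 1 / 2" using \<eta> by (auto simp: K_def)
  define C where "C = 8 * lam * 2 ^ d * d"
  note cap = capacity_asymptotics [OF \<alpha>0 D]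
  define f where "f n = lam * (real n powr (- 1/2) * ln (real n) + (1 + 3 * real d) ^ (d - 1) * real n powr (- (\<eta> / 2)))" for n :: nat
  have f: "f \<longlonglongrightarrow> 0"
  proof -
    have "(\<lambda>n. real n powr (- (\<eta> / 2))) \<longlonglongrightarrow> 0"
      by (rule tendsto_neg_powr [OF _ filterlim_real_sequentially]) (use \<eta> in simp)
    moreover have "(\<lambda>n. real n powr (- 1/2) * ln (real n)) \<longlonglongrightarrow> 0"
      by real_asymp
    ultimately have "f \<longlonglongrightarrow> lam * (0 + (1 + 3 * real d) ^ (d - 1) * 0)"
      unfolding f_def by (intro tendsto_intros)
    then show ?thesis by simp
  qed
  have Csmall: "eventually (\<lambda>n. C * (D n / ln (real n)) < \<eta> / 4) sequentially"
    using order_tendstoD(2) [OF tendsto_mult_left [OF cap(1), of C], of "\<eta> / 4"] \<eta> by simp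
  have Dln: "eventually (\<lambda>n. D n / ln (real n) < 1) sequentially"
    using order_tendstoD(2) [OF cap(1), of 1] by simp
  have DlnD: "eventually (\<lambda>n. \<beta> < real (D n) * ln (real (D n)) / ln (real n)) sequentially"
    using order_tendstoD(1) [OF cap(2) \<beta>(2)] .
  have D1: "eventually (\<lambda>n. 1 \<le> real (D n)) sequentially"
    using cap(3) unfolding filterlim_at_top by blast
  have lnd: "eventually (\<lambda>n. ln (real n) * real d \<le> real n - 2) sequentially"
    by real_asymp
  have "K_good lam d D K"
    unfolding K_good_def
  proof (intro allI impI)
    fix R :: "nat \<Rightarrow> rule" and \<mu> :: "nat \<Rightarrow> load_vector pmf" and t1 :: "nat \<Rightarrow> real"
    assume H: "\<forall>n\<ge>3. gdar_rule n d (D n) (R n) \<and> set_pmf (\<mu> n) \<subseteq> states n (D n) \<and>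
                burn_in n lam d (D n) (R n) (\<mu> n) \<le> t1 n"
    let ?m = "\<lambda>n. mean_lost n lam d (D n) (R n) (\<mu> n) (t1 n) (t1 n + real n powr K)"
    have "eventually (\<lambda>n. ?m n \<le> ennreal (f n)) sequentially"
      using Csmall Dln DlnD D1 lnd eventually_ge_at_top [of "3::nat"]
    proof eventually_elim
      case (elim n)
      interpret network n d lam by unfold_locales (use elim lam in auto)
      have lnn: "0 < ln (real n)" using elim(6) by simp
      have Dn: "D n \<le> ln (real n)" using elim(2) lnn by (simp add: field_simps)
      have small: "real (D n) * d \<le> real (n - 2)"
      proof -
        have "real (D n) * d \<le> ln (real n) * d" using Dn by (intro mult_right_mono) auto
        then show ?thesis using elim(5,6) by simp
      qed
      let ?y = "exp (- (D n * ln (D n)))"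
      have y: "?y \<le> real n powr - \<beta>"
        using elim(3) lnn elim(6) by (simp add: powr_def field_simps)
      have e: "exp (8 * lam * 2 ^ d * d * D n) \<le> real n powr (\<eta> / 4)"
        using elim(1) lnn elim(6) by (simp add: powr_def C_def field_simps)
      have "exp (8 * lam * 2 ^ d * d * D n) * (\<Prod>j<d. ?y + real j / real (n - 2)) \<le>
        real n powr (\<eta> / 4) * ((1 + 3 * real d) ^ (d - 1) * real n powr (- (\<eta> + 2)))"
        using prod_selection_bound [OF d elim(6) _ y] e
        by (intro mult_mono) (auto simp: \<eta>_def intro!: prod_nonneg)
      also have "\<dots> = (1 + 3 * real d) ^ (d - 1) * real n powr (\<eta> / 4 + (- (\<eta> + 2)))"
        by (simp only: powr_add mult_ac)
      finally have 1: "exp (8 * lam * 2 ^ d * d * D n) * (\<Prod>j<d. ?y + real j / real (n - 2)) \<le>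
        (1 + 3 * real d) ^ (d - 1) * real n powr (\<eta> / 4 + (- (\<eta> + 2)))" .
      have 2: "real n ^ 2 * D n * exp (- (5 * ln (real n))) \<le> ln (real n) * real n powr (- 3)"
      proof -
        have "exp (- (5 * ln (real n))) = real n powr (- 5)" using elim(6) by (simp add: powr_def)
        moreover have "real n ^ 2 = real n powr 2" using elim(6) by (simp add: powr_numeral)
        ultimately have "real n ^ 2 * D n * exp (- (5 * ln (real n))) = D n * real n powr (2 + (-5))"
          by (simp only: powr_add mult_ac)
        also have "\<dots> = D n * real n powr (- 3)" by simp
        also have "\<dots> \<le> ln (real n) * real n powr (- 3)"
          using Dn by (rule mult_right_mono) simp
        finally show ?thesis .
      qed
      have "?m n \<le> ennreal (lam * real n ^ 2 * real n powr K *
         (real n ^ 2 * D n * exp (- (5 * ln (real n))) +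
          exp (8 * lam * 2 ^ d * d * D n) * (\<Prod>j<d. ?y + real j / real (n - 2))))"
        by (rule mean_lost_explicit_bound) (use H elim small in auto)
      also have "\<dots> \<le> ennreal (lam * real n ^ 2 * real n powr K *
         (ln (real n) * real n powr (- 3) + (1 + 3 * real d) ^ (d - 1) * real n powr (\<eta> / 4 + (- (\<eta> + 2)))))"
        using 1 2 lam by (intro ennreal_leI mult_left_mono add_mono) auto
      also have "lam * real n ^ 2 * real n powr K *
         (ln (real n) * real n powr (- 3) + (1 + 3 * real d) ^ (d - 1) * real n powr (\<eta> / 4 + (- (\<eta> + 2)))) =
         lam * (real n powr (2 + K + - 3) * ln (real n) + (1 + 3 * real d) ^ (d - 1) * real n powr (2 + K + (\<eta> / 4 + (- (\<eta> + 2)))))"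
      proof -
        have "real n ^ 2 = real n powr 2" using elim(6) by (simp add: powr_numeral)
        then show ?thesis by (simp only: powr_add distrib_left mult_ac)
      qed
      also have "ennreal \<dots> \<le> ennreal (f n)"
        unfolding f_def using elim(6) lam K \<eta> lnn
        by (intro ennreal_leI mult_left_mono add_mono mult_right_mono powr_mono) auto
      finally show ?case .
    qed
    then have "?m \<longlonglongrightarrow> ennreal 0"
      by (intro tendsto_sandwich [OF _ _ tendsto_const tendsto_ennrealI [OF f]]) simp_all
    then show "?m \<longlonglongrightarrow> 0" by simp
  qed
  then show ?thesis using K by blast
qed


section \<open>Prolonging calls in progress\<close>

lemma load_at_cong:
  assumes "initial_load \<omega> = initial_load \<omega>'"
    and "\<And>e w k. k < initial_load \<omega> e w \<Longrightarrow> (t < residual \<omega> e w k) = (t < residual \<omega>' e w k)"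
    and "\<And>j. \<rho> j \<noteq> None \<Longrightarrow> call \<omega> j = call \<omega>' j"
    and "\<And>j. \<rho> j \<noteq> None \<Longrightarrow> in_progress \<omega> t j = in_progress \<omega>' t j"
  shows "load_at n \<omega> \<rho> t = load_at n \<omega>' \<rho> t"
proof (intro ext)
  fix e w
  have 1: "{k. k < initial_load \<omega> e w \<and> t < residual \<omega> e w k} = {k. k < initial_load \<omega>' e w \<and> t < residual \<omega>' e w k}"
    using assms(1,2) by auto
  have "call \<omega> j = e \<and> \<rho> j = Some w \<and> arrival_time \<omega> j \<le> t \<and> t < arrival_time \<omega> j + duration \<omega> j \<longleftrightarrow>
      call \<omega>' j = e \<and> \<rho> j = Some w \<and> arrival_time \<omega>' j \<le> t \<and> t < arrival_time \<omega>' j + duration \<omega>' j" for j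
    using assms(3) [of j] assms(4) [of j] unfolding in_progress_def by (cases "\<rho> j") auto
  then show "load_at n \<omega> \<rho> t e w = load_at n \<omega>' \<rho> t e w"
    unfolding load_at_def 1 by simp
qed

text \<open>Durations influence the decisions only through the question which calls are in progress
  at arrival times; their exact values may differ.\<close>

lemma routes_upto_cong:
  assumes "initial_load \<omega> = initial_load \<omega>'"
    and "\<And>j. j < m \<Longrightarrow> call \<omega> j = call \<omega>' j" "\<And>j. j < m \<Longrightarrow> selected \<omega> j = selected \<omega>' j"
    and "\<And>j. j < m \<Longrightarrow> tie_break \<omega> j = tie_break \<omega>' j"
    and "\<And>j. j < m \<Longrightarrow> arrival_time \<omega> j = arrival_time \<omega>' j"
    and "\<And>p e w k. p < m \<Longrightarrow> k < initial_load \<omega> e w \<Longrightarrow>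
      (arrival_time \<omega> p < residual \<omega> e w k) = (arrival_time \<omega> p < residual \<omega>' e w k)"
    and "\<And>p j. j < p \<Longrightarrow> p < m \<Longrightarrow> in_progress \<omega> (arrival_time \<omega> p) j = in_progress \<omega>' (arrival_time \<omega> p) j"
  shows "routes_upto n D R \<omega> m = routes_upto n D R \<omega>' m"
  using assms
proof (induction m)
  case (Suc m)
  have IH: "routes_upto n D R \<omega> m = routes_upto n D R \<omega>' m"
    by (rule Suc.IH) (use Suc.prems in auto)
  have "load_at n \<omega> (routes_upto n D R \<omega> m) (arrival_time \<omega> m) = load_at n \<omega>' (routes_upto n D R \<omega> m) (arrival_time \<omega> m)"
  proof (rule load_at_cong)
    show "call \<omega> j = call \<omega>' j" if "routes_upto n D R \<omega> m j \<noteq> None" for j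
      using that Suc.prems(2) by (auto simp: routes_upto_eq split: if_splits)
    show "in_progress \<omega> (arrival_time \<omega> m) j = in_progress \<omega>' (arrival_time \<omega> m) j" if "routes_upto n D R \<omega> m j \<noteq> None" for j
      using that Suc.prems(7) by (auto simp: routes_upto_eq split: if_splits)
  qed (use Suc.prems in auto)
  then show ?case
    using IH Suc.prems(2-5) by simp
qed simp

lemma arrival_time_cong: "(\<And>j. j \<le> i \<Longrightarrow> gap \<omega> j = gap \<omega>' j) \<Longrightarrow> arrival_time \<omega> i = arrival_time \<omega>' i"
  unfolding arrival_time_def by (rule sum.cong) auto

text \<open>A quantity that is invariant under such replacements is independent of arrival
  \<open>i\<close>; independence is expressed in this form below.\<close>

definition replace_arrival :: "nat \<Rightarrow> arrival \<Rightarrow> sample \<Rightarrow> sample" where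
  "replace_arrival i a \<omega> = (fst \<omega>, fst (snd \<omega>), (snd (snd \<omega>))(i := a))"

lemma replace_arrival_simps [simp]:
  "initial_load (replace_arrival i a \<omega>) = initial_load \<omega>"
  "residual (replace_arrival i a \<omega>) = residual \<omega>"
  "gap (replace_arrival i a \<omega>) j = (if j = i then fst a else gap \<omega> j)"
  "duration (replace_arrival i a \<omega>) j = (if j = i then fst (snd a) else duration \<omega> j)"
  "tie_break (replace_arrival i a \<omega>) j = (if j = i then fst (snd (snd a)) else tie_break \<omega> j)"
  "call (replace_arrival i a \<omega>) j = (if j = i then fst (snd (snd (snd a))) else call \<omega> j)"
  "selected (replace_arrival i a \<omega>) j = (if j = i then snd (snd (snd (snd a))) else selected \<omega> j)"
  by (auto simp: replace_arrival_def initial_load_def residual_def gap_def duration_def tie_break_def call_def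
      selected_def fun_eq_iff)

lemma replace_arrival_past:
  assumes "m \<le> i"
  shows "j < i \<Longrightarrow> arrival_time (replace_arrival i a \<omega>) j = arrival_time \<omega> j"
    and "j < i \<Longrightarrow> in_progress (replace_arrival i a \<omega>) t j = in_progress \<omega> t j"
    and "routes_upto n D R (replace_arrival i a \<omega>) m = routes_upto n D R \<omega> m"
proof -
  have *: "arrival_time (replace_arrival i a \<omega>) j = arrival_time \<omega> j" if "j < i" for j
    by (rule arrival_time_cong) (use that in auto)
  then show "j < i \<Longrightarrow> arrival_time (replace_arrival i a \<omega>) j = arrival_time \<omega> j" .
  have **: "in_progress (replace_arrival i a \<omega>) t j = in_progress \<omega> t j" if "j < i" for j t
    unfolding in_progress_def using * that by simp
  then show "j < i \<Longrightarrow> in_progress (replace_arrival i a \<omega>) t j = in_progress \<omega> t j" .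
  show "routes_upto n D R (replace_arrival i a \<omega>) m = routes_upto n D R \<omega> m"
    by (rule routes_upto_cong) (use assms * ** in auto)
qed

text \<open>Arrival \<open>i\<close> influences the loads that it finds only through its gap, which
  fixes the time. Its call and its selected nodes are therefore independent of these loads.\<close>

lemma seen_replace_arrival:
  assumes "fst a = gap \<omega> i"
  shows "arrival_time (replace_arrival i a \<omega>) i = arrival_time \<omega> i"
    and "seen n D R (replace_arrival i a \<omega>) i = seen n D R \<omega> i"
proof -
  show t: "arrival_time (replace_arrival i a \<omega>) i = arrival_time \<omega> i"
    by (rule arrival_time_cong) (use assms in auto)
  show "seen n D R (replace_arrival i a \<omega>) i = seen n D R \<omega> i"
    unfolding seen_def t replace_arrival_past(3) [OF order.refl]
    by (rule load_at_cong) (auto simp: replace_arrival_past(2) [OF order.refl] routes_upto_eq split: if_splits)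
qed

text \<open>The calls on the link \<open>uw\<close> at time \<open>t\<close>: initial calls carry the label \<open>Inl (e, k)\<close>, arrived calls
  the label \<open>Inr i\<close>.\<close>

definition calls_on ::
  "nat \<Rightarrow> sample \<Rightarrow> (nat \<Rightarrow> nat option) \<Rightarrow> real \<Rightarrow> nat \<Rightarrow> nat \<Rightarrow> ((nat set \<times> nat) + nat) set" where
  "calls_on n \<omega> \<rho> t u w = initial_calls n \<omega> t u w <+> arrived_calls n \<omega> \<rho> t u w"

lemma Inl_calls_on: "Inl (e, k) \<in> calls_on n \<omega> \<rho> t u w \<longleftrightarrow>
    e \<in> incident n u w \<and> k < initial_load \<omega> e w \<and> t < residual \<omega> e w k"
  by (auto simp: calls_on_def initial_calls_def)

lemma Inr_calls_on: "Inr i \<in> calls_on n \<omega> \<rho> t u w \<longleftrightarrow>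
    call \<omega> i \<in> incident n u w \<and> \<rho> i = Some w \<and> in_progress \<omega> t i"
  by (auto simp: calls_on_def arrived_calls_def in_progress_def)

lemma finite_arrived_calls: "finite {i. \<rho> i \<noteq> None} \<Longrightarrow> finite (arrived_calls n \<omega> \<rho> t u w)"
  by (rule finite_subset [of _ "{i. \<rho> i \<noteq> None}"]) (auto simp: arrived_calls_def)

lemma finite_calls_on: "finite {i. \<rho> i \<noteq> None} \<Longrightarrow> finite (calls_on n \<omega> \<rho> t u w)"
  unfolding calls_on_def by (intro finite_Plus finite_initial_calls finite_arrived_calls)

lemma card_calls_on:
  assumes "u \<in> nodes n" "w \<in> nodes n" "w \<noteq> u" "finite {i. \<rho> i \<noteq> None}"
  shows "card (calls_on n \<omega> \<rho> t u w) = link_load n (load_at n \<omega> \<rho> t) u w"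
  unfolding link_load_load_at [OF assms] calls_on_def
  by (simp add: card_Plus finite_arrived_calls [OF assms(4)])

text \<open>The label \<open>Inl (e, k)\<close> does not contain the node that the call is routed
  via, so \<open>w\<close> is a separate argument.\<close>

definition prolong :: "nat \<Rightarrow> ((nat set \<times> nat) + nat) set \<Rightarrow> real \<Rightarrow> sample \<Rightarrow> sample" where
  "prolong w B \<tau> \<omega> = (fst \<omega>,
     (\<lambda>c. fst (snd \<omega>) c + (if fst (snd c) = w \<and> Inl (fst c, snd (snd c)) \<in> B then \<tau> else 0)),
     (\<lambda>j. (fst (snd (snd \<omega>) j),
           fst (snd (snd (snd \<omega>) j)) + (if Inr j \<in> B then \<tau> else 0),
           snd (snd (snd (snd \<omega>) j)))))"

lemma prolong_simps [simp]:
  "initial_load (prolong w B \<tau> \<omega>) = initial_load \<omega>"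
  "residual (prolong w B \<tau> \<omega>) e w' k = residual \<omega> e w' k + (if w' = w \<and> Inl (e, k) \<in> B then \<tau> else 0)"
  "gap (prolong w B \<tau> \<omega>) j = gap \<omega> j"
  "duration (prolong w B \<tau> \<omega>) j = duration \<omega> j + (if Inr j \<in> B then \<tau> else 0)"
  "tie_break (prolong w B \<tau> \<omega>) j = tie_break \<omega> j"
  "call (prolong w B \<tau> \<omega>) j = call \<omega> j"
  "selected (prolong w B \<tau> \<omega>) j = selected \<omega> j"
  "arrival_time (prolong w B \<tau> \<omega>) j = arrival_time \<omega> j"
  by (auto simp: prolong_def initial_load_def residual_def gap_def duration_def tie_break_def call_def
      selected_def arrival_time_def)

lemma prolong_empty [simp]: "prolong w {} \<tau> \<omega> = \<omega>"
  by (simp add: prolong_def)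

lemma prolong_insert:
  "b \<notin> B \<Longrightarrow> prolong w (insert b B) \<tau> \<omega> = prolong w B \<tau> (prolong w {b} \<tau> \<omega>)"
  by (auto simp: prolong_def fun_eq_iff)

text \<open>Prolonging calls that are in progress at the arrival of call \<open>i\<close> does not affect any routing
  decision up to then.\<close>

lemma calls_on_prolong:
  assumes reg: "regular n d D \<omega>" and \<tau>: "0 \<le> \<tau>"
    and B: "B \<subseteq> calls_on n \<omega> (routes_upto n D R \<omega> (Suc i)) (arrival_time \<omega> i) u w"
  shows "B \<subseteq> calls_on n (prolong w B \<tau> \<omega>) (routes_upto n D R (prolong w B \<tau> \<omega>) (Suc i)) (arrival_time \<omega> i + \<tau>) u w"
proof -
  let ?t = "arrival_time \<omega> i" and ?\<omega> = "prolong w B \<tau> \<omega>"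
  have le: "arrival_time \<omega> p \<le> ?t" if "p < Suc i" for p
    using arrival_time_mono [OF reg] that by simp
  \<comment> \<open>Up to time \<open>?t\<close> a call of \<open>B\<close> passes the same tests
    with the old and with the new duration: it lasts beyond \<open>?t\<close> in either
    case.\<close>
  have routes: "routes_upto n D R ?\<omega> (Suc i) = routes_upto n D R \<omega> (Suc i)"
  proof (rule routes_upto_cong)
    fix p e w' k assume p: "p < Suc i"
    show "(arrival_time ?\<omega> p < residual ?\<omega> e w' k) = (arrival_time ?\<omega> p < residual \<omega> e w' k)"
    proof (cases "w' = w \<and> Inl (e, k) \<in> B")
      case True
      then have "?t < residual \<omega> e w k" using B by (auto simp: Inl_calls_on)
      then have "arrival_time \<omega> p < residual \<omega> e w k" using le [OF p] by linarith
      then show ?thesis using True \<tau> by simp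
    qed auto
  next
    fix p j assume j: "j < p" and p: "p < Suc i"
    show "in_progress ?\<omega> (arrival_time ?\<omega> p) j = in_progress \<omega> (arrival_time ?\<omega> p) j"
    proof (cases "Inr j \<in> B")
      case True
      then have "?t < arrival_time \<omega> j + duration \<omega> j" using B by (auto simp: Inr_calls_on in_progress_def)
      then have "arrival_time \<omega> p < arrival_time \<omega> j + duration \<omega> j" using le [OF p] by linarith
      then show ?thesis using True \<tau> by (simp add: in_progress_def)
    qed (simp add: in_progress_def)
  qed auto
  show ?thesis
    unfolding routes
  proof
    fix b assume b: "b \<in> B"
    show "b \<in> calls_on n ?\<omega> (routes_upto n D R \<omega> (Suc i)) (?t + \<tau>) u w"
    proof (cases b)
      case (Inl ek)
      obtain e k where "ek = (e, k)" by (cases ek)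
      then show ?thesis using b B Inl by (auto simp: Inl_calls_on)
    next
      case (Inr j)
      then have "Inr j \<in> calls_on n \<omega> (routes_upto n D R \<omega> (Suc i)) ?t u w" using b B by auto
      then show ?thesis using b \<tau> unfolding Inr by (simp add: Inr_calls_on in_progress_def del: routes_upto.simps)
    qed
  qed
qed

text \<open>The time is that of the arrival itself; a positive duration makes call \<open>i\<close>
  count as in progress at this very instant.\<close>

lemma calls_on_next:
  assumes reg: "regular n d D \<omega>" and dur: "0 < duration \<omega> i"
  shows "calls_on n \<omega> (routes_upto n D R \<omega> (Suc i)) (arrival_time \<omega> i) u w =
    calls_on n \<omega> (routes_upto n D R \<omega> i) (arrival_time \<omega> i) u w \<union>
      (if route n D R \<omega> i = Some w \<and> call \<omega> i \<in> incident n u w then {Inr i} else {})" (is "?L = ?R")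
proof (rule set_eqI)
  fix b
  show "b \<in> ?L \<longleftrightarrow> b \<in> ?R"
  proof (cases b)
    case (Inl ek)
    obtain e k where "ek = (e, k)" by (cases ek)
    then show ?thesis using Inl by (simp add: Inl_calls_on del: routes_upto.simps)
  next
    case (Inr j)
    have "in_progress \<omega> (arrival_time \<omega> i) i" using dur by (simp add: in_progress_def)
    then show ?thesis
      unfolding Inr by (auto simp: Inr_calls_on routes_upto_eq less_Suc_eq simp del: routes_upto.simps)
  qed
qed

lemma Inr_notin_calls_on: "Inr i \<notin> calls_on n \<omega> (routes_upto n D R \<omega> i) t u w"
  by (simp add: Inr_calls_on routes_upto_eq)

text \<open>The binomial coefficient counts the sets of \<open>k\<close> calls on the link. The sum
  ranges over a family that does not depend on the time or on the calls present, so expectations can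
  be taken for each \<open>B\<close> separately. \<open>D\<close> bounds the labels of initial calls
  because no pair of ends has more than \<open>D\<close> of them via one node.\<close>

lemma binomial_link_load:
  fixes m :: nat
  assumes reg: "regular n d D \<omega>" and u: "u \<in> nodes n" "w \<in> nodes n" "w \<noteq> u"
  defines "U \<equiv> (edges n \<times> {..<D}) <+> {..<m}"
  shows "link_load n (load_at n \<omega> (routes_upto n D R \<omega> m) t) u w choose k =
    (\<Sum>B | B \<subseteq> U \<and> card B = k. if B \<subseteq> calls_on n \<omega> (routes_upto n D R \<omega> m) t u w then 1 else 0)"
proof -
  let ?C = "calls_on n \<omega> (routes_upto n D R \<omega> m) t u w"
  have finU: "finite U" by (simp add: U_def finite_Plus)
  have x: "initial_load \<omega> \<in> states n D" using reg by (simp add: regular_def)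
  have CU: "?C \<subseteq> U"
  proof
    fix b assume b: "b \<in> ?C"
    show "b \<in> U"
    proof (cases b)
      case (Inl ek)
      obtain e k where "ek = (e, k)" by (cases ek)
      then show ?thesis using b Inl states_le [OF x, of e w] by (auto simp: Inl_calls_on U_def incident_def)
    next
      case (Inr j)
      then show ?thesis using b by (auto simp: Inr_calls_on U_def routes_upto_eq split: if_splits)
    qed
  qed
  have "link_load n (load_at n \<omega> (routes_upto n D R \<omega> m) t) u w choose k = card ?C choose k"
    by (subst card_calls_on) (use u finite_routes_upto in auto)
  also have "\<dots> = card {B. B \<subseteq> ?C \<and> card B = k}"
    by (rule n_subsets [symmetric]) (rule finite_subset [OF CU finU])
  also have "{B. B \<subseteq> ?C \<and> card B = k} = {B. B \<subseteq> U \<and> card B = k} \<inter> {B. B \<subseteq> ?C}"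
    using CU by auto
  also have "card \<dots> = (\<Sum>B | B \<subseteq> U \<and> card B = k. if B \<subseteq> ?C then 1 else 0)"
    using finU by (subst sum.If_cases) (auto intro: finite_subset [of _ "Pow U"])
  finally show ?thesis .
qed


section \<open>Measurability and shifts of durations\<close>

text \<open>In this form the decision is recursive in the list, which makes its measurability
  evident.\<close>

lemma fdar_decide:
  "decide n D (fdar n D) x e ws y = find (available n D x e) ws"
proof -
  have "(if \<exists>w\<in>set ws. P w then Some (hd (filter P ws)) else None) = find P ws" for P :: "nat \<Rightarrow> bool"
    by (induction ws) (auto split: if_splits)
  then show ?thesis unfolding decide_def fdar_def .
qed

lemma fdar_route: "route n D (fdar n D) \<omega> i = find (available n D (seen n D (fdar n D) \<omega> i) (call \<omega> i)) (selected \<omega> i)"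
  by (simp add: route_eq fdar_decide)

lemma measurable_add_nat:
  fixes f g :: "'a \<Rightarrow> nat"
  assumes [measurable]: "f \<in> M \<rightarrow>\<^sub>M count_space UNIV" "g \<in> M \<rightarrow>\<^sub>M count_space UNIV"
  shows "(\<lambda>\<omega>. f \<omega> + g \<omega>) \<in> M \<rightarrow>\<^sub>M count_space UNIV"
  by measurable

context network
begin

abbreviation (input) sample_M :: "load_vector pmf \<Rightarrow> sample measure" where
  "sample_M \<mu> \<equiv> sample_measure n lam d \<mu>"

lemma measurable_in_progress [measurable]:
  assumes [measurable]: "t \<in> borel_measurable (sample_M \<mu>)"
  shows "Measurable.pred (sample_M \<mu>) (\<lambda>\<omega>. in_progress \<omega> (t \<omega>) j)"
  unfolding in_progress_def by measurable

lemma measurable_call_eq [measurable]: "Measurable.pred (sample_M \<mu>) (\<lambda>\<omega>. call \<omega> j = e)"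
  by (rule measurable_compose [where N = "count_space UNIV" and g = "\<lambda>c. c = e" and f = "\<lambda>\<omega>. call \<omega> j"]) measurable

lemma measurable_call_in [measurable]: "Measurable.pred (sample_M \<mu>) (\<lambda>\<omega>. call \<omega> j \<in> E)"
  by (rule measurable_compose [where N = "count_space UNIV" and g = "\<lambda>c. c \<in> E" and f = "\<lambda>\<omega>. call \<omega> j"]) measurable

lemma measurable_initial_less [measurable]: "Measurable.pred (sample_M \<mu>) (\<lambda>\<omega>. k < initial_load \<omega> e w)"
  by (rule measurable_compose [where N = "count_space UNIV" and g = "\<lambda>x. k < x e w" and f = initial_load]) measurable

lemma measurable_load_at:
  assumes t [measurable]: "t \<in> borel_measurable (sample_M \<mu>)"
    and \<rho>: "\<And>j. j < m \<Longrightarrow> (\<lambda>\<omega>. \<rho> \<omega> j) \<in> sample_M \<mu> \<rightarrow>\<^sub>M count_space UNIV"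
    and fin: "\<And>\<omega> j. m \<le> j \<Longrightarrow> \<rho> \<omega> j = None"
  shows "(\<lambda>\<omega>. load_at n \<omega> (\<rho> \<omega>) (t \<omega>) e w) \<in> sample_M \<mu> \<rightarrow>\<^sub>M count_space UNIV"
proof (cases "e \<in> edges n \<and> w \<in> nodes n - e")
  case True
  have 1: "(\<lambda>\<omega>. card {k. k < initial_load \<omega> e w \<and> t \<omega> < residual \<omega> e w k}) \<in> sample_M \<mu> \<rightarrow>\<^sub>M count_space UNIV"
  proof (rule measurable_compose_countable [where g = "\<lambda>\<omega>. initial_load \<omega> e w"])
    fix m :: nat
    have eq: "card {k. k < m \<and> t \<omega> < residual \<omega> e w k} = (\<Sum>k<m. if t \<omega> < residual \<omega> e w k then 1 else 0)" for \<omega>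
      by (simp add: sum.If_cases Int_def)
    show "(\<lambda>\<omega>. card {k. k < m \<and> t \<omega> < residual \<omega> e w k}) \<in> sample_M \<mu> \<rightarrow>\<^sub>M count_space UNIV"
      unfolding eq by measurable
    show "(\<lambda>\<omega>. initial_load \<omega> e w) \<in> sample_M \<mu> \<rightarrow>\<^sub>M count_space UNIV"
      by (rule measurable_compose [where N = "count_space UNIV" and g = "\<lambda>x. x e w" and f = initial_load]) measurable
  qed
  have eq: "{j. call \<omega> j = e \<and> \<rho> \<omega> j = Some w \<and> arrival_time \<omega> j \<le> t \<omega> \<and> t \<omega> < arrival_time \<omega> j + duration \<omega> j} =
     {j \<in> {..<m}. call \<omega> j = e \<and> \<rho> \<omega> j = Some w \<and> in_progress \<omega> (t \<omega>) j}" for \<omega>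
    using fin [of _ \<omega>] by (auto simp: in_progress_def) (metis leI option.distinct(1))
  have 2: "(\<lambda>\<omega>. \<Sum>j<m. if call \<omega> j = e \<and> \<rho> \<omega> j = Some w \<and> in_progress \<omega> (t \<omega>) j then 1 else 0 :: nat) \<in> sample_M \<mu> \<rightarrow>\<^sub>M count_space UNIV"
  proof -
    have [measurable]: "Measurable.pred (sample_M \<mu>) (\<lambda>\<omega>. \<rho> \<omega> j = Some w)" if "j \<in> {..<m}" for j
      by (rule measurable_compose [OF \<rho>, where g = "\<lambda>r. r = Some w"]) (use that in auto)
    show ?thesis by measurable
  qed
  have eq2: "load_at n \<omega> (\<rho> \<omega>) (t \<omega>) e w = card {k. k < initial_load \<omega> e w \<and> t \<omega> < residual \<omega> e w k} +
     (\<Sum>j<m. if call \<omega> j = e \<and> \<rho> \<omega> j = Some w \<and> in_progress \<omega> (t \<omega>) j then 1 else 0)" for \<omega>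
    using True unfolding load_at_def eq by (simp add: sum.If_cases Int_def)
  show ?thesis unfolding eq2 by (rule measurable_add_nat [OF 1 2])
next
  case False
  then have "load_at n \<omega> (\<rho> \<omega>) (t \<omega>) e w = 0" for \<omega>
    unfolding load_at_def by (simp only: if_False)
  then show ?thesis by simp
qed

lemma measurable_find:
  assumes "\<And>w. Measurable.pred M (\<lambda>\<omega>. P \<omega> w)"
  shows "(\<lambda>\<omega>. find (P \<omega>) ws) \<in> M \<rightarrow>\<^sub>M count_space UNIV"
proof (induction ws)
  case (Cons w ws)
  note [measurable] = assms Cons
  show ?case unfolding find.simps by measurable
qed simp

text \<open>The two statements need each other: availability at arrival \<open>i\<close> depends on
  earlier routes, and the route of \<open>i\<close> on availability.\<close>

lemma measurable_fdar:
  "(\<lambda>\<omega>. route n D (fdar n D) \<omega> i) \<in> sample_M \<mu> \<rightarrow>\<^sub>M count_space UNIV \<and>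
   (\<forall>e w. Measurable.pred (sample_M \<mu>) (\<lambda>\<omega>. available n D (seen n D (fdar n D) \<omega> i) e w))"
proof (induction i rule: less_induct)
  case (less i)
  have load: "(\<lambda>\<omega>. seen n D (fdar n D) \<omega> i e w) \<in> sample_M \<mu> \<rightarrow>\<^sub>M count_space UNIV" for e w
    unfolding seen_def
    by (rule measurable_load_at [where m = i]) (use less in \<open>auto simp: routes_upto_eq\<close>)
  have av: "Measurable.pred (sample_M \<mu>) (\<lambda>\<omega>. available n D (seen n D (fdar n D) \<omega> i) e w)" for e w
  proof (cases "e \<in> edges n")
    case True
    then have "finite e" by (auto simp: edges_def intro: finite_subset)
    moreover have [measurable]: "(\<lambda>\<omega>. link_load n (seen n D (fdar n D) \<omega> i) u w) \<in> sample_M \<mu> \<rightarrow>\<^sub>M count_space UNIV" for u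
      unfolding link_load_def using load by measurable
    ultimately show ?thesis
      unfolding available_def saturated_def by measurable
  qed (simp add: available_def)
  \<comment> \<open>The type \<open>nat set\<close> is uncountable, but only a call in the finite
    set \<open>edges n\<close> has available routes.\<close>
  have eq: "available n D (seen n D (fdar n D) \<omega> i) (call \<omega> i) w \<longleftrightarrow>
      (\<exists>e\<in>edges n. call \<omega> i = e \<and> available n D (seen n D (fdar n D) \<omega> i) e w)" for \<omega> w
    by (auto simp: available_def)
  have [measurable]: "Measurable.pred (sample_M \<mu>) (\<lambda>\<omega>. available n D (seen n D (fdar n D) \<omega> i) (call \<omega> i) w)" for w
    unfolding eq by (intro pred_intros_finite pred_intros_logic av measurable_call_eq) simp
  have "(\<lambda>\<omega>. route n D (fdar n D) \<omega> i) \<in> sample_M \<mu> \<rightarrow>\<^sub>M count_space UNIV"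
    unfolding fdar_route
  proof (rule measurable_compose_countable [where g = "\<lambda>\<omega>. selected \<omega> i"])
    show "(\<lambda>\<omega>. find (available n D (seen n D (fdar n D) \<omega> i) (call \<omega> i)) ws) \<in> sample_M \<mu> \<rightarrow>\<^sub>M count_space UNIV" for ws
      by (rule measurable_find) measurable
  qed measurable
  then show ?case using av by blast
qed

lemmas measurable_fdar_route = measurable_fdar [THEN conjunct1]

lemma measurable_fdar_available:
  "Measurable.pred (sample_M \<mu>) (\<lambda>\<omega>. available n D (seen n D (fdar n D) \<omega> i) e w)"
  by (rule measurable_fdar [THEN conjunct2, THEN spec, THEN spec])

lemma measurable_seen: "(\<lambda>\<omega>. seen n D (fdar n D) \<omega> i e w) \<in> sample_M \<mu> \<rightarrow>\<^sub>M count_space UNIV"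
  unfolding seen_def
  by (rule measurable_load_at [where m = i]) (auto simp: routes_upto_eq measurable_fdar_route)

lemma measurable_link_load_seen [measurable]:
  "(\<lambda>\<omega>. link_load n (seen n D (fdar n D) \<omega> i) u w) \<in> sample_M \<mu> \<rightarrow>\<^sub>M count_space UNIV"
proof -
  note [measurable] = measurable_seen
  show ?thesis unfolding link_load_def by measurable
qed

lemma measurable_label_in_calls_on:
  assumes t [measurable]: "t \<in> borel_measurable (sample_M \<mu>)"
  shows "Measurable.pred (sample_M \<mu>) (\<lambda>\<omega>. b \<in> calls_on n \<omega> (routes_upto n D (fdar n D) \<omega> m) (t \<omega>) u w)"
proof (cases b)
  case (Inl ek)
  obtain e k where "ek = (e, k)" by (cases ek)
  then show ?thesis unfolding Inl by (simp add: Inl_calls_on)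
next
  case (Inr j)
  have [measurable]: "Measurable.pred (sample_M \<mu>) (\<lambda>\<omega>. routes_upto n D (fdar n D) \<omega> m j = Some w)"
  proof (cases "j < m")
    case True
    then show ?thesis
      unfolding routes_upto_eq
      by simp (rule measurable_compose [OF measurable_fdar_route, where g = "\<lambda>r. r = Some w"], simp)
  qed (simp add: routes_upto_eq)
  show ?thesis unfolding Inr Inr_calls_on by measurable
qed

lemma measurable_subset_calls_on:
  assumes "t \<in> borel_measurable (sample_M \<mu>)" "finite B"
  shows "Measurable.pred (sample_M \<mu>) (\<lambda>\<omega>. B \<subseteq> calls_on n \<omega> (routes_upto n D (fdar n D) \<omega> m) (t \<omega>) u w)"
  unfolding subset_eq using assms(2) by (intro pred_intros_finite measurable_label_in_calls_on assms(1))

section \<open>Lack of memory for a single coordinate of the sample\<close>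

lemma nn_integral_resample_residual:
  assumes [measurable]: "H \<in> borel_measurable residual_measure"
  shows "(\<integral>\<^sup>+r. H r \<partial>residual_measure) = (\<integral>\<^sup>+r. \<integral>\<^sup>+v. H (r(c := v)) \<partial>exponential_measure 1 \<partial>residual_measure)"
proof -
  have ps: "prob_space (exponential_measure 1)" by (rule prob_space_exponential_measure) simp
  interpret ER: pair_sigma_finite "exponential_measure 1" residual_measure
    unfolding pair_sigma_finite_def
    using prob_space_imp_sigma_finite [OF ps] prob_space_imp_sigma_finite [OF res.P.prob_space_axioms] by simp
  have [measurable]: "(\<lambda>z. (snd z)(c := fst z)) \<in> exponential_measure 1 \<Otimes>\<^sub>M residual_measure \<rightarrow>\<^sub>M residual_measure"
    by (rule measurable_fun_upd [where J = UNIV]) auto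
  have "(\<integral>\<^sup>+r. H r \<partial>residual_measure) =
      (\<integral>\<^sup>+r. H r \<partial>distr (exponential_measure 1 \<Otimes>\<^sub>M residual_measure) residual_measure (\<lambda>(v, r). r(c := v)))"
    using distr_pair_PiM_eq_PiM [of UNIV "\<lambda>_. exponential_measure 1" c] ps by simp
  also have "\<dots> = (\<integral>\<^sup>+z. H ((snd z)(c := fst z)) \<partial>(exponential_measure 1 \<Otimes>\<^sub>M residual_measure))"
    by (subst nn_integral_distr) (auto simp: case_prod_unfold)
  also have "\<dots> = (\<integral>\<^sup>+r. \<integral>\<^sup>+v. H (r(c := v)) \<partial>exponential_measure 1 \<partial>residual_measure)"
    by (subst ER.nn_integral_snd [symmetric]) auto
  finally show ?thesis .
qed

lemma residual_shift:
  assumes [measurable]: "H \<in> borel_measurable residual_measure" and \<tau>: "0 \<le> \<tau>"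
  shows "ennreal (exp (- \<tau>)) * (\<integral>\<^sup>+r. H (r(c := r c + \<tau>)) \<partial>residual_measure) \<le> (\<integral>\<^sup>+r. H r \<partial>residual_measure)"
proof -
  have [measurable]: "(\<lambda>r. r(c := r c + \<tau>)) \<in> residual_measure \<rightarrow>\<^sub>M residual_measure"
    by (rule measurable_fun_upd [where J = UNIV]) auto
  have upd: "(\<lambda>v. H (r(c := v))) \<in> borel_measurable borel" if "r \<in> space residual_measure" for r
  proof -
    have "(\<lambda>v. r(c := v)) \<in> borel \<rightarrow>\<^sub>M residual_measure"
      by (rule measurable_fun_upd [where J = UNIV]) (use that in auto)
    then show ?thesis by measurable
  qed
  have [measurable]: "(\<lambda>r. \<integral>\<^sup>+v. H (r(c := v + \<tau>)) \<partial>exponential_measure 1) \<in> borel_measurable residual_measure"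
  proof -
    have sf: "sigma_finite_measure (exponential_measure 1)"
      by (rule prob_space_imp_sigma_finite, rule prob_space_exponential_measure) simp
    have [measurable]: "(\<lambda>z. (fst z)(c := snd z + \<tau>)) \<in> residual_measure \<Otimes>\<^sub>M exponential_measure 1 \<rightarrow>\<^sub>M residual_measure"
      by (rule measurable_fun_upd [where J = UNIV]) auto
    show ?thesis by (rule sigma_finite_measure.borel_measurable_nn_integral [OF sf]) (simp add: case_prod_unfold)
  qed
  have "ennreal (exp (- \<tau>)) * (\<integral>\<^sup>+r. H (r(c := r c + \<tau>)) \<partial>residual_measure) =
     ennreal (exp (- \<tau>)) * (\<integral>\<^sup>+r. \<integral>\<^sup>+v. H (r(c := v + \<tau>)) \<partial>exponential_measure 1 \<partial>residual_measure)"
    by (subst nn_integral_resample_residual [where c = c]) simp_all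
  also have "\<dots> = (\<integral>\<^sup>+r. ennreal (exp (- \<tau>)) * (\<integral>\<^sup>+v. H (r(c := v + \<tau>)) \<partial>exponential_measure 1) \<partial>residual_measure)"
    by (rule nn_integral_cmult [symmetric]) measurable
  also have "\<dots> \<le> (\<integral>\<^sup>+r. (\<integral>\<^sup>+v. H (r(c := v)) \<partial>exponential_measure 1) \<partial>residual_measure)"
    by (intro nn_integral_mono exponential_measure_shift [where f = "\<lambda>v. H (r(c := v))" for r] upd \<tau>)
  also have "\<dots> = (\<integral>\<^sup>+r. H r \<partial>residual_measure)"
    by (rule nn_integral_resample_residual [symmetric]) simp
  finally show ?thesis .
qed

lemma arrival_shift:
  assumes H [measurable]: "H \<in> borel_measurable A" and \<tau>: "0 \<le> \<tau>"
  shows "ennreal (exp (- \<tau>)) * (\<integral>\<^sup>+a. H (fst a, fst (snd a) + \<tau>, snd (snd a)) \<partial>A) \<le> (\<integral>\<^sup>+a. H a \<partial>A)"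
proof -
  interpret U: prob_space "uniform_measure lborel {0..1::real}" by (rule prob_space_uniform_unit)
  have [measurable]: "H \<in> borel_measurable (borel \<Otimes>\<^sub>M borel \<Otimes>\<^sub>M borel \<Otimes>\<^sub>M count_space UNIV)"
    using H by (simp add: mark_measure_def cong: measurable_cong_sets sets_pair_measure_cong)
  let ?h = "\<lambda>g x. \<integral>\<^sup>+y. \<integral>\<^sup>+c. H (g, x, y, c) \<partial>call_pmf n d \<partial>uniform_measure lborel {0..1::real}"
  have hm: "(\<lambda>x. ?h g x) \<in> borel_measurable borel" for g
    by measurable
  have Hs: "(\<lambda>a. H (fst a, fst (snd a) + \<tau>, snd (snd a))) \<in> borel_measurable A"
    unfolding mark_measure_def by measurable
  interpret E: sigma_finite_measure "exponential_measure 1"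
    by (rule prob_space_imp_sigma_finite, rule prob_space_exponential_measure) simp
  have m: "(\<lambda>g. \<integral>\<^sup>+x. ?h g (x + \<tau>) \<partial>exponential_measure 1) \<in> borel_measurable (exponential_measure rate)"
    by measurable
  have "ennreal (exp (- \<tau>)) * (\<integral>\<^sup>+a. H (fst a, fst (snd a) + \<tau>, snd (snd a)) \<partial>A) =
     (\<integral>\<^sup>+g. ennreal (exp (- \<tau>)) * (\<integral>\<^sup>+x. ?h g (x + \<tau>) \<partial>exponential_measure 1) \<partial>exponential_measure rate)"
    by (subst nn_integral_arrival [OF Hs]) (simp add: nn_integral_cmult [OF m])
  also have "\<dots> \<le> (\<integral>\<^sup>+g. (\<integral>\<^sup>+x. ?h g x \<partial>exponential_measure 1) \<partial>exponential_measure rate)"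
    by (intro nn_integral_mono exponential_measure_shift hm \<tau>)
  also have "\<dots> = (\<integral>\<^sup>+a. H a \<partial>A)"
    by (rule nn_integral_arrival [symmetric]) simp
  finally show ?thesis .
qed

text \<open>The shift may depend on the other arrivals but not on arrival \<open>j\<close>; it is
  constant while coordinate \<open>j\<close> is integrated.\<close>

lemma stream_shift:
  fixes \<tau> :: "(nat \<Rightarrow> arrival) \<Rightarrow> real"
  assumes H [measurable]: "H \<in> borel_measurable St" and \<tau>m [measurable]: "\<tau> \<in> borel_measurable St"
    and \<tau>: "\<And>s. 0 \<le> \<tau> s" "\<And>s a. \<tau> (s(j := a)) = \<tau> s"
  shows "(\<integral>\<^sup>+s. ennreal (exp (- \<tau> s)) * H (s(j := (fst (s j), fst (snd (s j)) + \<tau> s, snd (snd (s j))))) \<partial>St) \<le> (\<integral>\<^sup>+s. H s \<partial>St)"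
proof -
  have sh [measurable]: "(\<lambda>s. (fst (s j), fst (snd (s j)) + \<tau> s, snd (snd (s j)))) \<in> St \<rightarrow>\<^sub>M A"
  proof -
    have "(\<lambda>(a, t). (fst a, fst (snd a) + t, snd (snd a))) \<in> A \<Otimes>\<^sub>M borel \<rightarrow>\<^sub>M A"
      unfolding mark_measure_def by measurable
    moreover have "(\<lambda>s. (s j, \<tau> s)) \<in> St \<rightarrow>\<^sub>M A \<Otimes>\<^sub>M borel"
      by measurable
    ultimately show ?thesis
      using measurable_compose by fastforce
  qed
  have "(\<integral>\<^sup>+s. ennreal (exp (- \<tau> s)) * H (s(j := (fst (s j), fst (snd (s j)) + \<tau> s, snd (snd (s j))))) \<partial>St) =
     (\<integral>\<^sup>+s. \<integral>\<^sup>+a. ennreal (exp (- \<tau> s)) * H (s(j := (fst a, fst (snd a) + \<tau> s, snd (snd a)))) \<partial>A \<partial>St)"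
    by (subst nn_integral_resample_arrival [where i = j]) (simp_all add: \<tau>(2))
  also have "\<dots> \<le> (\<integral>\<^sup>+s. \<integral>\<^sup>+a. H (s(j := a)) \<partial>A \<partial>St)"
  proof (rule nn_integral_mono)
    fix s assume s: "s \<in> space St"
    have 1: "(\<lambda>a. H (s(j := a))) \<in> borel_measurable A" using s by measurable
    have 2: "(\<lambda>a. (fst a, fst (snd a) + \<tau> s, snd (snd a))) \<in> A \<rightarrow>\<^sub>M A"
      unfolding mark_measure_def by measurable
    have 3: "(\<lambda>a. H (s(j := (fst a, fst (snd a) + \<tau> s, snd (snd a))))) \<in> borel_measurable A"
      by (rule measurable_compose [OF 2 1])
    show "(\<integral>\<^sup>+a. ennreal (exp (- \<tau> s)) * H (s(j := (fst a, fst (snd a) + \<tau> s, snd (snd a)))) \<partial>A) \<le> (\<integral>\<^sup>+a. H (s(j := a)) \<partial>A)"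
      using arrival_shift [OF 1 \<tau>(1)] by (simp add: nn_integral_cmult [OF 3])
  qed
  also have "\<dots> = (\<integral>\<^sup>+s. H s \<partial>St)"
    by (rule nn_integral_resample_arrival [symmetric]) simp
  finally show ?thesis .
qed

end

section \<open>Discounted time and the survival of a set of calls until the next arrival\<close>

definition discount :: "real \<Rightarrow> real \<Rightarrow> real \<Rightarrow> real" where
  "discount \<epsilon> t1 t = (if t1 \<le> t then exp (- \<epsilon> * (t - t1)) else 0)"

lemma discount_nonneg: "0 \<le> discount \<epsilon> t1 t"
  by (simp add: discount_def)

lemma measurable_discount [measurable]: "discount \<epsilon> t1 \<in> borel_measurable borel"
  unfolding discount_def [abs_def] by measurable

lemma discount_add: "0 \<le> g \<Longrightarrow> exp (- \<epsilon> * g) * discount \<epsilon> t1 t \<le> discount \<epsilon> t1 (t + g)"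
  by (simp add: discount_def algebra_simps flip: exp_add)

context network
begin

text \<open>Gaps are positive only almost everywhere.\<close>

definition next_gap :: "nat \<Rightarrow> sample \<Rightarrow> real" where
  "next_gap i \<omega> = max 0 (gap \<omega> (Suc i))"

lemma next_gap_nonneg: "0 \<le> next_gap i \<omega>"
  by (simp add: next_gap_def)

lemma measurable_next_gap [measurable]: "next_gap i \<in> borel_measurable (sample_M \<mu>)"
  unfolding next_gap_def [abs_def] by measurable

lemma next_gap_prolong [simp]: "next_gap i (prolong w B \<tau> \<omega>) = next_gap i \<omega>"
  by (simp add: next_gap_def)

lemma prolong_Inl: "prolong w {Inl (e, k)} \<tau> (x, r, s) = (x, r((e, w, k) := r (e, w, k) + \<tau>), s)"
  by (auto simp: prolong_def fun_eq_iff)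

lemma prolong_Inr: "prolong w {Inr j} \<tau> (x, r, s) =
    (x, r, s(j := (fst (s j), fst (snd (s j)) + \<tau>, snd (snd (s j)))))"
  by (auto simp: prolong_def fun_eq_iff)

lemma measurable_prolong_one:
  "(\<lambda>\<omega>. prolong w {b} (next_gap i \<omega>) \<omega>) \<in> sample_M \<mu> \<rightarrow>\<^sub>M sample_M \<mu>"
proof -
  have g [measurable]: "(\<lambda>\<omega>. next_gap i \<omega>) \<in> borel_measurable (measure_pmf \<mu> \<Otimes>\<^sub>M residual_measure \<Otimes>\<^sub>M St)"
    using measurable_next_gap [of i \<mu>] by (simp add: sample_measure_eq)
  show ?thesis
  proof (cases b)
    case (Inl ek)
    obtain e k where ek: "ek = (e, k)" by (cases ek)
    have "(\<lambda>\<omega>. (fst (snd \<omega>))((e, w, k) := fst (snd \<omega>) (e, w, k) + next_gap i \<omega>)) \<in>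
        measure_pmf \<mu> \<Otimes>\<^sub>M residual_measure \<Otimes>\<^sub>M St \<rightarrow>\<^sub>M residual_measure"
      by (rule measurable_fun_upd [where J = UNIV]) auto
    then have "(\<lambda>\<omega>. (fst \<omega>, (fst (snd \<omega>))((e, w, k) := fst (snd \<omega>) (e, w, k) + next_gap i \<omega>), snd (snd \<omega>))) \<in>
        measure_pmf \<mu> \<Otimes>\<^sub>M residual_measure \<Otimes>\<^sub>M St \<rightarrow>\<^sub>M measure_pmf \<mu> \<Otimes>\<^sub>M residual_measure \<Otimes>\<^sub>M St"
      by measurable
    moreover have "prolong w {b} (next_gap i \<omega>) \<omega> =
        (fst \<omega>, (fst (snd \<omega>))((e, w, k) := fst (snd \<omega>) (e, w, k) + next_gap i \<omega>), snd (snd \<omega>))" for \<omega>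
      unfolding Inl ek by (metis prolong_Inl prod.collapse)
    ultimately show ?thesis by (simp add: sample_measure_eq)
  next
    case (Inr j)
    have "(\<lambda>(a, t). (fst a, fst (snd a) + t, snd (snd a))) \<in> A \<Otimes>\<^sub>M borel \<rightarrow>\<^sub>M A"
      unfolding mark_measure_def by measurable
    moreover have "(\<lambda>\<omega>. (snd (snd \<omega>) j, next_gap i \<omega>)) \<in> measure_pmf \<mu> \<Otimes>\<^sub>M residual_measure \<Otimes>\<^sub>M St \<rightarrow>\<^sub>M A \<Otimes>\<^sub>M borel"
      by measurable
    ultimately have "(\<lambda>\<omega>. (fst (snd (snd \<omega>) j), fst (snd (snd (snd \<omega>) j)) + next_gap i \<omega>, snd (snd (snd (snd \<omega>) j)))) \<in>
        measure_pmf \<mu> \<Otimes>\<^sub>M residual_measure \<Otimes>\<^sub>M St \<rightarrow>\<^sub>M A"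
      using measurable_compose by fastforce
    then have "(\<lambda>\<omega>. (fst \<omega>, fst (snd \<omega>), (snd (snd \<omega>))(j := (fst (snd (snd \<omega>) j), fst (snd (snd (snd \<omega>) j)) + next_gap i \<omega>, snd (snd (snd (snd \<omega>) j)))))) \<in>
        measure_pmf \<mu> \<Otimes>\<^sub>M residual_measure \<Otimes>\<^sub>M St \<rightarrow>\<^sub>M measure_pmf \<mu> \<Otimes>\<^sub>M residual_measure \<Otimes>\<^sub>M St"
      by measurable
    moreover have "prolong w {b} (next_gap i \<omega>) \<omega> =
        (fst \<omega>, fst (snd \<omega>), (snd (snd \<omega>))(j := (fst (snd (snd \<omega>) j), fst (snd (snd (snd \<omega>) j)) + next_gap i \<omega>, snd (snd (snd (snd \<omega>) j)))))" for \<omega>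
      unfolding Inr by (metis prolong_Inr prod.collapse)
    ultimately show ?thesis by (simp add: sample_measure_eq)
  qed
qed

text \<open>The shift is the gap before arrival \<open>Suc i\<close>, and the prolonged duration
  belongs to an initial call or to a call with index at most \<open>i\<close>. The two are
  independent, so the lack of memory applies with the gap held fixed.\<close>

lemma prolong_one:
  assumes H: "H \<in> borel_measurable (sample_M \<mu>)" and b: "\<And>j. b = Inr j \<Longrightarrow> j \<le> i"
  shows "(\<integral>\<^sup>+\<omega>. ennreal (exp (- next_gap i \<omega>)) * H (prolong w {b} (next_gap i \<omega>) \<omega>) \<partial>sample_M \<mu>) \<le>
    (\<integral>\<^sup>+\<omega>. H \<omega> \<partial>sample_M \<mu>)"
proof -
  have [measurable]: "(\<lambda>\<omega>. H (prolong w {b} (next_gap i \<omega>) \<omega>)) \<in> borel_measurable (sample_M \<mu>)"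
    by (rule measurable_compose [OF measurable_prolong_one H])
  have Hp [measurable]: "H \<in> borel_measurable (measure_pmf \<mu> \<Otimes>\<^sub>M residual_measure \<Otimes>\<^sub>M St)"
    using H by (simp add: sample_measure_eq)
  define \<tau> where "\<tau> s = max 0 (fst (s (Suc i)))" for s :: "nat \<Rightarrow> arrival"
  have \<tau>: "next_gap i (x, r, s) = \<tau> s" for x r s
    by (simp add: next_gap_def gap_def \<tau>_def)
  have \<tau>m [measurable]: "\<tau> \<in> borel_measurable St"
    unfolding \<tau>_def by measurable
  have Hx: "(\<lambda>z. H (x, z)) \<in> borel_measurable (residual_measure \<Otimes>\<^sub>M St)" for x
    by measurable
  have "(\<integral>\<^sup>+\<omega>. ennreal (exp (- next_gap i \<omega>)) * H (prolong w {b} (next_gap i \<omega>) \<omega>) \<partial>sample_M \<mu>) =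
     (\<integral>\<^sup>+x. \<integral>\<^sup>+r. \<integral>\<^sup>+s. ennreal (exp (- \<tau> s)) * H (prolong w {b} (\<tau> s) (x, r, s)) \<partial>St \<partial>residual_measure \<partial>measure_pmf \<mu>)"
    by (subst nn_integral_sample) (simp_all add: \<tau>)
  also have "\<dots> \<le> (\<integral>\<^sup>+x. \<integral>\<^sup>+r. \<integral>\<^sup>+s. H (x, r, s) \<partial>St \<partial>residual_measure \<partial>measure_pmf \<mu>)"
  proof (rule nn_integral_mono)
    fix x
    have Hm: "(\<lambda>z. H (prolong w {b} (\<tau> (snd z)) (x, z))) \<in> borel_measurable (residual_measure \<Otimes>\<^sub>M St)"
    proof -
      have "(\<lambda>\<omega>. H (prolong w {b} (next_gap i \<omega>) \<omega>)) \<in> borel_measurable (measure_pmf \<mu> \<Otimes>\<^sub>M residual_measure \<Otimes>\<^sub>M St)"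
        using measurable_compose [OF measurable_prolong_one H] by (simp add: sample_measure_eq)
      from measurable_compose [OF measurable_Pair1' this, of x]
      show ?thesis by (simp add: next_gap_def gap_def \<tau>_def)
    qed
    show "(\<integral>\<^sup>+r. \<integral>\<^sup>+s. ennreal (exp (- \<tau> s)) * H (prolong w {b} (\<tau> s) (x, r, s)) \<partial>St \<partial>residual_measure) \<le>
       (\<integral>\<^sup>+r. \<integral>\<^sup>+s. H (x, r, s) \<partial>St \<partial>residual_measure)"
    proof (cases b)
      case (Inl ek)
      obtain e k where ek: "ek = (e, k)" by (cases ek)
      let ?c = "(e, w, k)"
      \<comment> \<open>The remaining durations are integrated first, so that the stream and with it
        \<open>\<tau> s\<close> are fixed.\<close>
      have "(\<integral>\<^sup>+r. \<integral>\<^sup>+s. ennreal (exp (- \<tau> s)) * H (prolong w {b} (\<tau> s) (x, r, s)) \<partial>St \<partial>residual_measure) =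
         (\<integral>\<^sup>+s. \<integral>\<^sup>+r. ennreal (exp (- \<tau> s)) * H (prolong w {b} (\<tau> s) (x, r, s)) \<partial>residual_measure \<partial>St)"
        by (rule tail.Fubini' [symmetric]) (use Hm in \<open>simp add: case_prod_unfold\<close>)
      also have "\<dots> \<le> (\<integral>\<^sup>+s. \<integral>\<^sup>+r. H (x, r, s) \<partial>residual_measure \<partial>St)"
      proof (rule nn_integral_mono)
        fix s assume s: "s \<in> space St"
        have 1: "(\<lambda>r. H (x, r, s)) \<in> borel_measurable residual_measure" using s by measurable
        have 2: "(\<lambda>r. r(?c := r ?c + \<tau> s)) \<in> residual_measure \<rightarrow>\<^sub>M residual_measure"
          by (rule measurable_fun_upd [where J = UNIV]) auto
        have 3: "(\<lambda>r. H (x, r(?c := r ?c + \<tau> s), s)) \<in> borel_measurable residual_measure"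
          by (rule measurable_compose [OF 2 1])
        have "0 \<le> \<tau> s" by (simp add: \<tau>_def)
        from residual_shift [OF 1 this, of ?c]
        show "(\<integral>\<^sup>+r. ennreal (exp (- \<tau> s)) * H (prolong w {b} (\<tau> s) (x, r, s)) \<partial>residual_measure) \<le> (\<integral>\<^sup>+r. H (x, r, s) \<partial>residual_measure)"
          by (simp add: Inl ek prolong_Inl nn_integral_cmult [OF 3])
      qed
      also have "\<dots> = (\<integral>\<^sup>+r. \<integral>\<^sup>+s. H (x, r, s) \<partial>St \<partial>residual_measure)"
        by (rule tail.Fubini') (use Hx in simp)
      finally show ?thesis .
    next
      case (Inr j)
      \<comment> \<open>\<open>\<tau>\<close> reads only coordinate \<open>Suc i\<close>, so a
        change of coordinate \<open>j\<close> leaves it unchanged.\<close>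
      have j: "j \<noteq> Suc i" using b [OF Inr] by simp
      show ?thesis
      proof (rule nn_integral_mono)
        fix r assume r: "r \<in> space residual_measure"
        have 1: "(\<lambda>s. H (x, r, s)) \<in> borel_measurable St" using r by measurable
        have "(\<integral>\<^sup>+s. ennreal (exp (- \<tau> s)) * H (x, r, s(j := (fst (s j), fst (snd (s j)) + \<tau> s, snd (snd (s j))))) \<partial>St) \<le> (\<integral>\<^sup>+s. H (x, r, s) \<partial>St)"
          by (rule stream_shift [OF 1 \<tau>m]) (use j in \<open>auto simp: \<tau>_def\<close>)
        then show "(\<integral>\<^sup>+s. ennreal (exp (- \<tau> s)) * H (prolong w {b} (\<tau> s) (x, r, s)) \<partial>St) \<le> (\<integral>\<^sup>+s. H (x, r, s) \<partial>St)"
          by (simp add: Inr prolong_Inr)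
      qed
    qed
  qed
  also have "\<dots> = (\<integral>\<^sup>+\<omega>. H \<omega> \<partial>sample_M \<mu>)"
    by (rule nn_integral_sample [OF H, symmetric])
  finally show ?thesis .
qed

text \<open>The calls are prolonged one at a time. Prolonging does not change the gap, so each step
  costs the same factor.\<close>

lemma prolong_many:
  assumes "finite B" "\<And>j. Inr j \<in> B \<Longrightarrow> j \<le> i" "H \<in> borel_measurable (sample_M \<mu>)"
  shows "(\<lambda>\<omega>. H (prolong w B (next_gap i \<omega>) \<omega>)) \<in> borel_measurable (sample_M \<mu>) \<and>
    (\<integral>\<^sup>+\<omega>. ennreal (exp (- (card B * next_gap i \<omega>))) * H (prolong w B (next_gap i \<omega>) \<omega>) \<partial>sample_M \<mu>) \<le>
    (\<integral>\<^sup>+\<omega>. H \<omega> \<partial>sample_M \<mu>)"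
  using assms
proof (induction B rule: finite_induct)
  case empty
  then show ?case by simp
next
  case (insert b B)
  let ?G = "\<lambda>\<omega>. H (prolong w B (next_gap i \<omega>) \<omega>)"
  have IH: "?G \<in> borel_measurable (sample_M \<mu>)"
    "(\<integral>\<^sup>+\<omega>. ennreal (exp (- (card B * next_gap i \<omega>))) * ?G \<omega> \<partial>sample_M \<mu>) \<le> (\<integral>\<^sup>+\<omega>. H \<omega> \<partial>sample_M \<mu>)"
    using insert.IH insert.prems by auto
  note [measurable] = IH(1)
  have eq: "H (prolong w (insert b B) (next_gap i \<omega>) \<omega>) = ?G (prolong w {b} (next_gap i \<omega>) \<omega>)" for \<omega>
    by (simp add: prolong_insert [OF insert.hyps(2)])
  have "(\<integral>\<^sup>+\<omega>. ennreal (exp (- (card (insert b B) * next_gap i \<omega>))) * H (prolong w (insert b B) (next_gap i \<omega>) \<omega>) \<partial>sample_M \<mu>) =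
     (\<integral>\<^sup>+\<omega>. ennreal (exp (- next_gap i \<omega>)) * (\<lambda>\<omega>. ennreal (exp (- (card B * next_gap i \<omega>))) * ?G \<omega>) (prolong w {b} (next_gap i \<omega>) \<omega>) \<partial>sample_M \<mu>)"
  proof (rule nn_integral_cong)
    fix \<omega>
    have "exp (- (real (Suc (card B)) * next_gap i \<omega>)) = exp (- next_gap i \<omega>) * exp (- (card B * next_gap i \<omega>))"
      by (simp add: algebra_simps flip: exp_add)
    then show "ennreal (exp (- (card (insert b B) * next_gap i \<omega>))) * H (prolong w (insert b B) (next_gap i \<omega>) \<omega>) =
      ennreal (exp (- next_gap i \<omega>)) * (\<lambda>\<omega>. ennreal (exp (- (card B * next_gap i \<omega>))) * ?G \<omega>) (prolong w {b} (next_gap i \<omega>) \<omega>)"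
      unfolding eq using insert.hyps by (simp add: ennreal_mult mult.assoc)
  qed
  also have "\<dots> \<le> (\<integral>\<^sup>+\<omega>. ennreal (exp (- (card B * next_gap i \<omega>))) * ?G \<omega> \<partial>sample_M \<mu>)"
  proof (rule prolong_one)
    show "(\<lambda>\<omega>. ennreal (exp (- (card B * next_gap i \<omega>))) * ?G \<omega>) \<in> borel_measurable (sample_M \<mu>)"
      by measurable
  qed (use insert.prems(1) in auto)
  also note IH(2)
  finally have "(\<integral>\<^sup>+\<omega>. ennreal (exp (- (card (insert b B) * next_gap i \<omega>))) * H (prolong w (insert b B) (next_gap i \<omega>) \<omega>) \<partial>sample_M \<mu>)
    \<le> (\<integral>\<^sup>+\<omega>. H \<omega> \<partial>sample_M \<mu>)" .
  moreover have "(\<lambda>\<omega>. H (prolong w (insert b B) (next_gap i \<omega>) \<omega>)) \<in> borel_measurable (sample_M \<mu>)"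
    unfolding eq by (rule measurable_compose [OF measurable_prolong_one IH(1)])
  ultimately show ?case by blast
qed

text \<open>The factor is the Laplace transform of the gap before arrival \<open>Suc i\<close>, from
  which \<open>F\<close> is independent.\<close>

lemma gap_independent:
  assumes F [measurable]: "F \<in> borel_measurable (sample_M \<mu>)"
    and indep: "\<And>\<omega> a. F (replace_arrival (Suc i) a \<omega>) = F \<omega>" and c: "0 \<le> c"
  shows "(\<integral>\<^sup>+\<omega>. ennreal (exp (- c * next_gap i \<omega>)) * F \<omega> \<partial>sample_M \<mu>) = ennreal (rate / (rate + c)) * (\<integral>\<^sup>+\<omega>. F \<omega> \<partial>sample_M \<mu>)"
proof -
  have pt: "(\<integral>\<^sup>+s. ennreal (exp (- c * next_gap i (x, r, s))) * F (x, r, s) \<partial>St) = ennreal (rate / (rate + c)) * (\<integral>\<^sup>+s. F (x, r, s) \<partial>St)"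
    if r: "r \<in> space residual_measure" for x r
  proof -
    have F': "F \<in> borel_measurable (measure_pmf \<mu> \<Otimes>\<^sub>M residual_measure \<Otimes>\<^sub>M St)"
      using F by (simp add: sample_measure_eq)
    have [measurable]: "(\<lambda>s. F (x, r, s)) \<in> borel_measurable St"
      using r F' by measurable
    have [measurable]: "(\<lambda>s. next_gap i (x, r, s)) \<in> borel_measurable St"
    proof -
      have "next_gap i (x, r, s) = max 0 (fst (s (Suc i)))" for s
        by (simp add: next_gap_def gap_def)
      then show ?thesis by simp
    qed
    have Fi: "F (x, r, s(Suc i := a)) = F (x, r, s)" for s a
      using indep [of a "(x, r, s)"] by (simp add: replace_arrival_def)
    have "(\<integral>\<^sup>+s. ennreal (exp (- c * next_gap i (x, r, s))) * F (x, r, s) \<partial>St) =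
       (\<integral>\<^sup>+s. \<integral>\<^sup>+a. ennreal (exp (- c * max 0 (fst a))) * F (x, r, s) \<partial>A \<partial>St)"
      by (subst nn_integral_resample_arrival [where i = "Suc i"]) (simp_all add: Fi, simp add: next_gap_def gap_def)
    also have "\<dots> = (\<integral>\<^sup>+s. (\<integral>\<^sup>+a. ennreal (exp (- c * max 0 (fst a))) \<partial>A) * F (x, r, s) \<partial>St)"
      by (simp add: nn_integral_multc)
    also have "(\<integral>\<^sup>+a. ennreal (exp (- c * max 0 (fst a))) \<partial>A) = (\<integral>\<^sup>+g. ennreal (exp (- c * max 0 g)) \<partial>exponential_measure rate)"
      by (subst mark.nn_integral_fst [symmetric]) (simp_all add: mark.emeasure_space_1)
    also have "\<dots> = (\<integral>\<^sup>+g. ennreal (exp (- c * g)) \<partial>exponential_measure rate)"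
      by (rule nn_integral_cong_AE, rule eventually_mono [OF AE_exponential_measure [OF rate_pos]]) simp
    also have "\<dots> = ennreal (rate / (rate + c))"
      by (rule nn_integral_exponential_exp [OF rate_pos c])
    finally show ?thesis by (simp add: nn_integral_cmult)
  qed
  have [measurable]: "(\<lambda>(x, r). \<integral>\<^sup>+s. F (x, r, s) \<partial>St) \<in> borel_measurable (measure_pmf \<mu> \<Otimes>\<^sub>M residual_measure)"
  proof -
    have [measurable]: "F \<in> borel_measurable (measure_pmf \<mu> \<Otimes>\<^sub>M residual_measure \<Otimes>\<^sub>M St)"
      using F by (simp add: sample_measure_eq)
    show ?thesis by measurable
  qed
  have "(\<integral>\<^sup>+\<omega>. ennreal (exp (- c * next_gap i \<omega>)) * F \<omega> \<partial>sample_M \<mu>) =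
     (\<integral>\<^sup>+x. \<integral>\<^sup>+r. ennreal (rate / (rate + c)) * (\<integral>\<^sup>+s. F (x, r, s) \<partial>St) \<partial>residual_measure \<partial>measure_pmf \<mu>)"
    by (subst nn_integral_sample) (measurable, intro nn_integral_cong pt)
  also have "\<dots> = ennreal (rate / (rate + c)) * (\<integral>\<^sup>+x. \<integral>\<^sup>+r. \<integral>\<^sup>+s. F (x, r, s) \<partial>St \<partial>residual_measure \<partial>measure_pmf \<mu>)"
    by (simp add: nn_integral_cmult)
  also have "\<dots> = ennreal (rate / (rate + c)) * (\<integral>\<^sup>+\<omega>. F \<omega> \<partial>sample_M \<mu>)"
    by (subst nn_integral_sample) simp_all
  finally show ?thesis .
qed

lemma calls_on_replace_arrival:
  assumes "m \<le> i" "\<And>j. Inr j \<in> B \<Longrightarrow> j < i" "p < i"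
  shows "B \<subseteq> calls_on n (replace_arrival i a \<omega>) (routes_upto n D R (replace_arrival i a \<omega>) m) (arrival_time (replace_arrival i a \<omega>) p) u w \<longleftrightarrow>
    B \<subseteq> calls_on n \<omega> (routes_upto n D R \<omega> m) (arrival_time \<omega> p) u w"
proof -
  have "b \<in> calls_on n (replace_arrival i a \<omega>) (routes_upto n D R (replace_arrival i a \<omega>) m) (arrival_time (replace_arrival i a \<omega>) p) u w \<longleftrightarrow>
    b \<in> calls_on n \<omega> (routes_upto n D R \<omega> m) (arrival_time \<omega> p) u w" if "b \<in> B" for b
    unfolding replace_arrival_past(1) [OF order.refl assms(3)] replace_arrival_past(3) [OF assms(1)]
    using assms(2) [of "projr b"] that replace_arrival_past(2) [OF order.refl, of _ i]
    by (cases b) (auto simp: Inl_calls_on Inr_calls_on)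
  then show ?thesis by (simp add: subset_eq)
qed

text \<open>During a gap \<open>g\<close> the calls of \<open>B\<close> all survive with probability
  \<open>exp (- card B * g)\<close>, and the weight decays by \<open>exp (- \<epsilon> * g)\<close>;
  averaging over \<open>g\<close> gives the factor on the left. To show survival, the calls are
  prolonged by \<open>g\<close>: this puts \<open>B\<close> on the link at the next arrival, and
  \<open>prolong_many\<close> accounts for the change of measure.\<close>

lemma survival_step:
  fixes \<epsilon> :: real
  assumes \<mu>: "set_pmf \<mu> \<subseteq> states n D" and B: "finite B" "\<And>j. Inr j \<in> B \<Longrightarrow> j \<le> i" and \<epsilon>: "0 \<le> \<epsilon>"
  defines "r \<equiv> \<lambda>\<omega>. routes_upto n D (fdar n D) \<omega> (Suc i)"
  shows "ennreal (rate / (rate + (card B + \<epsilon>))) *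
      (\<integral>\<^sup>+\<omega>. ennreal (discount \<epsilon> t1 (arrival_time \<omega> i)) * (if B \<subseteq> calls_on n \<omega> (r \<omega>) (arrival_time \<omega> i) u w then 1 else 0) \<partial>sample_M \<mu>)
    \<le> (\<integral>\<^sup>+\<omega>. ennreal (discount \<epsilon> t1 (arrival_time \<omega> (Suc i))) * (if B \<subseteq> calls_on n \<omega> (r \<omega>) (arrival_time \<omega> (Suc i)) u w then 1 else 0) \<partial>sample_M \<mu>)"
    (is "?c * (\<integral>\<^sup>+\<omega>. ?P \<omega> \<partial>_) \<le> (\<integral>\<^sup>+\<omega>. ?F \<omega> \<partial>_)")
proof -
  have [measurable]: "Measurable.pred (sample_M \<mu>) (\<lambda>\<omega>. B \<subseteq> calls_on n \<omega> (r \<omega>) (arrival_time \<omega> i) u w)"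
    "Measurable.pred (sample_M \<mu>) (\<lambda>\<omega>. B \<subseteq> calls_on n \<omega> (r \<omega>) (arrival_time \<omega> (Suc i)) u w)"
    unfolding r_def by (rule measurable_subset_calls_on [OF measurable_arrival_time B(1)])+
  have P [measurable]: "?P \<in> borel_measurable (sample_M \<mu>)" by measurable
  have F [measurable]: "?F \<in> borel_measurable (sample_M \<mu>)" by measurable
  have "?c * (\<integral>\<^sup>+\<omega>. ?P \<omega> \<partial>sample_M \<mu>) = (\<integral>\<^sup>+\<omega>. ennreal (exp (- (card B + \<epsilon>) * next_gap i \<omega>)) * ?P \<omega> \<partial>sample_M \<mu>)"
  proof (rule gap_independent [symmetric, OF P])
    fix \<omega> a
    have "B \<subseteq> calls_on n (replace_arrival (Suc i) a \<omega>) (r (replace_arrival (Suc i) a \<omega>)) (arrival_time (replace_arrival (Suc i) a \<omega>) i) u w \<longleftrightarrow>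
      B \<subseteq> calls_on n \<omega> (r \<omega>) (arrival_time \<omega> i) u w"
      unfolding r_def by (rule calls_on_replace_arrival) (use B(2) in \<open>auto simp: less_Suc_eq_le\<close>)
    moreover have "arrival_time (replace_arrival (Suc i) a \<omega>) i = arrival_time \<omega> i"
      by (rule replace_arrival_past(1) [OF order.refl]) simp
    ultimately show "?P (replace_arrival (Suc i) a \<omega>) = ?P \<omega>" by simp
  qed (use \<epsilon> in simp)
  also have "\<dots> \<le> (\<integral>\<^sup>+\<omega>. ennreal (exp (- (card B * next_gap i \<omega>))) * ?F (prolong w B (next_gap i \<omega>) \<omega>) \<partial>sample_M \<mu>)"
  proof (rule nn_integral_mono_AE)
    show "AE \<omega> in sample_M \<mu>. ennreal (exp (- (card B + \<epsilon>) * next_gap i \<omega>)) * ?P \<omega> \<le>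
        ennreal (exp (- (card B * next_gap i \<omega>))) * ?F (prolong w B (next_gap i \<omega>) \<omega>)"
      using AE_regular [OF \<mu>]
    proof eventually_elim
      case (elim \<omega>)
      let ?g = "next_gap i \<omega>"
      have g: "0 \<le> ?g" by (rule next_gap_nonneg)
      have T: "arrival_time \<omega> (Suc i) = arrival_time \<omega> i + ?g"
        using elim by (simp add: arrival_time_def next_gap_def regular_def max_def less_imp_le)
      show ?case
      proof (cases "B \<subseteq> calls_on n \<omega> (r \<omega>) (arrival_time \<omega> i) u w")
        case True
        have "B \<subseteq> calls_on n (prolong w B ?g \<omega>) (r (prolong w B ?g \<omega>)) (arrival_time \<omega> i + ?g) u w"
          unfolding r_def by (rule calls_on_prolong [OF elim g True [unfolded r_def]])
        then have "?F (prolong w B ?g \<omega>) = ennreal (discount \<epsilon> t1 (arrival_time \<omega> i + ?g))"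
          by (simp add: T)
        moreover have "exp (- (card B + \<epsilon>) * ?g) * discount \<epsilon> t1 (arrival_time \<omega> i) \<le>
           exp (- (card B * ?g)) * discount \<epsilon> t1 (arrival_time \<omega> i + ?g)"
        proof -
          have "exp (- (card B + \<epsilon>) * ?g) * discount \<epsilon> t1 (arrival_time \<omega> i) =
             exp (- (card B * ?g)) * (exp (- \<epsilon> * ?g) * discount \<epsilon> t1 (arrival_time \<omega> i))"
            by (simp add: algebra_simps flip: exp_add mult.assoc)
          also have "\<dots> \<le> exp (- (card B * ?g)) * discount \<epsilon> t1 (arrival_time \<omega> i + ?g)"
            by (intro mult_left_mono discount_add g) simp
          finally show ?thesis .
        qed
        then have "ennreal (exp (- (card B + \<epsilon>) * ?g)) * ennreal (discount \<epsilon> t1 (arrival_time \<omega> i)) \<le>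
           ennreal (exp (- (card B * ?g))) * ennreal (discount \<epsilon> t1 (arrival_time \<omega> i + ?g))"
          by (subst (1 2) ennreal_mult [symmetric]) (auto intro: ennreal_leI discount_nonneg)
        ultimately show ?thesis using True by simp
      qed simp
    qed
  qed
  also have "\<dots> \<le> (\<integral>\<^sup>+\<omega>. ?F \<omega> \<partial>sample_M \<mu>)"
    by (rule prolong_many [OF B F, THEN conjunct2])
  finally show ?thesis .
qed

end


section \<open>Binomial moments of the link loads under FDAR\<close>

definition links :: "nat \<Rightarrow> (nat \<times> nat) set" where
  "links n = {(u, w). u \<in> nodes n \<and> w \<in> nodes n \<and> w \<noteq> u}"

lemma finite_links [simp]: "finite (links n)"
  by (rule finite_subset [of _ "nodes n \<times> nodes n"]) (auto simp: links_def)

lemma links_Sigma: "links n = (SIGMA u:nodes n. nodes n - {u})"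
  by (auto simp: links_def)

lemma card_links: "card (links n) = n * (n - 1)"
  unfolding links_Sigma by (subst card_SigmaI) auto

context network
begin

definition load_seen :: "nat \<Rightarrow> nat \<Rightarrow> sample \<Rightarrow> nat \<times> nat \<Rightarrow> nat" where
  "load_seen D i \<omega> l = link_load n (seen n D (fdar n D) \<omega> i) (fst l) (snd l)"

lemma measurable_load_seen [measurable]: "(\<lambda>\<omega>. load_seen D i \<omega> l) \<in> sample_M \<mu> \<rightarrow>\<^sub>M count_space UNIV"
  unfolding load_seen_def by (rule measurable_link_load_seen)

lemma measurable_load_seen_fun [measurable]:
  "(\<lambda>\<omega>. f (load_seen D i \<omega> l) :: ennreal) \<in> borel_measurable (sample_M \<mu>)"
  by (rule measurable_compose [OF measurable_load_seen]) simp

lemma load_seen_le: "regular n d D \<omega> \<Longrightarrow> l \<in> links n \<Longrightarrow> load_seen D i \<omega> l \<le> D"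
  using seen_in_states [OF gdar_rule_fdar, of n d D \<omega> i]
  by (auto simp: load_seen_def states_def links_def)

lemma AE_duration_pos: "AE \<omega> in sample_M \<mu>. \<forall>i. 0 < duration \<omega> i"
proof -
  have "AE z in mark_measure n d. 0 < fst z"
    unfolding mark_measure_def
    by (intro AE_pair_fst AE_exponential_measure prob_space_pair prob_space_uniform_unit prob_space_measure_pmf) simp
  from AE_pair_snd [OF mark.sigma_finite_measure_axioms this]
  have "AE z in A. 0 < fst (snd z)" .
  then have "AE s in St. 0 < fst (snd (s i))" for i
    by (intro AE_PiM_component) (simp_all add: arr.prob_space_axioms)
  then have "AE s in St. \<forall>i. 0 < fst (snd (s i))"
    by (simp add: AE_all_countable)
  then have "AE \<omega> in sample_M \<mu>. \<forall>i. 0 < fst (snd (snd (snd \<omega>) i))"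
    unfolding sample_measure_eq
    by (rule AE_pair_snd [OF prob_space_imp_sigma_finite [OF tail.prob_space_axioms]
      AE_pair_snd [OF prob_space_imp_sigma_finite [OF stream.P.prob_space_axioms]]])
  then show ?thesis by (simp add: duration_def)
qed

text \<open>The gap of arrival \<open>i\<close> is retained, so that \<open>F\<close> may depend on
  the time of arrival \<open>i\<close> and on the loads seen then.\<close>

lemma call_independent:
  assumes F: "F \<in> borel_measurable (sample_M \<mu>)"
    and indep: "\<And>\<omega> a. fst a = gap \<omega> i \<Longrightarrow> F (replace_arrival i a \<omega>) = F \<omega>"
  shows "(\<integral>\<^sup>+\<omega>. F \<omega> * G (call \<omega> i, selected \<omega> i) \<partial>sample_M \<mu>) = (\<integral>\<^sup>+\<omega>. F \<omega> \<partial>sample_M \<mu>) * (\<integral>\<^sup>+c. G c \<partial>call_pmf n d)"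
proof -
  have Gm [measurable]: "(\<lambda>\<omega>. G (call \<omega> i, selected \<omega> i)) \<in> borel_measurable (sample_M \<mu>)"
    by (rule measurable_compose [OF measurable_coordinates(7)]) simp
  note [measurable] = F
  have pt: "(\<integral>\<^sup>+s. F (x, r, s) * G (snd (snd (snd (s i)))) \<partial>St) = (\<integral>\<^sup>+s. F (x, r, s) \<partial>St) * (\<integral>\<^sup>+c. G c \<partial>call_pmf n d)"
    if r: "r \<in> space residual_measure" for x r
  proof (rule stream_call_independent)
    have "F \<in> borel_measurable (measure_pmf \<mu> \<Otimes>\<^sub>M residual_measure \<Otimes>\<^sub>M St)"
      using F by (simp add: sample_measure_eq)
    then show "(\<lambda>s. F (x, r, s)) \<in> borel_measurable St" using r by measurable
    have "F (x, r, s(i := (g, m))) = F (x, r, s(i := (g, m')))" for s g m m'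
      using indep [of "(g, m')" "(x, r, s(i := (g, m)))"] by (simp add: replace_arrival_def gap_def)
    then show "F (x, r, s(i := (g, x', y, c))) = F (x, r, s(i := (g, x', y, c')))" for s g x' y c c'
      by blast
  qed
  have m: "(\<lambda>x. \<integral>\<^sup>+s. F (fst x, snd x, s) \<partial>St) \<in> borel_measurable (measure_pmf \<mu> \<Otimes>\<^sub>M residual_measure)"
  proof -
    have [measurable]: "F \<in> borel_measurable (measure_pmf \<mu> \<Otimes>\<^sub>M residual_measure \<Otimes>\<^sub>M St)"
      using F by (simp add: sample_measure_eq)
    show ?thesis by measurable
  qed
  have m': "(\<lambda>r. \<integral>\<^sup>+s. F (x, r, s) \<partial>St) \<in> borel_measurable residual_measure" for x
    using measurable_compose [OF measurable_Pair1' m, of x] by simp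
  have "(\<integral>\<^sup>+\<omega>. F \<omega> * G (call \<omega> i, selected \<omega> i) \<partial>sample_M \<mu>) =
     (\<integral>\<^sup>+x. \<integral>\<^sup>+r. \<integral>\<^sup>+s. F (x, r, s) * G (snd (snd (snd (s i)))) \<partial>St \<partial>residual_measure \<partial>measure_pmf \<mu>)"
    by (subst nn_integral_sample, measurable) (simp add: call_def selected_def)
  also have "\<dots> = (\<integral>\<^sup>+x. \<integral>\<^sup>+r. (\<integral>\<^sup>+s. F (x, r, s) \<partial>St) * (\<integral>\<^sup>+c. G c \<partial>call_pmf n d) \<partial>residual_measure \<partial>measure_pmf \<mu>)"
    by (intro nn_integral_cong pt)
  also have "\<dots> = (\<integral>\<^sup>+x. \<integral>\<^sup>+r. \<integral>\<^sup>+s. F (x, r, s) \<partial>St \<partial>residual_measure \<partial>measure_pmf \<mu>) * (\<integral>\<^sup>+c. G c \<partial>call_pmf n d)"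
    by (simp add: nn_integral_multc m')
  also have "(\<integral>\<^sup>+x. \<integral>\<^sup>+r. \<integral>\<^sup>+s. F (x, r, s) \<partial>St \<partial>residual_measure \<partial>measure_pmf \<mu>) = (\<integral>\<^sup>+\<omega>. F \<omega> \<partial>sample_M \<mu>)"
    by (rule nn_integral_sample [OF F, symmetric])
  finally show ?thesis .
qed

lemma call_pmf_first_candidate:
  assumes e: "e \<in> edges n" and w: "w \<in> nodes n - e" and d: "1 \<le> d"
  shows "(\<integral>\<^sup>+c. indicator {c. fst c = e \<and> hd (snd c) = w} c \<partial>call_pmf n d) = ennreal (1 / (real (n choose 2) * real (n - 2)))"
proof -
  obtain d' where d': "d = Suc d'" using d by (cases d) auto
  have inner: "(\<integral>\<^sup>+ws. indicator {c. fst c = e \<and> hd (snd c) = w} (e', ws) \<partial>replicate_pmf d (pmf_of_set (nodes n - e'))) =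
      (if e' = e then ennreal (1 / real (n - 2)) else 0)" if e': "e' \<in> edges n" for e'
  proof (cases "e' = e")
    case True
    have "(\<integral>\<^sup>+ws. indicator {c. fst c = e \<and> hd (snd c) = w} (e', ws) \<partial>replicate_pmf d (pmf_of_set (nodes n - e'))) =
       (\<integral>\<^sup>+x. indicator {w} x \<partial>pmf_of_set (nodes n - e))"
      by (simp add: d' True indicator_def measure_pmf.emeasure_space_1)
    also have "\<dots> = ennreal (1 / real (n - 2))"
      using w nodes_minus_ne [OF e] card_nodes_minus [OF e]
      by (simp add: emeasure_pmf_of_set)
    finally show ?thesis using True by simp
  next
    case False
    then show ?thesis by (simp add: indicator_def)
  qed
  have "(\<integral>\<^sup>+c. indicator {c. fst c = e \<and> hd (snd c) = w} c \<partial>call_pmf n d) =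
     (\<integral>\<^sup>+e'. \<integral>\<^sup>+ws. indicator {c. fst c = e \<and> hd (snd c) = w} (e', ws) \<partial>replicate_pmf d (pmf_of_set (nodes n - e')) \<partial>pmf_of_set (edges n))"
    by (simp add: call_pmf_def)
  also have "\<dots> = (\<Sum>e'\<in>edges n. if e' = e then ennreal (1 / real (n - 2)) else 0) / card (edges n)"
    using edges_ne by (subst nn_integral_pmf_of_set) (simp_all add: inner cong: sum.cong)
  also have "\<dots> = ennreal (1 / real (n - 2)) / ennreal (real (n choose 2))"
    using e by (simp add: card_edges ennreal_of_nat_eq_real_of_nat)
  also have "\<dots> = ennreal (1 / (real (n choose 2) * real (n - 2)))"
    using choose_pos by (simp add: divide_ennreal mult.commute)
  finally show ?thesis .
qed

text \<open>Just after arrival \<open>i\<close> the load is \<open>L\<close> or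
  \<open>L + 1\<close>, and Pascal's rule splits its binomial coefficient into the two integrals on
  the left. Each set of \<open>Suc k\<close> calls then survives to the next arrival by
  \<open>survival_step\<close>.\<close>

lemma link_step:
  fixes \<epsilon> :: real
  assumes \<mu>: "set_pmf \<mu> \<subseteq> states n D" and \<epsilon>: "0 \<le> \<epsilon>" and uw: "(u, w) \<in> links n"
  shows "ennreal (rate / (rate + (real (Suc k) + \<epsilon>))) *
     ((\<integral>\<^sup>+\<omega>. ennreal (discount \<epsilon> t1 (arrival_time \<omega> i)) * of_nat (load_seen D i \<omega> (u, w) choose Suc k) \<partial>sample_M \<mu>) +
      (\<integral>\<^sup>+\<omega>. ennreal (discount \<epsilon> t1 (arrival_time \<omega> i)) *
         (of_nat (load_seen D i \<omega> (u, w) choose k) *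
          (if route n D (fdar n D) \<omega> i = Some w \<and> call \<omega> i \<in> incident n u w then 1 else 0)) \<partial>sample_M \<mu>)) \<le>
     (\<integral>\<^sup>+\<omega>. ennreal (discount \<epsilon> t1 (arrival_time \<omega> (Suc i))) * of_nat (load_seen D (Suc i) \<omega> (u, w) choose Suc k) \<partial>sample_M \<mu>)"
proof -
  let ?R = "fdar n D" and ?M = "sample_M \<mu>"
  let ?r = "\<lambda>\<omega>. routes_upto n D ?R \<omega> (Suc i)"
  let ?\<psi> = "\<lambda>j \<omega>. ennreal (discount \<epsilon> t1 (arrival_time \<omega> j))"
  let ?c = "ennreal (rate / (rate + (real (Suc k) + \<epsilon>)))"
  define Bs where "Bs = {B. B \<subseteq> (edges n \<times> {..<D}) <+> {..<Suc i} \<and> card B = Suc k}"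
  have finU: "finite ((edges n \<times> {..<D}) <+> {..<Suc i})" by (simp add: finite_Plus)
  have finB: "finite B" "\<And>j. Inr j \<in> B \<Longrightarrow> j \<le> i" "card B = Suc k" if "B \<in> Bs" for B
    using that finU by (auto simp: Bs_def intro: finite_subset)
  have u: "u \<in> nodes n" "w \<in> nodes n" "w \<noteq> u" using uw by (auto simp: links_def)
  have [measurable]: "Measurable.pred ?M (\<lambda>\<omega>. route n D ?R \<omega> i = Some w)"
    by (rule measurable_compose [OF measurable_fdar_route, where g = "\<lambda>r. r = Some w"]) simp
  have subs [measurable]: "Measurable.pred ?M (\<lambda>\<omega>. B \<subseteq> calls_on n \<omega> (?r \<omega>) (arrival_time \<omega> j) u w)" if "B \<in> Bs" for B j
    by (rule measurable_subset_calls_on [OF measurable_arrival_time finB(1) [OF that]])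
  have expand: "AE \<omega> in ?M. of_nat (link_load n (load_at n \<omega> (?r \<omega>) (arrival_time \<omega> j)) u w choose Suc k) =
     (\<Sum>B\<in>Bs. if B \<subseteq> calls_on n \<omega> (?r \<omega>) (arrival_time \<omega> j) u w then 1 else 0 :: ennreal)" for j
    using AE_regular [OF \<mu>]
  proof eventually_elim
    case (elim \<omega>)
    show ?case
      unfolding binomial_link_load [OF elim u] Bs_def
      by (simp only: of_nat_sum if_distrib of_nat_0 of_nat_1)
  qed
  have "?c * ((\<integral>\<^sup>+\<omega>. ?\<psi> i \<omega> * of_nat (load_seen D i \<omega> (u, w) choose Suc k) \<partial>?M) +
      (\<integral>\<^sup>+\<omega>. ?\<psi> i \<omega> * (of_nat (load_seen D i \<omega> (u, w) choose k) *
          (if route n D ?R \<omega> i = Some w \<and> call \<omega> i \<in> incident n u w then 1 else 0)) \<partial>?M)) =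
     ?c * (\<integral>\<^sup>+\<omega>. ?\<psi> i \<omega> * of_nat (load_seen D i \<omega> (u, w) choose Suc k) + ?\<psi> i \<omega> * (of_nat (load_seen D i \<omega> (u, w) choose k) *
          (if route n D ?R \<omega> i = Some w \<and> call \<omega> i \<in> incident n u w then 1 else 0)) \<partial>?M)"
    by (subst nn_integral_add) simp_all
  also have "(\<integral>\<^sup>+\<omega>. ?\<psi> i \<omega> * of_nat (load_seen D i \<omega> (u, w) choose Suc k) + ?\<psi> i \<omega> * (of_nat (load_seen D i \<omega> (u, w) choose k) *
          (if route n D ?R \<omega> i = Some w \<and> call \<omega> i \<in> incident n u w then 1 else 0)) \<partial>?M) =
      (\<integral>\<^sup>+\<omega>. (\<Sum>B\<in>Bs. ?\<psi> i \<omega> * (if B \<subseteq> calls_on n \<omega> (?r \<omega>) (arrival_time \<omega> i) u w then 1 else 0)) \<partial>?M)"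
  proof (rule nn_integral_cong_AE)
    show "AE \<omega> in ?M. ?\<psi> i \<omega> * of_nat (load_seen D i \<omega> (u, w) choose Suc k) + ?\<psi> i \<omega> * (of_nat (load_seen D i \<omega> (u, w) choose k) *
          (if route n D ?R \<omega> i = Some w \<and> call \<omega> i \<in> incident n u w then 1 else 0)) =
        (\<Sum>B\<in>Bs. ?\<psi> i \<omega> * (if B \<subseteq> calls_on n \<omega> (?r \<omega>) (arrival_time \<omega> i) u w then 1 else 0))"
      using AE_regular [OF \<mu>] AE_duration_pos expand [of i]
    proof eventually_elim
      case (elim \<omega>)
      let ?T = "arrival_time \<omega> i"
      have "link_load n (load_at n \<omega> (?r \<omega>) ?T) u w = card (calls_on n \<omega> (?r \<omega>) ?T u w)"
        by (rule card_calls_on [symmetric]) (use u finite_routes_upto in blast)+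
      also have "\<dots> = load_seen D i \<omega> (u, w) + (if route n D ?R \<omega> i = Some w \<and> call \<omega> i \<in> incident n u w then 1 else 0)"
      proof -
        have "card (calls_on n \<omega> (routes_upto n D ?R \<omega> i) ?T u w) = load_seen D i \<omega> (u, w)"
          unfolding load_seen_def seen_def fst_conv snd_conv
          by (rule card_calls_on) (use u finite_routes_upto in blast)+
        moreover have "finite (calls_on n \<omega> (routes_upto n D ?R \<omega> i) ?T u w)"
          by (rule finite_calls_on [OF finite_routes_upto])
        moreover have "0 < duration \<omega> i" using elim(2) by blast
        ultimately show ?thesis
          using Inr_notin_calls_on by (simp add: calls_on_next [OF elim(1)] del: routes_upto.simps)
      qed
      finally have load: "link_load n (load_at n \<omega> (?r \<omega>) ?T) u w =
        load_seen D i \<omega> (u, w) + (if route n D ?R \<omega> i = Some w \<and> call \<omega> i \<in> incident n u w then 1 else 0)" .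
      show ?case
        unfolding sum_distrib_left [symmetric] elim(3) [symmetric] load
        by (simp add: distrib_left add.commute)
    qed
  qed
  also have "\<dots> = (\<Sum>B\<in>Bs. \<integral>\<^sup>+\<omega>. ?\<psi> i \<omega> * (if B \<subseteq> calls_on n \<omega> (?r \<omega>) (arrival_time \<omega> i) u w then 1 else 0) \<partial>?M)"
    by (rule nn_integral_sum) (use subs in measurable)
  also have "?c * \<dots> = (\<Sum>B\<in>Bs. ?c * (\<integral>\<^sup>+\<omega>. ?\<psi> i \<omega> * (if B \<subseteq> calls_on n \<omega> (?r \<omega>) (arrival_time \<omega> i) u w then 1 else 0) \<partial>?M))"
    by (rule sum_distrib_left)
  also have "\<dots> \<le> (\<Sum>B\<in>Bs. \<integral>\<^sup>+\<omega>. ?\<psi> (Suc i) \<omega> * (if B \<subseteq> calls_on n \<omega> (?r \<omega>) (arrival_time \<omega> (Suc i)) u w then 1 else 0) \<partial>?M)"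
  proof (rule sum_mono)
    fix B assume B: "B \<in> Bs"
    show "?c * (\<integral>\<^sup>+\<omega>. ?\<psi> i \<omega> * (if B \<subseteq> calls_on n \<omega> (?r \<omega>) (arrival_time \<omega> i) u w then 1 else 0) \<partial>?M) \<le>
      (\<integral>\<^sup>+\<omega>. ?\<psi> (Suc i) \<omega> * (if B \<subseteq> calls_on n \<omega> (?r \<omega>) (arrival_time \<omega> (Suc i)) u w then 1 else 0) \<partial>?M)"
      using survival_step [OF \<mu> finB(1) [OF B] finB(2) [OF B] \<epsilon>, where u = u and w = w and ?t1.0 = t1]
      unfolding finB(3) [OF B] .
  qed
  also have "\<dots> = (\<integral>\<^sup>+\<omega>. (\<Sum>B\<in>Bs. ?\<psi> (Suc i) \<omega> * (if B \<subseteq> calls_on n \<omega> (?r \<omega>) (arrival_time \<omega> (Suc i)) u w then 1 else 0)) \<partial>?M)"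
    by (rule nn_integral_sum [symmetric]) (use subs in measurable)
  also have "\<dots> = (\<integral>\<^sup>+\<omega>. ?\<psi> (Suc i) \<omega> * of_nat (load_seen D (Suc i) \<omega> (u, w) choose Suc k) \<partial>?M)"
  proof (rule nn_integral_cong_AE)
    show "AE \<omega> in ?M. (\<Sum>B\<in>Bs. ?\<psi> (Suc i) \<omega> * (if B \<subseteq> calls_on n \<omega> (?r \<omega>) (arrival_time \<omega> (Suc i)) u w then 1 else 0)) =
        ?\<psi> (Suc i) \<omega> * of_nat (load_seen D (Suc i) \<omega> (u, w) choose Suc k)"
      using expand [of "Suc i"]
      by eventually_elim (simp only: sum_distrib_left [symmetric] load_seen_def seen_def fst_conv snd_conv)
  qed
  finally show ?thesis .
qed

text \<open>First-fit enters here: a call between \<open>u\<close> and \<open>v\<close> whose first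
  candidate is \<open>w\<close> is certainly routed via \<open>w\<close> if both links are free. A
  given pair of call and first candidate has the probability on the left, independently of the
  loads. Acceptances onto later candidates are discarded.\<close>

lemma acceptance_bound:
  fixes \<epsilon> :: real
  assumes \<mu>: "set_pmf \<mu> \<subseteq> states n D" and uw: "(u, w) \<in> links n" and d: "1 \<le> d"
  shows "ennreal (1 / (real (n choose 2) * real (n - 2))) *
     (\<Sum>v\<in>nodes n - {u, w}. \<integral>\<^sup>+\<omega>. ennreal (discount \<epsilon> t1 (arrival_time \<omega> i)) * (of_nat (load_seen D i \<omega> (u, w) choose k) *
        (if load_seen D i \<omega> (u, w) \<noteq> D \<and> load_seen D i \<omega> (v, w) \<noteq> D then 1 else 0)) \<partial>sample_M \<mu>) \<le>
     (\<integral>\<^sup>+\<omega>. ennreal (discount \<epsilon> t1 (arrival_time \<omega> i)) *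
         (of_nat (load_seen D i \<omega> (u, w) choose k) *
          (if route n D (fdar n D) \<omega> i = Some w \<and> call \<omega> i \<in> incident n u w then 1 else 0)) \<partial>sample_M \<mu>)"
    (is "?b * (\<Sum>v\<in>?V. \<integral>\<^sup>+\<omega>. ?F v \<omega> \<partial>_) \<le> _")
proof -
  let ?M = "sample_M \<mu>"
  let ?G = "\<lambda>v. indicator {c. fst c = {u, v} \<and> hd (snd c) = w} :: nat set \<times> nat list \<Rightarrow> ennreal"
  have u: "u \<in> nodes n" "w \<in> nodes n" "w \<noteq> u" using uw by (auto simp: links_def)
  have Fm [measurable]: "?F v \<in> borel_measurable ?M" for v
    by measurable
  have Gm [measurable]: "(\<lambda>\<omega>. ?G v (call \<omega> i, selected \<omega> i)) \<in> borel_measurable ?M" for v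
    by (rule measurable_compose [OF measurable_coordinates(7)]) simp
  have "?b * (\<Sum>v\<in>?V. \<integral>\<^sup>+\<omega>. ?F v \<omega> \<partial>?M) = (\<Sum>v\<in>?V. \<integral>\<^sup>+\<omega>. ?F v \<omega> * ?G v (call \<omega> i, selected \<omega> i) \<partial>?M)"
    unfolding sum_distrib_left
  proof (rule sum.cong)
    fix v assume v: "v \<in> ?V"
    have e: "{u, v} \<in> edges n" "w \<in> nodes n - {u, v}" using u v by (auto simp: edges_def card_insert_if)
    have "(\<integral>\<^sup>+\<omega>. ?F v \<omega> * ?G v (call \<omega> i, selected \<omega> i) \<partial>?M) = (\<integral>\<^sup>+\<omega>. ?F v \<omega> \<partial>?M) * (\<integral>\<^sup>+c. ?G v c \<partial>call_pmf n d)"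
      by (rule call_independent [OF Fm]) (simp add: load_seen_def seen_replace_arrival)
    then show "?b * (\<integral>\<^sup>+\<omega>. ?F v \<omega> \<partial>?M) = (\<integral>\<^sup>+\<omega>. ?F v \<omega> * ?G v (call \<omega> i, selected \<omega> i) \<partial>?M)"
      unfolding call_pmf_first_candidate [OF e d] by (simp only: mult.commute)
  qed simp
  also have "\<dots> = (\<integral>\<^sup>+\<omega>. (\<Sum>v\<in>?V. ?F v \<omega> * ?G v (call \<omega> i, selected \<omega> i)) \<partial>?M)"
    by (rule nn_integral_sum [symmetric]) measurable
  also have "\<dots> \<le> (\<integral>\<^sup>+\<omega>. ennreal (discount \<epsilon> t1 (arrival_time \<omega> i)) *
         (of_nat (load_seen D i \<omega> (u, w) choose k) *
          (if route n D (fdar n D) \<omega> i = Some w \<and> call \<omega> i \<in> incident n u w then 1 else 0)) \<partial>?M)"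
  proof (rule nn_integral_mono_AE)
    show "AE \<omega> in ?M. (\<Sum>v\<in>?V. ?F v \<omega> * ?G v (call \<omega> i, selected \<omega> i)) \<le> ennreal (discount \<epsilon> t1 (arrival_time \<omega> i)) *
         (of_nat (load_seen D i \<omega> (u, w) choose k) *
          (if route n D (fdar n D) \<omega> i = Some w \<and> call \<omega> i \<in> incident n u w then 1 else 0))"
      using AE_regular [OF \<mu>]
    proof eventually_elim
      case (elim \<omega>)
      let ?a = "ennreal (discount \<epsilon> t1 (arrival_time \<omega> i)) * of_nat (load_seen D i \<omega> (u, w) choose k)"
      let ?acc = "route n D (fdar n D) \<omega> i = Some w \<and> call \<omega> i \<in> incident n u w"
      let ?P = "\<lambda>v. load_seen D i \<omega> (u, w) \<noteq> D \<and> load_seen D i \<omega> (v, w) \<noteq> D \<and> call \<omega> i = {u, v} \<and> hd (selected \<omega> i) = w"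
      have acc: ?acc if v: "v \<in> ?V" and P: "?P v" for v
      proof -
        have e: "call \<omega> i \<in> edges n" "length (selected \<omega> i) = d" using elim by (auto simp: regular_def)
        have "available n D (seen n D (fdar n D) \<omega> i) (call \<omega> i) w"
          using P v u e(1) by (auto simp: available_def saturated_def load_seen_def)
        moreover obtain ws where "selected \<omega> i = w # ws"
          using e(2) d P by (cases "selected \<omega> i") auto
        ultimately show ?thesis
          using P v u e(1) by (simp add: fdar_route incident_def)
      qed
      have eqF: "?F v \<omega> * ?G v (call \<omega> i, selected \<omega> i) = (if ?P v then ?a else 0)" for v
        by (simp add: indicator_def)
      have "?a * (if ?acc then 1 else 0) = (if ?acc then ?a else 0)" by simp
      moreover have "(\<Sum>v\<in>?V. ?F v \<omega> * ?G v (call \<omega> i, selected \<omega> i)) \<le> (if ?acc then ?a else 0)"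
      \<comment> \<open>The call determines \<open>v\<close>, so at most one summand is not
        0.\<close>
      proof (cases "\<exists>v\<in>?V. ?P v")
        case True
        then obtain v where v: "v \<in> ?V" "?P v" by blast
        have "(\<Sum>v'\<in>?V. ?F v' \<omega> * ?G v' (call \<omega> i, selected \<omega> i)) = (\<Sum>v'\<in>?V. if v' = v then ?a else 0)"
          unfolding eqF
        proof (rule sum.cong)
          fix v' assume "v' \<in> ?V"
          have "?P v' \<longleftrightarrow> v' = v" using v by (auto simp: doubleton_eq_iff)
          then show "(if ?P v' then ?a else 0) = (if v' = v then ?a else 0)" by simp
        qed simp
        also have "\<dots> = ?a" using v by simp
        finally show ?thesis using acc [OF v] by simp
      next
        case False
        then have "(\<Sum>v\<in>?V. ?F v \<omega> * ?G v (call \<omega> i, selected \<omega> i)) = 0"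
          unfolding eqF by (intro sum.neutral) auto
        then show ?thesis by (simp only: zero_le)
      qed
      ultimately show ?case by (simp only: mult.assoc)
    qed
  qed
  finally show ?thesis .
qed

end

section \<open>The recursion for the discounted moments\<close>

lemma suminf_Suc_le: "(\<Sum>i. f (Suc i)) \<le> (\<Sum>i. f i)" for f :: "nat \<Rightarrow> ennreal"
proof -
  have "(\<Sum>i<N. f (Suc i)) \<le> (\<Sum>i. f i)" for N
  proof -
    have "(\<Sum>i<N. f (Suc i)) \<le> (\<Sum>i<Suc N. f i)"
      by (subst sum.lessThan_Suc_shift) (simp add: add_increasing)
    also have "\<dots> \<le> (\<Sum>i. f i)"
      by (rule sum_le_suminf) auto
    finally show ?thesis .
  qed
  then show ?thesis unfolding suminf_eq_SUP [of "\<lambda>i. f (Suc i)"] by (rule SUP_least)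
qed

text \<open>Exchanging the two ends \<open>u\<close> and \<open>v\<close> is an involution on
  triples of distinct nodes.\<close>

lemma sum_links_third_node:
  fixes g :: "nat \<times> nat \<Rightarrow> nat"
  shows "(\<Sum>l\<in>links n. \<Sum>v\<in>nodes n - {fst l, snd l}. g (v, snd l)) = (n - 2) * (\<Sum>l\<in>links n. g l)"
proof -
  let ?S = "SIGMA l:links n. nodes n - {fst l, snd l}"
  let ?h = "\<lambda>z :: (nat \<times> nat) \<times> nat. ((snd z, snd (fst z)), fst (fst z))"
  have "(\<Sum>l\<in>links n. \<Sum>v\<in>nodes n - {fst l, snd l}. g (v, snd l)) = (\<Sum>z\<in>?S. g (snd z, snd (fst z)))"
    by (subst sum.Sigma) (auto simp: case_prod_unfold)
  also have "\<dots> = (\<Sum>z\<in>?S. g (fst z))"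
    by (rule sum.reindex_bij_witness [of _ ?h ?h]) (auto simp: links_def)
  also have "\<dots> = (\<Sum>l\<in>links n. \<Sum>v\<in>nodes n - {fst l, snd l}. g l)"
    by (subst sum.Sigma) (auto simp: case_prod_unfold)
  also have "\<dots> = (\<Sum>l\<in>links n. (n - 2) * g l)"
  proof (rule sum.cong)
    fix l assume l: "l \<in> links n"
    have "card (nodes n - {fst l, snd l}) = n - 2"
      using l by (subst card_Diff_subset) (auto simp: links_def)
    then show "(\<Sum>v\<in>nodes n - {fst l, snd l}. g l) = (n - 2) * g l" by simp
  qed simp
  finally show ?thesis by (simp add: sum_distrib_left)
qed

context network
begin

text \<open>On a link with load at most \<open>D\<close>, \<open>f choose D\<close> is the indicator
  of saturation. A pair with a saturated link loses at most \<open>2 ^ D\<close>, the bound for any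
  binomial coefficient. Each saturated link occurs both as the link itself and as its partner, which
  doubles the error.\<close>

lemma unsaturated_pairs_bound:
  fixes f :: "nat \<times> nat \<Rightarrow> nat"
  assumes f: "\<And>l. l \<in> links n \<Longrightarrow> f l \<le> D"
  shows "(n - 2) * (\<Sum>l\<in>links n. f l choose k) \<le>
    (\<Sum>l\<in>links n. \<Sum>v\<in>nodes n - {fst l, snd l}. (f l choose k) * (if f l \<noteq> D \<and> f (v, snd l) \<noteq> D then 1 else 0)) +
    (n - 2) * (2 ^ Suc D * (\<Sum>l\<in>links n. f l choose D))"
proof -
  let ?V = "\<lambda>l. nodes n - {fst l, snd l}"
  have cardV: "card (?V l) = n - 2" if "l \<in> links n" for l
    using that by (subst card_Diff_subset) (auto simp: links_def)
  have pt: "f l choose k \<le> (f l choose k) * (if f l \<noteq> D \<and> f (v, snd l) \<noteq> D then 1 else 0) +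
      (2 ^ D * (f l choose D) + 2 ^ D * (f (v, snd l) choose D))" if l: "l \<in> links n" for l v
  proof -
    have "f l choose k \<le> 2 ^ f l" by (rule binomial_le_pow2)
    also have "\<dots> \<le> 2 ^ D" using f [OF l] by simp
    finally have "f l choose k \<le> 2 ^ D" .
    then show ?thesis by auto
  qed
  have "(n - 2) * (\<Sum>l\<in>links n. f l choose k) = (\<Sum>l\<in>links n. \<Sum>v\<in>?V l. f l choose k)"
    using cardV by (simp add: sum_distrib_left)
  also have "\<dots> \<le> (\<Sum>l\<in>links n. \<Sum>v\<in>?V l. (f l choose k) * (if f l \<noteq> D \<and> f (v, snd l) \<noteq> D then 1 else 0) +
      (2 ^ D * (f l choose D) + 2 ^ D * (f (v, snd l) choose D)))"
    by (intro sum_mono pt)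
  also have "\<dots> = (\<Sum>l\<in>links n. \<Sum>v\<in>?V l. (f l choose k) * (if f l \<noteq> D \<and> f (v, snd l) \<noteq> D then 1 else 0)) +
      ((\<Sum>l\<in>links n. \<Sum>v\<in>?V l. 2 ^ D * (f l choose D)) + (\<Sum>l\<in>links n. \<Sum>v\<in>?V l. 2 ^ D * (f (v, snd l) choose D)))"
    by (simp only: sum.distrib)
  also have "(\<Sum>l\<in>links n. \<Sum>v\<in>?V l. 2 ^ D * (f l choose D)) = (n - 2) * (2 ^ D * (\<Sum>l\<in>links n. f l choose D))"
    using cardV by (simp add: sum_distrib_left)
  also have "(\<Sum>l\<in>links n. \<Sum>v\<in>?V l. 2 ^ D * (f (v, snd l) choose D)) = (n - 2) * (2 ^ D * (\<Sum>l\<in>links n. f l choose D))"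
    by (subst sum_links_third_node) (simp add: sum_distrib_left)
  finally show ?thesis by (simp add: algebra_simps)
qed

lemma nn_integral_arrival_time:
  assumes [measurable]: "f \<in> borel_measurable borel"
  shows "(\<integral>\<^sup>+\<omega>. f (arrival_time \<omega> i) \<partial>sample_M \<mu>) = (\<integral>\<^sup>+s. f (atime s i) \<partial>St)"
proof -
  have "arrival_time \<omega> i = atime (snd (snd \<omega>)) i" for \<omega>
    by (cases \<omega>) (simp add: arrival_time_eq)
  then have "(\<integral>\<^sup>+\<omega>. f (arrival_time \<omega> i) \<partial>sample_M \<mu>) = (\<integral>\<^sup>+\<omega>. 1 * f (atime (snd (snd \<omega>)) i) \<partial>sample_M \<mu>)"
    by simp
  also have "\<dots> = (\<integral>\<^sup>+z. 1 \<partial>(measure_pmf \<mu> \<Otimes>\<^sub>M residual_measure)) * (\<integral>\<^sup>+s. f (atime s i) \<partial>St)"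
    by (rule nn_integral_sample_split [where f = "\<lambda>_. 1" and g = "\<lambda>s. f (atime s i)"]) measurable
  also have "(\<integral>\<^sup>+z. 1 \<partial>(measure_pmf \<mu> \<Otimes>\<^sub>M residual_measure)) = 1"
    using nn_integral_initial [where f = "\<lambda>_. 1" and \<mu> = \<mu>] by (simp add: measure_pmf.emeasure_space_1)
  finally show ?thesis by simp
qed

lemma discount_tail:
  assumes "0 < \<epsilon>" "t1 \<le> t2"
  shows "(\<integral>\<^sup>+t. ennreal (discount \<epsilon> t1 t) * indicator {t2..} t \<partial>lborel) = ennreal (exp (- \<epsilon> * (t2 - t1)) / \<epsilon>)"
proof -
  have "(\<integral>\<^sup>+t. ennreal (discount \<epsilon> t1 t) * indicator {t2..} t \<partial>lborel) =
      (\<integral>\<^sup>+t. ennreal (exp (- \<epsilon> * (t - t1))) * indicator {t2..} t \<partial>lborel)"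
    using assms by (intro nn_integral_cong) (auto simp: discount_def indicator_def)
  also have "\<dots> = ennreal (0 - (- (1 / \<epsilon>) * exp (- \<epsilon> * (t2 - t1))))"
  proof (rule nn_integral_FTC_atLeast)
    show "((\<lambda>t. - (1 / \<epsilon>) * exp (- \<epsilon> * (t - t1))) has_real_derivative exp (- \<epsilon> * (t - t1))) (at t)" for t
      using assms by (auto intro!: derivative_eq_intros)
    show "((\<lambda>t. - (1 / \<epsilon>) * exp (- \<epsilon> * (t - t1))) \<longlongrightarrow> 0) at_top"
      using assms(1) by real_asymp
  qed auto
  finally show ?thesis by simp
qed

text \<open>The discount has total mass \<open>1 / \<epsilon>\<close>, and \<open>0 \<le> t1\<close>
  ensures that none of it falls before time 0.\<close>

lemma total_weight:
  assumes "0 < \<epsilon>" "0 \<le> t1"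
  shows "(\<Sum>i. \<integral>\<^sup>+\<omega>. ennreal (discount \<epsilon> t1 (arrival_time \<omega> i)) \<partial>sample_M \<mu>) = ennreal (rate / \<epsilon>)"
proof -
  have "(\<Sum>i. \<integral>\<^sup>+\<omega>. ennreal (discount \<epsilon> t1 (arrival_time \<omega> i)) \<partial>sample_M \<mu>) =
     (\<Sum>i. \<integral>\<^sup>+s. ennreal (discount \<epsilon> t1 (atime s i)) \<partial>St)"
    by (intro suminf_cong nn_integral_arrival_time) measurable
  also have "\<dots> = ennreal rate * (\<integral>\<^sup>+t. ennreal (discount \<epsilon> t1 t) * indicator {0..} t \<partial>lborel)"
    by (rule suminf_nn_integral_atime) measurable
  also have "(\<integral>\<^sup>+t. ennreal (discount \<epsilon> t1 t) * indicator {0..} t \<partial>lborel) = (\<integral>\<^sup>+t. ennreal (discount \<epsilon> t1 t) * indicator {t1..} t \<partial>lborel)"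
    using assms by (intro nn_integral_cong) (auto simp: discount_def indicator_def)
  also have "\<dots> = ennreal (1 / \<epsilon>)"
    using discount_tail [OF assms(1) order.refl, of t1] by simp
  finally show ?thesis using assms rate_pos by (simp flip: ennreal_mult)
qed

lemma weight_after:
  assumes "0 < \<epsilon>" "0 \<le> t1" "t1 \<le> t2"
  shows "(\<Sum>i. \<integral>\<^sup>+\<omega>. ennreal (discount \<epsilon> t1 (arrival_time \<omega> i)) * indicator {t2..} (arrival_time \<omega> i) \<partial>sample_M \<mu>) =
    ennreal (rate / \<epsilon> * exp (- \<epsilon> * (t2 - t1)))"
proof -
  have "(\<Sum>i. \<integral>\<^sup>+\<omega>. ennreal (discount \<epsilon> t1 (arrival_time \<omega> i)) * indicator {t2..} (arrival_time \<omega> i) \<partial>sample_M \<mu>) =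
     (\<Sum>i. \<integral>\<^sup>+s. ennreal (discount \<epsilon> t1 (atime s i)) * indicator {t2..} (atime s i) \<partial>St)"
    by (intro suminf_cong nn_integral_arrival_time [where f = "\<lambda>t. ennreal (discount \<epsilon> t1 t) * indicator {t2..} t"]) measurable
  also have "\<dots> = ennreal rate * (\<integral>\<^sup>+t. ennreal (discount \<epsilon> t1 t) * indicator {t2..} t * indicator {0..} t \<partial>lborel)"
    by (rule suminf_nn_integral_atime) measurable
  also have "(\<integral>\<^sup>+t. ennreal (discount \<epsilon> t1 t) * indicator {t2..} t * indicator {0..} t \<partial>lborel) = (\<integral>\<^sup>+t. ennreal (discount \<epsilon> t1 t) * indicator {t2..} t \<partial>lborel)"
    using assms by (intro nn_integral_cong) (auto simp: indicator_def)
  also have "\<dots> = ennreal (exp (- \<epsilon> * (t2 - t1)) / \<epsilon>)"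
    by (rule discount_tail [OF assms(1,3)])
  finally show ?thesis using assms rate_pos by (simp flip: ennreal_mult)
qed

definition moment :: "nat \<Rightarrow> load_vector pmf \<Rightarrow> real \<Rightarrow> real \<Rightarrow> nat \<Rightarrow> ennreal" where
  "moment D \<mu> \<epsilon> t1 k = (\<Sum>i. \<Sum>l\<in>links n. \<integral>\<^sup>+\<omega>. ennreal (discount \<epsilon> t1 (arrival_time \<omega> i)) *
     of_nat (load_seen D i \<omega> l choose k) \<partial>sample_M \<mu>)"

lemma moment_0:
  assumes "0 < \<epsilon>" "0 \<le> t1"
  shows "moment D \<mu> \<epsilon> t1 0 = ennreal (real (n * (n - 1)) * (rate / \<epsilon>))"
proof -
  have "moment D \<mu> \<epsilon> t1 0 = (\<Sum>i. of_nat (n * (n - 1)) * (\<integral>\<^sup>+\<omega>. ennreal (discount \<epsilon> t1 (arrival_time \<omega> i)) \<partial>sample_M \<mu>))"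
    by (simp add: moment_def card_links)
  also have "\<dots> = of_nat (n * (n - 1)) * ennreal (rate / \<epsilon>)"
    unfolding ennreal_suminf_cmult total_weight [OF assms] ..
  finally show ?thesis
    using assms rate_pos by (simp only: ennreal_of_nat_eq_real_of_nat ennreal_mult of_nat_0_le_iff zero_le_divide_iff less_imp_le simp_thms)
qed

text \<open>Allows the recursion to be rearranged in the reals.\<close>

lemma moment_finite:
  assumes \<mu>: "set_pmf \<mu> \<subseteq> states n D" and "0 < \<epsilon>" "0 \<le> t1"
  shows "moment D \<mu> \<epsilon> t1 k < \<infinity>"
proof -
  have "moment D \<mu> \<epsilon> t1 k \<le> (\<Sum>i. \<Sum>l\<in>links n. of_nat (2 ^ D) * (\<integral>\<^sup>+\<omega>. ennreal (discount \<epsilon> t1 (arrival_time \<omega> i)) \<partial>sample_M \<mu>))"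
    unfolding moment_def
  proof (intro suminf_le sum_mono)
    fix i l assume l: "l \<in> links n"
    have "(\<integral>\<^sup>+\<omega>. ennreal (discount \<epsilon> t1 (arrival_time \<omega> i)) * of_nat (load_seen D i \<omega> l choose k) \<partial>sample_M \<mu>) \<le>
       (\<integral>\<^sup>+\<omega>. of_nat (2 ^ D) * ennreal (discount \<epsilon> t1 (arrival_time \<omega> i)) \<partial>sample_M \<mu>)"
    proof (rule nn_integral_mono_AE)
      show "AE \<omega> in sample_M \<mu>. ennreal (discount \<epsilon> t1 (arrival_time \<omega> i)) * of_nat (load_seen D i \<omega> l choose k) \<le>
         of_nat (2 ^ D) * ennreal (discount \<epsilon> t1 (arrival_time \<omega> i))"
        using AE_regular [OF \<mu>]
      proof eventually_elim
        case (elim \<omega>)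
        have "load_seen D i \<omega> l choose k \<le> 2 ^ load_seen D i \<omega> l" by (rule binomial_le_pow2)
        also have "\<dots> \<le> 2 ^ D" using load_seen_le [OF elim l] by simp
        finally have "(of_nat (load_seen D i \<omega> l choose k) :: ennreal) \<le> of_nat (2 ^ D)" by (simp only: of_nat_le_iff)
        then show ?case by (subst mult.commute) (rule mult_right_mono, auto)
      qed
    qed
    also have "\<dots> = of_nat (2 ^ D) * (\<integral>\<^sup>+\<omega>. ennreal (discount \<epsilon> t1 (arrival_time \<omega> i)) \<partial>sample_M \<mu>)"
      by (rule nn_integral_cmult) measurable
    finally show "(\<integral>\<^sup>+\<omega>. ennreal (discount \<epsilon> t1 (arrival_time \<omega> i)) * of_nat (load_seen D i \<omega> l choose k) \<partial>sample_M \<mu>) \<le>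
      of_nat (2 ^ D) * (\<integral>\<^sup>+\<omega>. ennreal (discount \<epsilon> t1 (arrival_time \<omega> i)) \<partial>sample_M \<mu>)" .
  qed auto
  also have "\<dots> = of_nat (card (links n)) * (of_nat (2 ^ D) * ennreal (rate / \<epsilon>))"
    by (simp only: sum_constant ennreal_suminf_cmult total_weight [OF assms(2,3)])
  also have "\<dots> < \<infinity>"
    by (simp add: ennreal_mult_less_top of_nat_less_top del: of_nat_power)
  finally show ?thesis .
qed

text \<open>\<open>Y\<close> is the discounted sum over pairs of links \<open>uw\<close>,
  \<open>vw\<close> that are both free. Summing \<open>link_step\<close> and
  \<open>acceptance_bound\<close> over all links and arrivals bounds it from above, and
  \<open>unsaturated_pairs_bound\<close> bounds it from below. The factor
  \<open>rate / ((n choose 2) * (n - 2))\<close> turns the sum over third nodes into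
  \<open>lam\<close>.\<close>

lemma moment_step:
  assumes \<mu>: "set_pmf \<mu> \<subseteq> states n D" and d: "1 \<le> d" and \<epsilon>: "0 < \<epsilon>" and t1: "0 \<le> t1"
  shows "lam * enn2real (moment D \<mu> \<epsilon> t1 k) \<le>
    (real (Suc k) + \<epsilon>) * enn2real (moment D \<mu> \<epsilon> t1 (Suc k)) + lam * 2 ^ Suc D * enn2real (moment D \<mu> \<epsilon> t1 D)"
proof -
  let ?M = "sample_M \<mu>"
  let ?\<psi> = "\<lambda>i \<omega>. ennreal (discount \<epsilon> t1 (arrival_time \<omega> i))"
  let ?m = "moment D \<mu> \<epsilon> t1"
  let ?c = "ennreal (rate / (rate + (real (Suc k) + \<epsilon>)))"
  let ?b = "ennreal (1 / (real (n choose 2) * real (n - 2)))"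
  let ?acc = "\<lambda>i l. \<integral>\<^sup>+\<omega>. ?\<psi> i \<omega> * (of_nat (load_seen D i \<omega> l choose k) *
          (if route n D (fdar n D) \<omega> i = Some (snd l) \<and> call \<omega> i \<in> incident n (fst l) (snd l) then 1 else 0)) \<partial>?M"
  let ?uns = "\<lambda>i l v. \<integral>\<^sup>+\<omega>. ?\<psi> i \<omega> * (of_nat (load_seen D i \<omega> l choose k) *
        (if load_seen D i \<omega> l \<noteq> D \<and> load_seen D i \<omega> (v, snd l) \<noteq> D then 1 else 0)) \<partial>?M"
  define Y where "Y = (\<Sum>i. \<Sum>l\<in>links n. \<Sum>v\<in>nodes n - {fst l, snd l}. ?uns i l v)"
  have "?c * (?m (Suc k) + ?b * Y) = (\<Sum>i. \<Sum>l\<in>links n. ?c * ((\<integral>\<^sup>+\<omega>. ?\<psi> i \<omega> * of_nat (load_seen D i \<omega> l choose Suc k) \<partial>?M) +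
      ?b * (\<Sum>v\<in>nodes n - {fst l, snd l}. ?uns i l v)))"
    unfolding moment_def Y_def
    by (simp only: ennreal_suminf_cmult [symmetric] suminf_add [OF summableI summableI] sum_distrib_left sum.distrib distrib_left)
  also have "\<dots> \<le> (\<Sum>i. \<Sum>l\<in>links n. \<integral>\<^sup>+\<omega>. ?\<psi> (Suc i) \<omega> * of_nat (load_seen D (Suc i) \<omega> l choose Suc k) \<partial>?M)"
  proof (intro suminf_le sum_mono)
    fix i l assume l: "l \<in> links n"
    have l': "(fst l, snd l) \<in> links n" using l by simp
    have "?c * ((\<integral>\<^sup>+\<omega>. ?\<psi> i \<omega> * of_nat (load_seen D i \<omega> l choose Suc k) \<partial>?M) + ?b * (\<Sum>v\<in>nodes n - {fst l, snd l}. ?uns i l v))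
       \<le> ?c * ((\<integral>\<^sup>+\<omega>. ?\<psi> i \<omega> * of_nat (load_seen D i \<omega> l choose Suc k) \<partial>?M) + ?acc i l)"
      using acceptance_bound [OF \<mu> l' d, of \<epsilon> t1 i k] by (intro mult_left_mono add_left_mono) simp_all
    also have "\<dots> \<le> (\<integral>\<^sup>+\<omega>. ?\<psi> (Suc i) \<omega> * of_nat (load_seen D (Suc i) \<omega> l choose Suc k) \<partial>?M)"
      using link_step [OF \<mu> _ l', of \<epsilon> k t1 i] \<epsilon> by simp
    finally show "?c * ((\<integral>\<^sup>+\<omega>. ?\<psi> i \<omega> * of_nat (load_seen D i \<omega> l choose Suc k) \<partial>?M) + ?b * (\<Sum>v\<in>nodes n - {fst l, snd l}. ?uns i l v))
      \<le> (\<integral>\<^sup>+\<omega>. ?\<psi> (Suc i) \<omega> * of_nat (load_seen D (Suc i) \<omega> l choose Suc k) \<partial>?M)" .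
  qed auto
  \<comment> \<open>The shift of the index omits only the first arrival.\<close>
  also have "\<dots> \<le> ?m (Suc k)"
    unfolding moment_def by (rule suminf_Suc_le)
  finally have 1: "?c * (?m (Suc k) + ?b * Y) \<le> ?m (Suc k)" .
  have "of_nat (n - 2) * ?m k \<le> Y + of_nat (n - 2) * (of_nat (2 ^ Suc D) * ?m D)"
  proof -
    have pt: "of_nat (n - 2) * (\<Sum>l\<in>links n. \<integral>\<^sup>+\<omega>. ?\<psi> i \<omega> * of_nat (load_seen D i \<omega> l choose k) \<partial>?M) \<le>
       (\<Sum>l\<in>links n. \<Sum>v\<in>nodes n - {fst l, snd l}. ?uns i l v) +
       of_nat (n - 2) * (of_nat (2 ^ Suc D) * (\<Sum>l\<in>links n. \<integral>\<^sup>+\<omega>. ?\<psi> i \<omega> * of_nat (load_seen D i \<omega> l choose D) \<partial>?M))" for i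
    proof -
      have m: "(\<lambda>\<omega>. ?\<psi> i \<omega> * (of_nat (load_seen D i \<omega> l choose k) *
        (if load_seen D i \<omega> l \<noteq> D \<and> load_seen D i \<omega> (v, snd l) \<noteq> D then 1 else 0))) \<in> borel_measurable ?M" for l v
        by measurable
      have "of_nat (n - 2) * (\<Sum>l\<in>links n. \<integral>\<^sup>+\<omega>. ?\<psi> i \<omega> * of_nat (load_seen D i \<omega> l choose k) \<partial>?M) =
         (\<integral>\<^sup>+\<omega>. of_nat (n - 2) * (\<Sum>l\<in>links n. ?\<psi> i \<omega> * of_nat (load_seen D i \<omega> l choose k)) \<partial>?M)"
        by (subst nn_integral_cmult, measurable) (subst nn_integral_sum, measurable)
      also have "\<dots> \<le> (\<integral>\<^sup>+\<omega>. (\<Sum>l\<in>links n. \<Sum>v\<in>nodes n - {fst l, snd l}. ?\<psi> i \<omega> * (of_nat (load_seen D i \<omega> l choose k) *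
          (if load_seen D i \<omega> l \<noteq> D \<and> load_seen D i \<omega> (v, snd l) \<noteq> D then 1 else 0))) +
         of_nat (n - 2) * (of_nat (2 ^ Suc D) * (\<Sum>l\<in>links n. ?\<psi> i \<omega> * of_nat (load_seen D i \<omega> l choose D))) \<partial>?M)"
      proof (rule nn_integral_mono_AE)
        show "AE \<omega> in ?M. of_nat (n - 2) * (\<Sum>l\<in>links n. ?\<psi> i \<omega> * of_nat (load_seen D i \<omega> l choose k)) \<le>
          (\<Sum>l\<in>links n. \<Sum>v\<in>nodes n - {fst l, snd l}. ?\<psi> i \<omega> * (of_nat (load_seen D i \<omega> l choose k) *
          (if load_seen D i \<omega> l \<noteq> D \<and> load_seen D i \<omega> (v, snd l) \<noteq> D then 1 else 0))) +
         of_nat (n - 2) * (of_nat (2 ^ Suc D) * (\<Sum>l\<in>links n. ?\<psi> i \<omega> * of_nat (load_seen D i \<omega> l choose D)))"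
          using AE_regular [OF \<mu>]
        proof eventually_elim
          case (elim \<omega>)
          let ?f = "load_seen D i \<omega>"
          have "(of_nat ((n - 2) * (\<Sum>l\<in>links n. ?f l choose k)) :: ennreal) \<le>
            of_nat ((\<Sum>l\<in>links n. \<Sum>v\<in>nodes n - {fst l, snd l}. (?f l choose k) * (if ?f l \<noteq> D \<and> ?f (v, snd l) \<noteq> D then 1 else 0)) +
              (n - 2) * (2 ^ Suc D * (\<Sum>l\<in>links n. ?f l choose D)))"
            by (simp only: of_nat_le_iff) (rule unsaturated_pairs_bound [OF load_seen_le [OF elim]])
          then have "?\<psi> i \<omega> * of_nat ((n - 2) * (\<Sum>l\<in>links n. ?f l choose k)) \<le>
            ?\<psi> i \<omega> * of_nat ((\<Sum>l\<in>links n. \<Sum>v\<in>nodes n - {fst l, snd l}. (?f l choose k) * (if ?f l \<noteq> D \<and> ?f (v, snd l) \<noteq> D then 1 else 0)) +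
              (n - 2) * (2 ^ Suc D * (\<Sum>l\<in>links n. ?f l choose D)))"
            by (rule mult_left_mono) simp
          then show ?case
            by (simp only: of_nat_mult of_nat_add of_nat_sum sum_distrib_left distrib_left mult_ac if_distrib [of of_nat] of_nat_0 of_nat_1)
        qed
      qed
      also have "\<dots> = (\<Sum>l\<in>links n. \<Sum>v\<in>nodes n - {fst l, snd l}. ?uns i l v) +
       of_nat (n - 2) * (of_nat (2 ^ Suc D) * (\<Sum>l\<in>links n. \<integral>\<^sup>+\<omega>. ?\<psi> i \<omega> * of_nat (load_seen D i \<omega> l choose D) \<partial>?M))"
        by (simp add: nn_integral_add nn_integral_sum nn_integral_cmult)
      finally show ?thesis .
    qed
    have "of_nat (n - 2) * ?m k = (\<Sum>i. of_nat (n - 2) * (\<Sum>l\<in>links n. \<integral>\<^sup>+\<omega>. ?\<psi> i \<omega> * of_nat (load_seen D i \<omega> l choose k) \<partial>?M))"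
      unfolding moment_def by (rule ennreal_suminf_cmult [symmetric])
    also have "\<dots> \<le> (\<Sum>i. (\<Sum>l\<in>links n. \<Sum>v\<in>nodes n - {fst l, snd l}. ?uns i l v) +
       of_nat (n - 2) * (of_nat (2 ^ Suc D) * (\<Sum>l\<in>links n. \<integral>\<^sup>+\<omega>. ?\<psi> i \<omega> * of_nat (load_seen D i \<omega> l choose D) \<partial>?M)))"
      by (intro suminf_le pt) auto
    also have "\<dots> = Y + of_nat (n - 2) * (of_nat (2 ^ Suc D) * ?m D)"
      unfolding moment_def Y_def
      by (simp only: ennreal_suminf_cmult suminf_add [OF summableI summableI, symmetric])
    finally show ?thesis .
  qed
  note 2 = this
  have fin: "?m j < \<infinity>" for j by (rule moment_finite [OF \<mu> \<epsilon> t1])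
  define a where "a j = enn2real (?m j)" for j
  have a: "?m j = ennreal (a j)" "0 \<le> a j" for j
    using fin [of j] by (auto simp: a_def)
  have r: "0 < rate / (rate + (real (Suc k) + \<epsilon>))" using rate_pos \<epsilon> by (intro divide_pos_pos) auto
  have N: "0 < real (n choose 2)" "0 < real (n - 2)" using choose_pos n by auto
  \<comment> \<open>Otherwise 1 would force the moment of order \<open>Suc k\<close> to be
    infinite.\<close>
  have "Y < \<infinity>"
  proof (rule ccontr)
    assume "\<not> Y < \<infinity>"
    then have "Y = \<infinity>" using less_top [of Y] by auto
    then have "?c * (?m (Suc k) + ?b * Y) = \<infinity>"
      using r N rate_pos \<epsilon> by (simp add: ennreal_mult_top)
    then show False using 1 fin [of "Suc k"] by (simp add: top_unique)
  qed
  then obtain y where y: "Y = ennreal y" "0 \<le> y" by (cases Y) auto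
  have "rate / (rate + (real (Suc k) + \<epsilon>)) * (a (Suc k) + 1 / (real (n choose 2) * real (n - 2)) * y) \<le> a (Suc k)"
    using 1 a y r N by (simp flip: ennreal_mult ennreal_plus del: times_divide_eq_left times_divide_eq_right)
  \<comment> \<open>\<open>r / (r + s) * (x + y) \<le> x\<close> amounts to
    \<open>r * y \<le> s * x\<close>: most of the survival term cancels.\<close>
  then have 3: "rate * (1 / (real (n choose 2) * real (n - 2)) * y) \<le> (real (Suc k) + \<epsilon>) * a (Suc k)"
    using rate_pos \<epsilon> by (simp add: field_simps)
  have "real (n - 2) * a k \<le> y + real (n - 2) * (2 ^ Suc D * a D)"
    using 2 a y by (simp add: ennreal_of_nat_eq_real_of_nat flip: ennreal_mult ennreal_plus ennreal_power ennreal_numeral)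
  then have "a k - 2 ^ Suc D * a D \<le> y / real (n - 2)"
    using N by (simp add: field_simps)
  then have "lam * (a k - 2 ^ Suc D * a D) \<le> lam * (y / real (n - 2))"
    using lam by (intro mult_left_mono) auto
  also have "\<dots> = rate * (1 / (real (n choose 2) * real (n - 2)) * y)"
    using N by (simp add: rate_def)
  also note 3
  finally show ?thesis unfolding a_def by (simp add: algebra_simps)
qed

text \<open>The error term of every step is a multiple of \<open>a D\<close>, the very quantity to
  be bounded. After \<open>D\<close> steps all errors are moved to its side, so no prior estimate of
  the proportion of saturated links is required.\<close>

lemma saturation_lower_bound:
  assumes \<mu>: "set_pmf \<mu> \<subseteq> states n D" and d: "1 \<le> d" and \<epsilon>: "0 < \<epsilon>" "\<epsilon> \<le> 1" and t1: "0 \<le> t1"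
  shows "lam ^ D / (fact (Suc D) * (1 + 2 ^ Suc D * (1 + lam) ^ D)) * (real (n * (n - 1)) * (rate / \<epsilon>)) \<le>
    enn2real (moment D \<mu> \<epsilon> t1 D)"
proof -
  define a where "a k = enn2real (moment D \<mu> \<epsilon> t1 k)" for k
  have a: "0 \<le> a k" for k by (simp add: a_def)
  have step: "lam * a k \<le> real (k + 2) * a (Suc k) + lam * 2 ^ Suc D * a D" for k
  proof -
    \<comment> \<open>Rounding \<epsilon> up to 1 gives the coefficients \<open>k + 2\<close>, with
      product \<open>fact (Suc k)\<close> over the first \<open>k\<close> steps.\<close>
    have "(real (Suc k) + \<epsilon>) * a (Suc k) \<le> real (k + 2) * a (Suc k)"
      using \<epsilon> a by (intro mult_right_mono) auto
    then show ?thesis using moment_step [OF \<mu> d \<epsilon>(1) t1, of k] unfolding a_def by linarith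
  qed
  \<comment> \<open>If \<open>E\<close> is the coefficient of the error after \<open>k\<close>
    steps, the next step needs at most \<open>lam * (1 + E)\<close>. With
    \<open>E = (1 + lam) ^ k - 1\<close> this is \<open>lam * (1 + lam) ^ k\<close>, which stays
    below the next coefficient.\<close>
  have "lam ^ k / fact (Suc k) * a 0 \<le> a k + ((1 + lam) ^ k - 1) * (2 ^ Suc D * a D)" for k
  proof (induction k)
    case (Suc k)
    let ?e = "2 ^ Suc D * a D"
    have e: "0 \<le> ?e" using a by simp
    have "lam ^ Suc k / fact (Suc (Suc k)) * a 0 = lam / real (k + 2) * (lam ^ k / fact (Suc k) * a 0)"
      by simp
    also have "\<dots> \<le> lam / real (k + 2) * (a k + ((1 + lam) ^ k - 1) * ?e)"
      using Suc lam by (intro mult_left_mono) auto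
    also have "\<dots> = (lam * a k) / real (k + 2) + lam / real (k + 2) * (((1 + lam) ^ k - 1) * ?e)"
      by (simp add: distrib_left)
    also have "\<dots> \<le> (real (k + 2) * a (Suc k) + lam * 2 ^ Suc D * a D) / real (k + 2) + lam / real (k + 2) * (((1 + lam) ^ k - 1) * ?e)"
      using step [of k] by (intro add_right_mono divide_right_mono) auto
    also have "\<dots> = a (Suc k) + lam / real (k + 2) * ((1 + lam) ^ k * ?e)"
    proof -
      have "(p * x + lam * y) / p + lam / p * ((q - 1) * y) = x + lam / p * (q * y)" if "0 < p" for p x y q :: real
        using that by (simp add: field_simps)
      from this [of "real (k + 2)" "a (Suc k)" "?e" "(1 + lam) ^ k"] show ?thesis
        by (simp add: mult.assoc)
    qed
    also have "\<dots> \<le> a (Suc k) + lam * ((1 + lam) ^ k * ?e)"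
      using lam e by (intro add_left_mono mult_right_mono) (auto simp: divide_le_eq)
    also have "\<dots> \<le> a (Suc k) + ((1 + lam) ^ Suc k - 1) * ?e"
    proof -
      have "1 \<le> (1 + lam) ^ k" using lam by (intro one_le_power) auto
      then have "lam * (1 + lam) ^ k \<le> (1 + lam) ^ Suc k - 1" by (simp add: algebra_simps)
      from mult_right_mono [OF this e] show ?thesis by (simp add: mult.assoc)
    qed
    finally show ?case .
  qed simp
  from this [of D]
  have "lam ^ D / fact (Suc D) * a 0 \<le> a D + ((1 + lam) ^ D - 1) * (2 ^ Suc D * a D)" .
  also have "\<dots> \<le> a D * (1 + 2 ^ Suc D * (1 + lam) ^ D)"
    using a [of D] by (simp add: algebra_simps)
  finally have main: "lam ^ D / fact (Suc D) * a 0 \<le> a D * (1 + 2 ^ Suc D * (1 + lam) ^ D)" .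
  have a0: "a 0 = real (n * (n - 1)) * (rate / \<epsilon>)"
    unfolding a_def moment_0 [OF \<epsilon>(1) t1] using rate_pos \<epsilon> by simp
  have "0 < 1 + 2 ^ Suc D * (1 + lam) ^ D"
    using lam by (intro add_pos_nonneg) auto
  then have "lam ^ D / fact (Suc D) * a 0 / (1 + 2 ^ Suc D * (1 + lam) ^ D) \<le> a D"
    by (rule pos_divide_le_eq [THEN iffD2, OF _ main])
  then show ?thesis
    unfolding a0 unfolding a_def by (simp only: times_divide_eq_left divide_divide_eq_left)
qed

end


section \<open>Capacities below the threshold\<close>

text \<open>The convex function \<open>q ^ Suc m\<close> lies above its tangent at \<theta>, written
  without subtraction.\<close>

lemma power_tangent_bound:
  fixes q \<theta> :: real
  assumes "0 \<le> q" "0 \<le> \<theta>"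
  shows "real (Suc m) * \<theta> ^ m * q \<le> q ^ Suc m + real m * \<theta> ^ Suc m"
proof (induction m)
  case (Suc m)
  have "q * (real (Suc m) * \<theta> ^ m * q) \<le> q * (q ^ Suc m + real m * \<theta> ^ Suc m)"
    using Suc assms by (intro mult_left_mono) auto
  moreover have "0 \<le> real (Suc m) * \<theta> ^ m * (q - \<theta>) ^ 2"
    using assms by (intro mult_nonneg_nonneg) auto
  ultimately show ?case
    by (simp add: algebra_simps power2_eq_square)
qed simp

lemma two_times_choose_two: "2 * (n choose 2) = n * (n - 1)"
proof -
  have "even (n * (n - 1))" by (cases n) auto
  then show ?thesis by (simp only: choose_two dvd_mult_div_cancel)
qed

lemma card_incident:
  assumes "u \<in> nodes n" "w \<in> nodes n" "w \<noteq> u"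
  shows "card (incident n u w) = n - 2"
proof -
  have "card (nodes n - {u, w}) = n - 2"
    using assms by (subst card_Diff_subset) auto
  then show ?thesis
    using link_load_eq [OF assms(1,3), of "\<lambda>_ _. 1"] by (simp add: link_load_def)
qed

text \<open>The link \<open>uw\<close> belongs to the routes via \<open>w\<close> of exactly
  \<open>n - 2\<close> calls, namely those with end \<open>u\<close> other than the call between
  \<open>u\<close> and \<open>w\<close>.\<close>

lemma sum_edges_links:
  fixes g :: "nat \<times> nat \<Rightarrow> nat"
  shows "(\<Sum>e\<in>edges n. \<Sum>w\<in>nodes n - e. \<Sum>u\<in>e. g (u, w)) = (n - 2) * (\<Sum>l\<in>links n. g l)"
proof -
  have fin: "finite e" if "e \<in> edges n" for e using that by (auto simp: edges_def intro: finite_subset)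
  have "(\<Sum>e\<in>edges n. \<Sum>w\<in>nodes n - e. \<Sum>u\<in>e. g (u, w)) =
      (\<Sum>z\<in>(SIGMA e:edges n. (nodes n - e) \<times> e). g (snd (snd z), fst (snd z)))"
    using fin by (simp add: sum.cartesian_product sum.Sigma case_prod_unfold)
  also have "\<dots> = (\<Sum>z\<in>(SIGMA l:links n. incident n (fst l) (snd l)). g (fst z))"
    by (rule sum.reindex_bij_witness [of _ "\<lambda>z. (snd z, snd (fst z), fst (fst z))" "\<lambda>z. ((snd (snd z), fst (snd z)), fst z)"])
      (auto simp: links_def incident_def edges_def)
  also have "\<dots> = (\<Sum>l\<in>links n. \<Sum>e\<in>incident n (fst l) (snd l). g l)"
    by (subst sum.Sigma) (auto simp: case_prod_unfold)
  also have "\<dots> = (\<Sum>l\<in>links n. (n - 2) * g l)"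
    by (intro sum.cong) (auto simp: links_def card_incident)
  finally show ?thesis by (simp add: sum_distrib_left)
qed

lemma nn_integral_replicate_subset:
  assumes "finite S" "S \<noteq> {}"
  shows "(\<integral>\<^sup>+ws. (if \<forall>w\<in>set ws. P w then 1 else 0) \<partial>replicate_pmf k (pmf_of_set S)) =
    ennreal ((real (card {w \<in> S. P w}) / real (card S)) ^ k)"
proof (induction k)
  case (Suc k)
  have "(\<integral>\<^sup>+ws. (if \<forall>w\<in>set ws. P w then 1 else 0) \<partial>replicate_pmf (Suc k) (pmf_of_set S)) =
     (\<integral>\<^sup>+x. indicator {w. P w} x * (\<integral>\<^sup>+ws. (if \<forall>w\<in>set ws. P w then 1 else 0) \<partial>replicate_pmf k (pmf_of_set S)) \<partial>pmf_of_set S)"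
    by (simp, intro nn_integral_cong) (simp add: indicator_def)
  also have "\<dots> = (\<integral>\<^sup>+x. indicator {w. P w} x \<partial>pmf_of_set S) * ennreal ((real (card {w \<in> S. P w}) / real (card S)) ^ k)"
    unfolding Suc.IH by (subst nn_integral_multc) simp_all
  also have "(\<integral>\<^sup>+x. indicator {w. P w} x \<partial>pmf_of_set S) = ennreal (real (card {w \<in> S. P w}) / real (card S))"
    using assms by (simp add: emeasure_pmf_of_set Int_def)
  finally show ?case by (simp flip: ennreal_mult)
qed simp

context network
begin

lemma unavailable_fraction_bound:
  fixes D :: nat and \<theta> :: real
  assumes d: "1 \<le> d" and \<theta>: "0 \<le> \<theta>" and x: "x \<in> states n D"
  defines "N \<equiv> \<Sum>l\<in>links n. link_load n x (fst l) (snd l) choose D"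
  shows "ennreal (real d * \<theta> ^ (d - 1) * (real N / real (n * (n - 1)))) \<le>
    (\<integral>\<^sup>+c. (if \<forall>w\<in>set (snd c). \<not> available n D x (fst c) w then 1 else 0) \<partial>call_pmf n d) + ennreal (real (d - 1) * \<theta> ^ d)"
proof -
  define q where "q e = real (card {w \<in> nodes n - e. \<not> available n D x e w}) / real (n - 2)" for e
  have q: "0 \<le> q e" for e by (simp add: q_def)
  have N2: "0 < real (n - 2)" "0 < real (n choose 2)" using n choose_pos by auto
  have "(\<integral>\<^sup>+c. (if \<forall>w\<in>set (snd c). \<not> available n D x (fst c) w then 1 else 0) \<partial>call_pmf n d) =
     (\<integral>\<^sup>+e. \<integral>\<^sup>+ws. (if \<forall>w\<in>set ws. \<not> available n D x e w then 1 else 0) \<partial>replicate_pmf d (pmf_of_set (nodes n - e)) \<partial>pmf_of_set (edges n))"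
    by (simp add: call_pmf_def)
  also have "\<dots> = (\<integral>\<^sup>+e. ennreal (q e ^ d) \<partial>pmf_of_set (edges n))"
  proof (rule nn_integral_cong_AE, rule AE_pmfI)
    fix e assume "e \<in> set_pmf (pmf_of_set (edges n))"
    then have e: "e \<in> edges n" using edges_ne by simp
    show "(\<integral>\<^sup>+ws. (if \<forall>w\<in>set ws. \<not> available n D x e w then 1 else 0) \<partial>replicate_pmf d (pmf_of_set (nodes n - e))) = ennreal (q e ^ d)"
      by (subst nn_integral_replicate_subset) (use nodes_minus_ne [OF e] in \<open>auto simp: q_def card_nodes_minus [OF e]\<close>)
  qed
  also have "\<dots> = ennreal ((\<Sum>e\<in>edges n. q e ^ d) / real (n choose 2))"
    using edges_ne q N2 by (subst nn_integral_pmf_of_set)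
      (simp_all add: divide_ennreal ennreal_of_nat_eq_real_of_nat sum_nonneg card_edges)
  finally have int: "(\<integral>\<^sup>+c. (if \<forall>w\<in>set (snd c). \<not> available n D x (fst c) w then 1 else 0) \<partial>call_pmf n d) =
     ennreal ((\<Sum>e\<in>edges n. q e ^ d) / real (n choose 2))" .
  have loads: "link_load n x u w \<le> D" if "u \<in> nodes n" "w \<in> nodes n" "w \<noteq> u" for u w
    using x that by (auto simp: states_def)
  have "(n - 2) * N = (\<Sum>e\<in>edges n. \<Sum>w\<in>nodes n - e. \<Sum>u\<in>e. link_load n x u w choose D)"
    unfolding N_def by (subst sum_edges_links [where g = "\<lambda>l. link_load n x (fst l) (snd l) choose D", symmetric]) simp
  also have "\<dots> \<le> (\<Sum>e\<in>edges n. \<Sum>w\<in>nodes n - e. 2 * (if \<not> available n D x e w then 1 else 0))"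
  proof (intro sum_mono)
    fix e w assume e: "e \<in> edges n" and w: "w \<in> nodes n - e"
    have fe: "finite e" "card e = 2" "e \<subseteq> nodes n" using e by (auto simp: edges_def intro: finite_subset)
    have le: "link_load n x u w \<le> D" if "u \<in> e" for u
      using loads that w fe by auto
    show "(\<Sum>u\<in>e. link_load n x u w choose D) \<le> 2 * (if \<not> available n D x e w then 1 else 0)"
    proof (cases "available n D x e w")
      case True
      then have "link_load n x u w < D" if "u \<in> e" for u
        using le [OF that] that by (auto simp: available_def saturated_def order.order_iff_strict)
      then have "(\<Sum>u\<in>e. link_load n x u w choose D) = 0" by (intro sum.neutral) auto
      then show ?thesis by simp
    next
      case False
      have "link_load n x u w choose D \<le> 1" if "u \<in> e" for u
        using le [OF that] binomial_eq_0 [of "link_load n x u w" D]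
        by (cases "link_load n x u w = D") (auto simp: le_less)
      then have "(\<Sum>u\<in>e. link_load n x u w choose D) \<le> (\<Sum>u\<in>e. 1)" by (rule sum_mono)
      then show ?thesis using False fe by simp
    qed
  qed
  also have "\<dots> = 2 * (\<Sum>e\<in>edges n. card {w \<in> nodes n - e. \<not> available n D x e w})"
  proof -
    have "(\<Sum>w\<in>S. 2 * (if Q w then 1 else 0)) = 2 * card {w \<in> S. Q w}" if "finite S" for S :: "nat set" and Q
    proof -
      have "card {w \<in> S. Q w} = (\<Sum>w\<in>S. if Q w then 1 else 0)"
        using that by (simp only: card_eq_sum sum.inter_filter)
      then show ?thesis by (simp only: sum_distrib_left)
    qed
    then show ?thesis by (simp add: sum_distrib_left)
  qed
  finally have "real ((n - 2) * N) \<le> real (2 * (\<Sum>e\<in>edges n. card {w \<in> nodes n - e. \<not> available n D x e w}))"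
    by (simp only: of_nat_le_iff)
  also have "\<dots> = real (n - 2) * (2 * (\<Sum>e\<in>edges n. q e))"
    using N2 by (simp add: q_def sum_distrib_left)
  finally have "real N \<le> 2 * (\<Sum>e\<in>edges n. q e)"
    using N2 by simp
  then have avg: "real N / real (n * (n - 1)) \<le> (\<Sum>e\<in>edges n. q e) / real (n choose 2)"
    unfolding two_times_choose_two [symmetric] using N2 by (simp add: field_simps)
  obtain m where m: "d = Suc m" using d by (cases d) auto
  have "real d * \<theta> ^ (d - 1) * (real N / real (n * (n - 1))) \<le> real d * \<theta> ^ (d - 1) * ((\<Sum>e\<in>edges n. q e) / real (n choose 2))"
    using avg \<theta> by (intro mult_left_mono) auto
  also have "\<dots> = (\<Sum>e\<in>edges n. real (Suc m) * \<theta> ^ m * q e) / real (n choose 2)"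
    by (simp add: m sum_distrib_left)
  also have "\<dots> \<le> (\<Sum>e\<in>edges n. q e ^ Suc m + real m * \<theta> ^ Suc m) / real (n choose 2)"
    using N2 by (intro divide_right_mono sum_mono power_tangent_bound q \<theta>) auto
  also have "\<dots> = (\<Sum>e\<in>edges n. q e ^ d) / real (n choose 2) + real (d - 1) * \<theta> ^ d"
    using N2 by (simp add: m sum.distrib card_edges add_divide_distrib)
  finally have "ennreal (real d * \<theta> ^ (d - 1) * (real N / real (n * (n - 1)))) \<le>
     ennreal ((\<Sum>e\<in>edges n. q e ^ d) / real (n choose 2) + real (d - 1) * \<theta> ^ d)"
    by (rule ennreal_leI)
  also have "\<dots> = ennreal ((\<Sum>e\<in>edges n. q e ^ d) / real (n choose 2)) + ennreal (real (d - 1) * \<theta> ^ d)"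
    using q \<theta> by (intro ennreal_plus) (auto intro!: divide_nonneg_nonneg sum_nonneg)
  finally show ?thesis unfolding int .
qed

text \<open>The call and its candidates are independent of the loads found on arrival, so the
  fraction of blocked pairs of call and candidates is a conditional probability of loss. The
  remainder of the tangent bound stays on the right.\<close>

lemma lost_weight_lower_bound:
  fixes \<theta> :: real
  assumes \<mu>: "set_pmf \<mu> \<subseteq> states n D" and d: "1 \<le> d" and \<theta>: "0 \<le> \<theta>"
  shows "ennreal (real d * \<theta> ^ (d - 1) / real (n * (n - 1))) *
      (\<Sum>l\<in>links n. \<integral>\<^sup>+\<omega>. ennreal (discount \<epsilon> t1 (arrival_time \<omega> i)) * of_nat (load_seen D i \<omega> l choose D) \<partial>sample_M \<mu>) \<le>
    (\<integral>\<^sup>+\<omega>. ennreal (discount \<epsilon> t1 (arrival_time \<omega> i)) * (if route n D (fdar n D) \<omega> i = None then 1 else 0) \<partial>sample_M \<mu>) +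
    ennreal (real (d - 1) * \<theta> ^ d) * (\<integral>\<^sup>+\<omega>. ennreal (discount \<epsilon> t1 (arrival_time \<omega> i)) \<partial>sample_M \<mu>)"
proof -
  let ?M = "sample_M \<mu>" and ?C = "set_pmf (call_pmf n d)"
  let ?\<psi> = "\<lambda>\<omega>. ennreal (discount \<epsilon> t1 (arrival_time \<omega> i))"
  let ?k = "ennreal (real d * \<theta> ^ (d - 1) / real (n * (n - 1)))" and ?r = "ennreal (real (d - 1) * \<theta> ^ d)"
  define unav where "unav c \<omega> = (if \<forall>w\<in>set (snd c). \<not> available n D (seen n D (fdar n D) \<omega> i) (fst c) w then 1 else 0 :: ennreal)"
    for c :: "nat set \<times> nat list" and \<omega>
  note [measurable] = measurable_fdar_available
  have [measurable]: "unav c \<in> borel_measurable ?M" for c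
    unfolding unav_def [abs_def] by measurable
  have [measurable]: "Measurable.pred ?M (\<lambda>\<omega>. route n D (fdar n D) \<omega> i = None)"
    by (rule measurable_compose [OF measurable_fdar_route, where g = "\<lambda>r. r = None"]) simp
  have Gm: "(\<lambda>\<omega>. indicator {c} (call \<omega> i, selected \<omega> i) :: ennreal) \<in> borel_measurable ?M" for c
    by (rule measurable_compose [OF measurable_coordinates(7)]) simp
  have "?k * (\<Sum>l\<in>links n. \<integral>\<^sup>+\<omega>. ?\<psi> \<omega> * of_nat (load_seen D i \<omega> l choose D) \<partial>?M) =
     (\<integral>\<^sup>+\<omega>. ?k * (\<Sum>l\<in>links n. ?\<psi> \<omega> * of_nat (load_seen D i \<omega> l choose D)) \<partial>?M)"
    by (subst nn_integral_cmult, measurable) (subst nn_integral_sum, measurable)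
  also have "\<dots> \<le> (\<integral>\<^sup>+\<omega>. (\<Sum>c\<in>?C. ?\<psi> \<omega> * unav c \<omega> * ennreal (pmf (call_pmf n d) c)) + ?r * ?\<psi> \<omega> \<partial>?M)"
  proof (rule nn_integral_mono_AE)
    show "AE \<omega> in ?M. ?k * (\<Sum>l\<in>links n. ?\<psi> \<omega> * of_nat (load_seen D i \<omega> l choose D)) \<le>
      (\<Sum>c\<in>?C. ?\<psi> \<omega> * unav c \<omega> * ennreal (pmf (call_pmf n d) c)) + ?r * ?\<psi> \<omega>"
      using AE_regular [OF \<mu>]
    proof eventually_elim
      case (elim \<omega>)
      let ?x = "seen n D (fdar n D) \<omega> i"
      define N where "N = (\<Sum>l\<in>links n. load_seen D i \<omega> l choose D)"
      have x: "?x \<in> states n D" by (rule seen_in_states [OF gdar_rule_fdar elim])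
      have "?k * (\<Sum>l\<in>links n. ?\<psi> \<omega> * of_nat (load_seen D i \<omega> l choose D)) = ?\<psi> \<omega> * (?k * of_nat N)"
        unfolding N_def of_nat_sum sum_distrib_left [symmetric] by (rule mult.left_commute)
      also have "?k * of_nat N = ennreal (real d * \<theta> ^ (d - 1) * (real N / real (n * (n - 1))))"
        using \<theta> by (simp add: ennreal_of_nat_eq_real_of_nat flip: ennreal_mult)
      also have "?\<psi> \<omega> * \<dots> \<le> ?\<psi> \<omega> * ((\<integral>\<^sup>+c. unav c \<omega> \<partial>call_pmf n d) + ?r)"
        using unavailable_fraction_bound [OF d \<theta> x]
        by (intro mult_left_mono) (simp_all add: N_def load_seen_def unav_def)
      also have "(\<integral>\<^sup>+c. unav c \<omega> \<partial>call_pmf n d) = (\<Sum>c\<in>?C. unav c \<omega> * ennreal (pmf (call_pmf n d) c))"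
        by (rule nn_integral_measure_pmf_finite [OF finite_set_call_pmf]) (simp add: unav_def)
      also have "?\<psi> \<omega> * ((\<Sum>c\<in>?C. unav c \<omega> * ennreal (pmf (call_pmf n d) c)) + ?r) =
         (\<Sum>c\<in>?C. ?\<psi> \<omega> * unav c \<omega> * ennreal (pmf (call_pmf n d) c)) + ?r * ?\<psi> \<omega>"
        by (simp only: distrib_left sum_distrib_left mult.assoc mult.commute [of ?r])
      finally show ?case .
    qed
  qed
  also have "\<dots> = (\<Sum>c\<in>?C. \<integral>\<^sup>+\<omega>. ?\<psi> \<omega> * unav c \<omega> * ennreal (pmf (call_pmf n d) c) \<partial>?M) + ?r * (\<integral>\<^sup>+\<omega>. ?\<psi> \<omega> \<partial>?M)"
    by (subst nn_integral_add, measurable) (subst nn_integral_sum, measurable, subst nn_integral_cmult, measurable)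
  \<comment> \<open>Independence is used backwards: the probability of type \<open>c\<close> becomes
    the indicator that arrival \<open>i\<close> has this type, and a blocked type is then a lost
    call.\<close>
  also have "(\<Sum>c\<in>?C. \<integral>\<^sup>+\<omega>. ?\<psi> \<omega> * unav c \<omega> * ennreal (pmf (call_pmf n d) c) \<partial>?M) =
     (\<Sum>c\<in>?C. \<integral>\<^sup>+\<omega>. ?\<psi> \<omega> * unav c \<omega> * indicator {c} (call \<omega> i, selected \<omega> i) \<partial>?M)"
  proof (rule sum.cong)
    fix c
    have "(\<integral>\<^sup>+\<omega>. (?\<psi> \<omega> * unav c \<omega>) * indicator {c} (call \<omega> i, selected \<omega> i) \<partial>?M) =
       (\<integral>\<^sup>+\<omega>. ?\<psi> \<omega> * unav c \<omega> \<partial>?M) * (\<integral>\<^sup>+c'. indicator {c} c' \<partial>call_pmf n d)"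
      by (rule call_independent) (measurable, simp add: unav_def seen_replace_arrival)
    also have "\<dots> = (\<integral>\<^sup>+\<omega>. ?\<psi> \<omega> * unav c \<omega> * ennreal (pmf (call_pmf n d) c) \<partial>?M)"
      by (simp add: emeasure_pmf_single nn_integral_multc)
    finally show "(\<integral>\<^sup>+\<omega>. ?\<psi> \<omega> * unav c \<omega> * ennreal (pmf (call_pmf n d) c) \<partial>?M) =
      (\<integral>\<^sup>+\<omega>. ?\<psi> \<omega> * unav c \<omega> * indicator {c} (call \<omega> i, selected \<omega> i) \<partial>?M)" by simp
  qed simp
  also have "\<dots> = (\<integral>\<^sup>+\<omega>. (\<Sum>c\<in>?C. ?\<psi> \<omega> * unav c \<omega> * indicator {c} (call \<omega> i, selected \<omega> i)) \<partial>?M)"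
    by (rule nn_integral_sum [symmetric]) (intro borel_measurable_times_ennreal Gm, measurable)
  also have "\<dots> \<le> (\<integral>\<^sup>+\<omega>. ?\<psi> \<omega> * (if route n D (fdar n D) \<omega> i = None then 1 else 0) \<partial>?M)"
  proof (rule nn_integral_mono)
    fix \<omega>
    let ?c = "(call \<omega> i, selected \<omega> i)"
    have "(\<Sum>c\<in>?C. ?\<psi> \<omega> * unav c \<omega> * indicator {c} ?c) \<le> (\<Sum>c\<in>?C. if c = ?c then ?\<psi> \<omega> * unav ?c \<omega> else 0)"
      by (intro sum_mono) (auto simp: indicator_def)
    also have "\<dots> \<le> ?\<psi> \<omega> * unav ?c \<omega>"
      by (simp add: finite_set_call_pmf sum.delta)
    also have "unav ?c \<omega> = (if route n D (fdar n D) \<omega> i = None then 1 else 0)"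
      by (simp add: unav_def fdar_route find_None_iff)
    finally show "(\<Sum>c\<in>?C. ?\<psi> \<omega> * unav c \<omega> * indicator {c} ?c) \<le> ?\<psi> \<omega> * (if route n D (fdar n D) \<omega> i = None then 1 else 0)" .
  qed
  finally show ?thesis by (simp add: add_right_mono)
qed

text \<open>The tangent point is the lower bound \<theta> for the proportion of saturated links
  itself: what remains is \<open>d * \<theta> ^ d - (d - 1) * \<theta> ^ d = \<theta> ^ d\<close>.
  Weights are at most 1, so discounted losses inside the interval count at most once each, and the
  weight after the interval is the fraction \<open>exp (- \<epsilon> * len)\<close> of the
  total.\<close>

lemma mean_lost_lower_bound:
  fixes \<epsilon> len :: real
  assumes \<mu>: "set_pmf \<mu> \<subseteq> states n D" and d: "1 \<le> d" and \<epsilon>: "0 < \<epsilon>" "\<epsilon> \<le> 1" and t1: "0 \<le> t1" and len: "0 \<le> len"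
  defines "\<theta> \<equiv> lam ^ D / (fact (Suc D) * (1 + 2 ^ Suc D * (1 + lam) ^ D))"
  shows "ennreal (rate / \<epsilon> * (\<theta> ^ d - exp (- (\<epsilon> * len)))) \<le> mean_lost n lam d D (fdar n D) \<mu> t1 (t1 + len)"
proof -
  let ?M = "sample_M \<mu>" and ?t2 = "t1 + len" and ?R = "fdar n D"
  let ?\<psi> = "\<lambda>i \<omega>. ennreal (discount \<epsilon> t1 (arrival_time \<omega> i))"
  let ?k = "real d * \<theta> ^ (d - 1) / real (n * (n - 1))" and ?r = "real (d - 1) * \<theta> ^ d"
  let ?lost = "\<lambda>i \<omega>. if route n D ?R \<omega> i = None then 1 else 0 :: ennreal"
  have \<theta>: "0 \<le> \<theta>" unfolding \<theta>_def using lam by (intro divide_nonneg_nonneg mult_nonneg_nonneg add_nonneg_nonneg) auto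
  have k: "0 \<le> ?k" "0 \<le> ?r" using \<theta> by auto
  have W: "0 < rate / \<epsilon>" using rate_pos \<epsilon> by simp
  have [measurable]: "Measurable.pred ?M (\<lambda>\<omega>. route n D ?R \<omega> i = None)" for i
    by (rule measurable_compose [OF measurable_fdar_route, where g = "\<lambda>r. r = None"]) simp
  let ?I = "\<lambda>i \<omega>. if t1 \<le> arrival_time \<omega> i \<and> arrival_time \<omega> i \<le> ?t2 \<and> route n D ?R \<omega> i = None then 1 else 0 :: ennreal"
  have "(\<Sum>i. \<integral>\<^sup>+\<omega>. ?\<psi> i \<omega> * ?lost i \<omega> \<partial>?M) \<le> (\<Sum>i. (\<integral>\<^sup>+\<omega>. ?I i \<omega> \<partial>?M) + (\<integral>\<^sup>+\<omega>. ?\<psi> i \<omega> * indicator {?t2..} (arrival_time \<omega> i) \<partial>?M))"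
  proof (rule suminf_le)
    fix i
    have "(\<integral>\<^sup>+\<omega>. ?\<psi> i \<omega> * ?lost i \<omega> \<partial>?M) \<le> (\<integral>\<^sup>+\<omega>. ?I i \<omega> + ?\<psi> i \<omega> * indicator {?t2..} (arrival_time \<omega> i) \<partial>?M)"
    proof (rule nn_integral_mono)
      fix \<omega>
      have "?\<psi> i \<omega> \<le> 1"
        using \<epsilon> by (auto simp: discount_def intro: mult_nonneg_nonneg)
      then show "?\<psi> i \<omega> * ?lost i \<omega> \<le> ?I i \<omega> + ?\<psi> i \<omega> * indicator {?t2..} (arrival_time \<omega> i)"
        by (auto simp: indicator_def discount_def)
    qed
    also have "\<dots> = (\<integral>\<^sup>+\<omega>. ?I i \<omega> \<partial>?M) + (\<integral>\<^sup>+\<omega>. ?\<psi> i \<omega> * indicator {?t2..} (arrival_time \<omega> i) \<partial>?M)"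
      by (rule nn_integral_add) measurable
    finally show "(\<integral>\<^sup>+\<omega>. ?\<psi> i \<omega> * ?lost i \<omega> \<partial>?M) \<le> (\<integral>\<^sup>+\<omega>. ?I i \<omega> \<partial>?M) + (\<integral>\<^sup>+\<omega>. ?\<psi> i \<omega> * indicator {?t2..} (arrival_time \<omega> i) \<partial>?M)" .
  qed auto
  also have "\<dots> = (\<Sum>i. \<integral>\<^sup>+\<omega>. ?I i \<omega> \<partial>?M) + (\<Sum>i. \<integral>\<^sup>+\<omega>. ?\<psi> i \<omega> * indicator {?t2..} (arrival_time \<omega> i) \<partial>?M)"
    by (rule suminf_add [OF summableI summableI, symmetric])
  also have "(\<Sum>i. \<integral>\<^sup>+\<omega>. ?\<psi> i \<omega> * indicator {?t2..} (arrival_time \<omega> i) \<partial>?M) = ennreal (rate / \<epsilon> * exp (- (\<epsilon> * len)))"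
    using weight_after [OF \<epsilon>(1) t1, of ?t2 \<mu>] len by simp
  also have "(\<Sum>i. \<integral>\<^sup>+\<omega>. ?I i \<omega> \<partial>?M) = (\<integral>\<^sup>+\<omega>. (\<Sum>i. ?I i \<omega>) \<partial>?M)"
    by (rule nn_integral_suminf [symmetric]) measurable
  also have "\<dots> = mean_lost n lam d D ?R \<mu> t1 ?t2"
    unfolding mean_lost_def
  proof (rule nn_integral_cong)
    fix \<omega>
    have "emeasure (count_space UNIV) (lost_calls n D ?R t1 ?t2 \<omega>) = (\<Sum>i. indicator (lost_calls n D ?R t1 ?t2 \<omega>) i)"
      by (simp add: nn_integral_count_space_nat flip: nn_integral_indicator)
    then show "(\<Sum>i. ?I i \<omega>) = emeasure (count_space UNIV) (lost_calls n D ?R t1 ?t2 \<omega>)"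
      by (simp add: lost_calls_def indicator_def of_bool_def)
  qed
  finally have A: "(\<Sum>i. \<integral>\<^sup>+\<omega>. ?\<psi> i \<omega> * ?lost i \<omega> \<partial>?M) \<le> mean_lost n lam d D ?R \<mu> t1 ?t2 + ennreal (rate / \<epsilon> * exp (- (\<epsilon> * len)))" .
  have "ennreal ?k * moment D \<mu> \<epsilon> t1 D \<le> (\<Sum>i. (\<integral>\<^sup>+\<omega>. ?\<psi> i \<omega> * ?lost i \<omega> \<partial>?M) + ennreal ?r * (\<integral>\<^sup>+\<omega>. ?\<psi> i \<omega> \<partial>?M))"
    unfolding moment_def ennreal_suminf_cmult [symmetric]
    by (intro suminf_le lost_weight_lower_bound \<mu> d \<theta>) auto
  also have "\<dots> = (\<Sum>i. \<integral>\<^sup>+\<omega>. ?\<psi> i \<omega> * ?lost i \<omega> \<partial>?M) + ennreal ?r * ennreal (rate / \<epsilon>)"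
    by (simp only: suminf_add [OF summableI summableI, symmetric] ennreal_suminf_cmult total_weight [OF \<epsilon>(1) t1])
  also have "\<dots> \<le> (mean_lost n lam d D ?R \<mu> t1 ?t2 + ennreal (rate / \<epsilon> * exp (- (\<epsilon> * len)))) + ennreal ?r * ennreal (rate / \<epsilon>)"
    by (intro add_right_mono A)
  finally have B: "ennreal ?k * moment D \<mu> \<epsilon> t1 D \<le>
    (mean_lost n lam d D ?R \<mu> t1 ?t2 + ennreal (rate / \<epsilon> * exp (- (\<epsilon> * len)))) + ennreal ?r * ennreal (rate / \<epsilon>)" .
  define a where "a = enn2real (moment D \<mu> \<epsilon> t1 D)"
  have a: "moment D \<mu> \<epsilon> t1 D = ennreal a" "0 \<le> a"
    using moment_finite [OF \<mu> \<epsilon>(1) t1, of D] by (auto simp: a_def)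
  have nn: "0 < real (n * (n - 1))" using n by simp
  have "\<theta> * (real (n * (n - 1)) * (rate / \<epsilon>)) \<le> a"
    unfolding \<theta>_def a_def by (rule saturation_lower_bound [OF \<mu> d \<epsilon> t1])
  then have "?k * (\<theta> * (real (n * (n - 1)) * (rate / \<epsilon>))) \<le> ?k * a"
    using k(1) by (rule mult_left_mono)
  moreover have "?k * (\<theta> * (real (n * (n - 1)) * (rate / \<epsilon>))) = real d * \<theta> ^ d * (rate / \<epsilon>)"
  proof -
    have "c / m * (\<theta> * (m * w)) = c * \<theta> * w" if "0 < m" for c m w :: real using that by simp
    note this [OF nn, of "real d * \<theta> ^ (d - 1)" "rate / \<epsilon>"]
    also have "real d * \<theta> ^ (d - 1) * \<theta> = real d * \<theta> ^ d"
      using d power_minus_mult [of d \<theta>] by (simp only: mult.assoc)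
    finally show ?thesis .
  qed
  ultimately have ka: "real d * \<theta> ^ d * (rate / \<epsilon>) \<le> ?k * a" by (simp only:)
  show ?thesis
  proof (cases "mean_lost n lam d D ?R \<mu> t1 ?t2")
    case (real m)
    have "ennreal (?k * a) \<le> ennreal (m + rate / \<epsilon> * exp (- (\<epsilon> * len)) + ?r * (rate / \<epsilon>))"
      using B k W real a by (simp add: ennreal_mult del: times_divide_eq_left times_divide_eq_right)
    moreover have "0 \<le> m + rate / \<epsilon> * exp (- (\<epsilon> * len)) + ?r * (rate / \<epsilon>)"
      using real(1) \<theta> less_imp_le [OF W] by (intro add_nonneg_nonneg mult_nonneg_nonneg zero_le_power) (assumption | simp)+
    ultimately have "?k * a \<le> m + rate / \<epsilon> * exp (- (\<epsilon> * len)) + ?r * (rate / \<epsilon>)"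
      by (simp only: ennreal_le_iff)
    then have "real d * \<theta> ^ d * (rate / \<epsilon>) \<le> m + rate / \<epsilon> * exp (- (\<epsilon> * len)) + ?r * (rate / \<epsilon>)"
      by (rule order.trans [OF ka])
    moreover have "real d * \<theta> ^ d * (rate / \<epsilon>) = \<theta> ^ d * (rate / \<epsilon>) + ?r * (rate / \<epsilon>)"
      using d by (simp add: of_nat_diff algebra_simps)
    ultimately have "rate / \<epsilon> * (\<theta> ^ d - exp (- (\<epsilon> * len))) \<le> m"
      by (simp add: algebra_simps)
    then show ?thesis using real by (simp add: ennreal_leI)
  qed simp
qed

end

text \<open>Everything except \<open>m ^ m\<close> is exponential in \<open>m\<close>. With
  \<open>m = D\<close>, this makes the proportion of saturated links at least \<open>n\<close> to
  the power \<open>- \<alpha> - o(1)\<close>.\<close>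

lemma saturation_probability_bound:
  fixes lam :: real and m :: nat
  assumes lam: "0 < lam" and m: "1 \<le> m"
  shows "exp (- (m * ln m + m * ln (12 * (1 + lam) / lam))) \<le>
    lam ^ m / (fact (Suc m) * (1 + 2 ^ Suc m * (1 + lam) ^ m))"
proof -
  \<comment> \<open>The 12 is \<open>2 * 6\<close>: one factor 2 per step covers
    \<open>m + 1 \<le> 2 ^ m\<close>, and 6 covers \<open>3 * 2 ^ m \<le> 6 ^ m\<close>.\<close>
  let ?c = "12 * (1 + lam) / lam"
  have c: "0 < ?c" using lam by simp
  have one: "1 \<le> (1 + lam) ^ m" using lam by (intro one_le_power) auto
  have f: "fact (Suc m) \<le> (2 :: real) ^ m * real m ^ m"
  proof -
    have "real (Suc m) \<le> 2 ^ m"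
      using Suc_leI [OF less_exp [of m]] by (metis of_nat_le_iff of_nat_numeral of_nat_power)
    moreover have "(fact m :: real) \<le> real m ^ m"
      using fact_le_power [of m, where 'a = real] by simp
    ultimately show ?thesis by (simp only: fact_Suc) (intro mult_mono, auto)
  qed
  have g: "1 + 2 ^ Suc m * (1 + lam) ^ m \<le> 6 ^ m * (1 + lam) ^ m"
  proof -
    have "(3 :: real) \<le> 3 ^ m" using m by (metis one_le_numeral power_increasing power_one_right)
    then have "3 * 2 ^ m \<le> (3 :: real) ^ m * 2 ^ m" by (intro mult_right_mono) auto
    then have six: "3 * 2 ^ m \<le> (6 :: real) ^ m" by (simp flip: power_mult_distrib)
    have "1 \<le> 2 ^ m * (1 + lam) ^ m" using one by (intro mult_ge1_I) auto
    then have "1 + 2 ^ Suc m * (1 + lam) ^ m \<le> (3 * 2 ^ m) * (1 + lam) ^ m" by (simp add: mult.commute)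
    also have "\<dots> \<le> 6 ^ m * (1 + lam) ^ m" using six lam by (intro mult_right_mono) auto
    finally show ?thesis .
  qed
  have "fact (Suc m) * (1 + 2 ^ Suc m * (1 + lam) ^ m) \<le> (2 ^ m * real m ^ m) * (6 ^ m * (1 + lam) ^ m)"
    using f g lam by (intro mult_mono) (auto intro!: add_nonneg_nonneg)
  also have "\<dots> = lam ^ m * (real m ^ m * ?c ^ m)"
  proof -
    have "lam * (12 * (1 + lam) / lam) = 2 * (6 * (1 + lam))" using lam by simp
    then have "lam ^ m * ?c ^ m = 2 ^ m * (6 ^ m * (1 + lam) ^ m)"
      by (simp only: power_mult_distrib [symmetric])
    then have "real m ^ m * (2 ^ m * (6 ^ m * (1 + lam) ^ m)) = real m ^ m * (lam ^ m * ?c ^ m)"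
      by (simp only:)
    then show ?thesis by (simp only: mult.left_commute mult.assoc)
  qed
  also have "real m ^ m * ?c ^ m = exp (m * ln m + m * ln ?c)"
    using m c by (simp add: exp_add exp_of_nat_mult)
  finally have le: "fact (Suc m) * (1 + 2 ^ Suc m * (1 + lam) ^ m) \<le> lam ^ m * exp (m * ln m + m * ln ?c)" .
  have pos: "0 < fact (Suc m) * (1 + 2 ^ Suc m * (1 + lam) ^ m)"
    using lam by (intro mult_pos_pos add_pos_nonneg) auto
  have "inverse y \<le> v / x" if "x \<le> v * y" "0 < x" "0 < y" for v x y :: real
    using that by (simp add: divide_simps mult.commute)
  from this [OF le pos exp_gt_zero] show ?thesis
    unfolding exp_minus .
qed

theorem K_bad_below_threshold:
  fixes lam \<alpha> K :: real and d :: nat and D :: "nat \<Rightarrow> nat"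
  assumes lam: "lam > 0" and d: "d \<ge> 1" and \<alpha>0: "\<alpha> > 0" and \<alpha>: "\<alpha> \<le> 2 / real d" and K: "K > 0"
    and D: "(\<lambda>n. real (D n)) \<sim>[at_top] (\<lambda>n. \<alpha> * (ln (real n) / ln (ln (real n))))"
  shows "K_bad lam d D K"
  unfolding K_bad_def
proof (intro allI impI)
  fix \<mu> :: "nat \<Rightarrow> load_vector pmf" and t1 :: "nat \<Rightarrow> real"
  assume H: "\<forall>n\<ge>3. set_pmf (\<mu> n) \<subseteq> states n (D n) \<and> 0 \<le> t1 n"
  let ?m = "\<lambda>n. mean_lost n lam d (D n) (fdar n (D n)) (\<mu> n) (t1 n) (t1 n + real n powr K)"
  \<comment> \<open>The error \<delta> in the exponent of \<theta> becomes
    \<open>\<delta> * d = K / 8\<close> in that of \<open>\<theta> ^ d\<close>.\<close>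
  define \<delta> where "\<delta> = K / (8 * real d)"
  have \<delta>: "0 < \<delta>" using K d by (simp add: \<delta>_def)
  define C where "C = ln (12 * (1 + lam) / lam)"
  note cap = capacity_asymptotics [OF \<alpha>0 D]
  have "(\<lambda>n. real (D n) * ln (real (D n)) / ln (real n) + C * (real (D n) / ln (real n))) \<longlonglongrightarrow> \<alpha> + C * 0"
    by (intro tendsto_intros cap)
  then have "(\<lambda>n. real (D n) * ln (real (D n)) / ln (real n) + C * (real (D n) / ln (real n))) \<longlonglongrightarrow> \<alpha>"
    by simp
  from order_tendstoD(2) [OF this, of "\<alpha> + \<delta>"] \<delta>
  have ev1: "eventually (\<lambda>n. real (D n) * ln (real (D n)) / ln (real n) + C * (real (D n) / ln (real n)) < \<alpha> + \<delta>) sequentially"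
    by simp
  have D1: "eventually (\<lambda>n. 1 \<le> real (D n)) sequentially"
    using cap(3) unfolding filterlim_at_top by blast
  \<comment> \<open>The weight beyond the interval costs at most half of
    \<open>\<theta> ^ d\<close>.\<close>
  have ev2: "eventually (\<lambda>n::nat. exp (- (real n powr (K / 2))) \<le> real n powr (- (2 + K / 8)) / 2) sequentially"
    using K by real_asymp
  have ev3: "eventually (\<lambda>n::nat. real n powr (K / 4) \<le> lam / 8 * real n powr (3 * K / 8)) sequentially"
    using K lam by real_asymp
  have "eventually (\<lambda>n. ennreal (real n powr (K / 4)) \<le> ?m n) sequentially"
    using ev1 ev2 ev3 D1 eventually_ge_at_top [of "3::nat"]
  proof eventually_elim
    case (elim n)
    interpret network n d lam by unfold_locales (use elim lam in auto)
    have lnn: "0 < ln (real n)" using elim(5) by simp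
    let ?\<theta> = "lam ^ D n / (fact (Suc (D n)) * (1 + 2 ^ Suc (D n) * (1 + lam) ^ D n))"
    \<comment> \<open>Small enough to gain the factor \<open>n powr (K / 2)\<close> from
      \<open>1 / \<epsilon>\<close>, large enough that \<epsilon> times the length of the interval
      still grows like a power of \<open>n\<close>.\<close>
    let ?\<epsilon> = "real n powr (- (K / 2))"
    have Dn: "1 \<le> D n" using elim(4) by simp
    have "real n powr (- (\<alpha> + \<delta>)) = exp (- ((\<alpha> + \<delta>) * ln n))"
      using elim(5) by (simp add: powr_def algebra_simps)
    also have "\<dots> \<le> exp (- (D n * ln (D n) + D n * C))"
    proof -
      have "(D n * ln (D n) + D n * C) / ln n < \<alpha> + \<delta>" using elim(1) by (simp add: add_divide_distrib mult.commute)
      then show ?thesis using lnn by (simp add: divide_less_eq)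
    qed
    also have "\<dots> \<le> ?\<theta>"
      unfolding C_def by (rule saturation_probability_bound [OF lam Dn])
    finally have \<theta>: "real n powr (- (\<alpha> + \<delta>)) \<le> ?\<theta>" .
    have "real n powr (- (2 + K / 8)) \<le> real n powr (- (\<alpha> + \<delta>) * real d)"
    proof (rule powr_mono)
      have "\<alpha> * real d \<le> 2" using \<alpha> d by (simp add: field_simps)
      moreover have "\<delta> * real d = K / 8" using d by (simp add: \<delta>_def)
      ultimately show "- (2 + K / 8) \<le> - (\<alpha> + \<delta>) * real d" by (simp add: algebra_simps)
    qed (use elim in simp)
    also have "\<dots> = (real n powr (- (\<alpha> + \<delta>))) ^ d"
      using elim(5) by (simp add: powr_powr flip: powr_realpow)
    also have "\<dots> \<le> ?\<theta> ^ d"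
      by (rule power_mono [OF \<theta>]) simp
    finally have \<theta>d: "real n powr (- (2 + K / 8)) \<le> ?\<theta> ^ d" .
    have \<epsilon>: "0 < ?\<epsilon>" "?\<epsilon> \<le> 1"
    proof -
      show "0 < ?\<epsilon>" using elim(5) by simp
      have "?\<epsilon> \<le> real n powr 0" using elim(5) K by (intro powr_mono) auto
      then show "?\<epsilon> \<le> 1" using elim(5) by simp
    qed
    have el: "?\<epsilon> * real n powr K = real n powr (K / 2)"
      by (simp flip: powr_add)
    have "real n ^ 2 / 4 \<le> real (n choose 2)"
    proof -
      have "real (2 * (n choose 2)) = real n * (real n - 1)"
        unfolding two_times_choose_two using elim(5) by (simp add: of_nat_diff)
      moreover have "real n * (real n / 2) \<le> real n * (real n - 1)"
        using elim(5) by (intro mult_left_mono) auto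
      ultimately show ?thesis by (simp add: power2_eq_square)
    qed
    then have rate: "lam / 4 * real n powr 2 \<le> rate"
      using lam elim(5) unfolding rate_def by (simp add: powr_numeral)
    \<comment> \<open>The exponents are 2 from the rate, \<open>K / 2\<close> from
      \<open>1 / \<epsilon>\<close> and \<open>- (2 + K / 8)\<close> from
      \<open>\<theta> ^ d\<close>, in total \<open>3 * K / 8\<close>; stepping down to
      \<open>K / 4\<close> absorbs the constant \<open>lam / 8\<close>.\<close>
    have "real n powr (K / 4) \<le> lam / 8 * real n powr (3 * K / 8)" by (rule elim(3))
    also have "\<dots> = (lam / 4 * real n powr 2) * (real n powr (K / 2) * (real n powr (- (2 + K / 8)) / 2))"
    proof -
      have "3 * K / 8 = 2 + (K / 2 + - (2 + K / 8))" by simp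
      then have "real n powr (3 * K / 8) = real n powr 2 * (real n powr (K / 2) * real n powr (- (2 + K / 8)))"
        by (metis powr_add)
      then show ?thesis by simp
    qed
    also have "\<dots> \<le> rate * (real n powr (K / 2) * (?\<theta> ^ d - exp (- (?\<epsilon> * real n powr K))))"
    proof (intro mult_mono rate mult_left_mono)
      show "real n powr (- (2 + K / 8)) / 2 \<le> ?\<theta> ^ d - exp (- (?\<epsilon> * real n powr K))"
        using elim(2) \<theta>d unfolding el by linarith
    qed (use rate_pos in auto)
    also have "\<dots> = rate / ?\<epsilon> * (?\<theta> ^ d - exp (- (?\<epsilon> * real n powr K)))"
      by (simp add: powr_minus field_simps)
    finally have "ennreal (real n powr (K / 4)) \<le> ennreal (rate / ?\<epsilon> * (?\<theta> ^ d - exp (- (?\<epsilon> * real n powr K))))"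
      by (rule ennreal_leI)
    also have "\<dots> \<le> ?m n"
      by (rule mean_lost_lower_bound) (use H elim d \<epsilon> in auto)
    finally show ?case .
  qed
  then show "\<exists>c>0. \<forall>\<^sub>F n in sequentially. ennreal (real n powr c) \<le> ?m n"
    using K by (intro exI [of _ "K / 4"]) simp
qed

theorem theorem1p1:
  fixes lam \<alpha> :: real and d :: nat and D :: "nat \<Rightarrow> nat"
  assumes "lam > 0" and "d \<ge> 1" and "\<alpha> > 0"
    and "(\<lambda>n. real (D n)) \<sim>[at_top] (\<lambda>n. \<alpha> * (ln (real n) / ln (ln (real n))))"
  shows "(\<alpha> > 2 / real d \<longrightarrow> (\<exists>K>0. K_good lam d D K)) \<and>
         (\<alpha> \<le> 2 / real d \<longrightarrow> (\<forall>K>0. K_bad lam d D K))"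
proof (intro conjI impI allI)
  assume "\<alpha> > 2 / real d"
  then show "\<exists>K>0. K_good lam d D K"
    by (rule K_good_above_threshold [OF assms(1,2) _ assms(4)])
next
  fix K :: real
  assume "\<alpha> \<le> 2 / real d" "K > 0"
  then show "K_bad lam d D K"
    by (rule K_bad_below_threshold [OF assms(1,2,3) _ _ assms(4)])
qed

end
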